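(* Consider a MISO system ($p=1$) with data generated, partitioned and corrupted by noise bounded by $\delta$ as described in the context, and assume $\delta<\sigma_{\min}(\widehat H)/(2l_{\mathrm h})$. Let $\check u_{\mathrm f}$ be a minimizer of $u_{\mathrm f}\mapsto c_{\mathrm{worst}}(u_{\mathrm f})$, let $u_{\mathrm f}^*=\mathrm{argmin}_{u_{\mathrm f}}\|\bar y_{\mathrm f}(u_{\mathrm f})\|^2+\|u_{\mathrm f}\|^2$ and $\hat u_{\mathrm f}^*=\mathrm{argmin}_{u_{\mathrm f}}\|\hat y_{\mathrm f}(u_{\mathrm f})\|^2+\|u_{\mathrm f}\|^2$. With $\widehat{\mathcal Y}=(\widehat Y_{\mathrm p},\widehat Y_{\mathrm f},\hat y_{\mathrm p})$ and $\eta(\delta,\widehat{\mathcal Y})$ as defined in the context, put $$\begin{aligned} \mathcal C_1(\delta,\widehat{\mathcal Y})&:=2\sigma_{\min}^{-1}(\widehat H)\bigl(\sqrt{l_{\mathrm p}}+\eta(\delta,\widehat{\mathcal Y})\,l_{\mathrm h}\|\hat g(\hat u_{\mathrm f}^* )\|\bigr)\delta,\\ \mathcal C_2(\delta,\widehat{\mathcal Y})&:=(\|\widehat Y_{\mathrm f}\|+l_{\mathrm h}\delta)\,\mathcal C_1(\delta,\widehat{\mathcal Y})+\eta(\delta,\widehat{\mathcal Y})\,l_{\mathrm h}\|\hat g(\hat u_{\mathrm f}^* )\|\delta,\\ \mathcal C_3(\delta,\widehat{\mathcal Y})&:=8\bigl(\mathcal C_2(\delta,\widehat{\mathcal Y})\bigr)^2+4\|\widehat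 Y_{\mathrm f}\|\,\|\hat g(\hat u_{\mathrm f}^* )\|\,\eta(\delta,\widehat{\mathcal Y})\,\mathcal C_2(\delta,\widehat{\mathcal Y}). \end{aligned}$$ Then $$\bar c(\check u_{\mathrm f})-\bar c(u_{\mathrm f}^* )\le\mathcal C_3(\delta,\widehat{\mathcal Y}).$$ Moreover, $\mathcal C_3(\delta,\widehat{\mathcal Y})$, which is computable from $\delta$, the inputs and the noisy measurements only, converges in probability to $0$ as $\delta\to0$.
   Context: Norms: $\|\cdot\|$ is the Euclidean norm of a vector and the spectral norm of a matrix; $\|M\|_{\max}=\max_{i,j}|m_{ij}|$; $\sigma_{\min}$ is the smallest singular value; $\dagger$ is the Moore–Penrose pseudoinverse. For a sequence $v$, $v_{[a,b]}=\{v_a,\dots,v_b\}$ and $\mathrm{col}(v_{[a,b]})$ is the stacked column vector. System: $x_{t+1}=Ax_t+Bu_t$, $y_t=Cx_t+Du_t$ with $u_t\in\mathbb R^m$, $y_t\in\mathbb R^p$, $x_t\in\mathbb R^{n_x}$, controllable and observable (minimal realization); MISO means $p=1$. The observability index $l_{\mathrm o}$ is the smallest positive integer $l$ such that $[C^\top\ (CA)^\top\ \cdots\ (CA^{l-1})^\top]^\top$ has full column rank. Page matrices: for a sequence $v_{[1,T]}$ and $l_{\mathrm h}=\lfloor T/L\rfloor$, $\mathcal P_L(v_{[1,T]})$ is the matrix with $l_{\mathrm h}$ columns whose $j$-th column is $\mathrm{col}(v_{[(j-1)L+1,\,jL]})$ (and similarly for sequences starting at another index). The sequence $u_{[1,T]}$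 is $L$-Page exciting of order $d$ if the matrix obtained by stacking vertically $\mathcal P_L(u_{[1,T-(d-1)L]})$, $\mathcal P_L(u_{[L+1,T-(d-2)L]})$, ..., $\mathcal P_L(u_{[L(d-1)+1,T]})$ has full row rank. Historical data: $L>l_{\mathrm o}$; $x_1=0$; the blocks $u_{[1,L]},u_{[L+1,2L]},\dots,u_{[4L^2+1,4L^2+L]}$ are i.i.d. with law $\mathcal Q$ on $\mathbb R^{mL}$, where $\mathcal Q$ gives probability $0$ to every subspace $V\subsetneqq\mathbb R^{mL}$; $T\ge 4L^2+L$ and $u_{[1,T]}$ is $L$-Page exciting of order $n_x+1$. $y_{[1,T]}$ is the resulting noiseless output and $\hat y_{[1,T]}$ the noisy measurement. Partition: $l_{\mathrm p}=l_{\mathrm o}$, $l_{\mathrm f}=L-l_{\mathrm p}$. $U_{\mathrm p}$ and $U_{\mathrm f}$ are the first $ml_{\mathrm p}$ and last $ml_{\mathrm f}$ rows of $\mathcal P_L(u_{[1,T]})$; $Y_{\mathrm p},Y_{\mathrm f}$ (resp. $\widehat Y_{\mathrm p},\widehat Y_{\mathrm f}$) are the first $pl_{\mathrm p}$ and last $pl_{\mathrm f}$ rows of $\mathcal P_L(y_{[1,T]})$ (resp. $\mathcal P_L(\hat y_{[1,T]})$). A recent trajectory $(u^r_{[1,l_{\mathrm p}]},y^r_{[1,l_{\mathrm p}]})$ of the system is given, $u_{\mathrm p}=\mathrm{col}(u^r_{[1,l_{\mathrm p}]})$, $y_{\mathrm p}=\mathrm{col}(y^r_{[1,l_{\mathrm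 p}]})$, and $\hat y_{\mathrm p}$ is the noisy measurement of $y_{\mathrm p}$. Noise bound: for a known constant $\delta>0$, $\max\{\|\widehat Y_{\mathrm p}-Y_{\mathrm p}\|_{\max},\|\widehat Y_{\mathrm f}-Y_{\mathrm f}\|_{\max},\|\hat y_{\mathrm p}-y_{\mathrm p}\|_\infty\}\le\delta$. In the limit $\delta\to0$ the system, the inputs and the noiseless trajectories do not depend on $\delta$; only the noise does, and it satisfies this bound for each $\delta$. Predictor: $\widehat H=[U_{\mathrm p}^\top\ \widehat Y_{\mathrm p}^\top\ U_{\mathrm f}^\top]^\top$, $\hat b(u_{\mathrm f})=[u_{\mathrm p}^\top\ \hat y_{\mathrm p}^\top\ u_{\mathrm f}^\top]^\top$, $\hat g(u_{\mathrm f})=\widehat H^\dagger\hat b(u_{\mathrm f})$, $\hat y_{\mathrm f}(u_{\mathrm f})=\widehat Y_{\mathrm f}\hat g(u_{\mathrm f})$ for $u_{\mathrm f}\in\mathbb R^{ml_{\mathrm f}}$. The noiseless counterparts are $\overline H=[U_{\mathrm p}^\top\ Y_{\mathrm p}^\top\ U_{\mathrm f}^\top]^\top$, $\bar b(u_{\mathrm f})=[u_{\mathrm p}^\top\ y_{\mathrm p}^\top\ u_{\mathrm f}^\top]^\top$, $\bar g(u_{\mathrm f})=\overline H^\dagger\bar b(u_{\mathrm f})$, $\bar y_{\mathrm f}(u_{\mathrm f})=Y_{\mathrm f}\bar g(u_{\mathrm f})$. Costs: the true regulation cost is $\bar c(u_{\mathrm f})=\|\bar y_{\mathrm f}(u_{\mathrm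 f})\|^2+\|u_{\mathrm f}\|^2$. With $\mathcal C(u_{\mathrm f})=2\sigma_{\min}(\widehat H)^{-1}(\sqrt{l_{\mathrm p}}+l_{\mathrm h}\|\hat g(u_{\mathrm f})\|)$, $c_{\mathrm{worst}}(u_{\mathrm f})$ is the maximum of $\|y_{\mathrm f}\|^2+\|u_{\mathrm f}\|^2$ over all $(\Delta_{Y_{\mathrm p}},\Delta_{Y_{\mathrm f}},\Delta_{y_{\mathrm p}},g,y_{\mathrm f})$ satisfying $U_{\mathrm p}g=u_{\mathrm p}$, $(\widehat Y_{\mathrm p}+\Delta_{Y_{\mathrm p}})g=\hat y_{\mathrm p}+\Delta_{y_{\mathrm p}}$, $U_{\mathrm f}g=u_{\mathrm f}$, $(\widehat Y_{\mathrm f}+\Delta_{Y_{\mathrm f}})g=y_{\mathrm f}$, $\max(\|\Delta_{Y_{\mathrm p}}\|_{\max},\|\Delta_{Y_{\mathrm f}}\|_{\max},\|\Delta_{y_{\mathrm p}}\|_\infty)\le\delta$ and $\|g-\hat g(u_{\mathrm f})\|^2\le\mathcal C^2(u_{\mathrm f})\delta^2$. Definition of $\eta$: let $\widehat K_1=\widehat Y_{\mathrm f}\widehat H^\dagger$, $\widehat K_2=\widehat K_1[0\ 0\ I]^\top$ (the last $ml_{\mathrm f}$ columns of $\widehat K_1$), and $$\begin{aligned} \mathcal F_1&=2l_{\mathrm h}\|\widehat H^\dagger\|(1+4\|\widehat Y_{\mathrm f}\|\,\|\widehat H^\dagger\|)\delta,\qquad \mathcal F_2=(2\|\widehat K_1\|+\mathcal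 F_1)\mathcal F_1,\\ \mathcal F_3&=\sqrt{l_{\mathrm p}}\,\|\widehat K_2^\top\widehat K_1\|\delta+(\|\hat b(0)\|+\sqrt{l_{\mathrm p}}\,\delta)\mathcal F_2,\\ \mathcal F&=\|(\widehat K_2^\top\widehat K_2+I)^{-1}\|\mathcal F_3+(\|\widehat K_2^\top\widehat K_1\hat b(0)\|+\mathcal F_3)\mathcal F_2 . \end{aligned}$$ Then $\eta(\delta,\widehat{\mathcal Y})=1+\|\widehat H^\dagger\|\mathcal F/\|\hat g(\hat u_{\mathrm f}^* )\|$, where $\hat g(\hat u_{\mathrm f}^* )\ne0$ is understood so that $\eta$ is well defined. *)

theory Defs
  imports
    "HOL-Probability.Probability"
    "Jordan_Normal_Form.DL_Rank"
    "Jordan_Normal_Form.Char_Poly"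
    "Jordan_Normal_Form.Gauss_Jordan_Elimination"
begin

no_notation Finite_Cartesian_Product.vec_nth (infixl \<open>$\<close> 90)
hide_const (open) Finite_Cartesian_Product.vec Finite_Cartesian_Product.mat
  Finite_Cartesian_Product.row Finite_Cartesian_Product.transpose

section \<open>Norms, singular values, pseudoinverse, block matrices\<close>

definition vnorm :: "real vec \<Rightarrow> real" where
  "vnorm v = L2_set (\<lambda>i. v $ i) {..<dim_vec v}"

definition vnorm_inf :: "real vec \<Rightarrow> real" where
  "vnorm_inf v = Max {\<bar>v $ i\<bar> | i. i < dim_vec v}"

definition max_norm :: "real mat \<Rightarrow> real" where
  "max_norm M = Max {\<bar>M $$ (i, j)\<bar> | i j. i < dim_row M \<and> j < dim_col M}"

definition spectral_norm :: "real mat \<Rightarrow> real" where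
  "spectral_norm M = Sup {vnorm (M *\<^sub>v x) | x. x \<in> carrier_vec (dim_col M) \<and> vnorm x \<le> 1}"

text \<open>An \<open>r \<times> c\<close> matrix has \<open>min r c\<close> singular values, namely the square roots of the
  eigenvalues of the smaller of its two Gram matrices.\<close>

definition sigma_min :: "real mat \<Rightarrow> real" where
  "sigma_min M = sqrt (Min {k. eigenvalue
     (if dim_row M \<le> dim_col M then M * M\<^sup>T else M\<^sup>T * M) k})"

definition is_pinv :: "real mat \<Rightarrow> real mat \<Rightarrow> bool" where
  "is_pinv M X \<longleftrightarrow> X \<in> carrier_mat (dim_col M) (dim_row M) \<and>
     M * X * M = M \<and> X * M * X = X \<and> (M * X)\<^sup>T = M * X \<and> (X * M)\<^sup>T = X * M"

definition pinv :: "real mat \<Rightarrow> real mat" where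
  "pinv M = (THE X. is_pinv M X)"

definition full_row_rank :: "real mat \<Rightarrow> bool" where
  "full_row_rank M \<longleftrightarrow> vec_space.rank (dim_row M) M = dim_row M"

definition full_col_rank :: "real mat \<Rightarrow> bool" where
  "full_col_rank M \<longleftrightarrow> vec_space.rank (dim_row M) M = dim_col M"

text \<open>Vertical stack of \<open>Ms 0, \<dots>, Ms (d - 1)\<close>, all of size \<open>r \<times> c\<close>.\<close>

definition vstack :: "nat \<Rightarrow> nat \<Rightarrow> nat \<Rightarrow> (nat \<Rightarrow> real mat) \<Rightarrow> real mat" where
  "vstack r c d Ms = mat (r * d) c (\<lambda>(i, j). Ms (i div r) $$ (i mod r, j))"

definition first_rows :: "nat \<Rightarrow> real mat \<Rightarrow> real mat" where
  "first_rows k M = mat k (dim_col M) (\<lambda>(i, j). M $$ (i, j))"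

definition last_rows :: "nat \<Rightarrow> real mat \<Rightarrow> real mat" where
  "last_rows k M = mat k (dim_col M) (\<lambda>(i, j). M $$ (dim_row M - k + i, j))"

section \<open>Linear systems\<close>

definition is_trajectory ::
  "real mat \<Rightarrow> real mat \<Rightarrow> real mat \<Rightarrow> real mat \<Rightarrow> nat \<Rightarrow> nat \<Rightarrow>
   (nat \<Rightarrow> real vec) \<Rightarrow> (nat \<Rightarrow> real vec) \<Rightarrow> (nat \<Rightarrow> real vec) \<Rightarrow> bool" where
  "is_trajectory A B C D a b x u y \<longleftrightarrow> (\<forall>t\<in>{a..b}.
     x t \<in> carrier_vec (dim_col A) \<and> u t \<in> carrier_vec (dim_col B) \<and>
     x (Suc t) = A *\<^sub>v x t + B *\<^sub>v u t \<and>
     y t = C *\<^sub>v x t + D *\<^sub>v u t)"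

definition obs_mat :: "real mat \<Rightarrow> real mat \<Rightarrow> nat \<Rightarrow> real mat" where
  "obs_mat A C l = vstack (dim_row C) (dim_col A) l (\<lambda>k. C * A ^\<^sub>m k)"

definition ctrb_mat :: "real mat \<Rightarrow> real mat \<Rightarrow> nat \<Rightarrow> real mat" where
  "ctrb_mat A B l = mat (dim_row A) (dim_col B * l)
     (\<lambda>(i, j). (A ^\<^sub>m (j div dim_col B) * B) $$ (i, j mod dim_col B))"

definition controllable :: "real mat \<Rightarrow> real mat \<Rightarrow> bool" where
  "controllable A B \<longleftrightarrow> full_row_rank (ctrb_mat A B (dim_row A))"

definition observable :: "real mat \<Rightarrow> real mat \<Rightarrow> bool" where
  "observable A C \<longleftrightarrow> full_col_rank (obs_mat A C (dim_row A))"

definition obs_index :: "real mat \<Rightarrow> real mat \<Rightarrow> nat" where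
  "obs_index A C = (LEAST l. 0 < l \<and> full_col_rank (obs_mat A C l))"

section \<open>Page matrices and data\<close>

text \<open>Sequences are indexed from 1, as functions on the naturals; \<open>q\<close> is the dimension of
  their members.\<close>

definition col_seq :: "nat \<Rightarrow> nat \<Rightarrow> nat \<Rightarrow> (nat \<Rightarrow> real vec) \<Rightarrow> real vec" where
  "col_seq q a b v = vec (q * (b + 1 - a)) (\<lambda>i. v (a + i div q) $ (i mod q))"

definition page_mat :: "nat \<Rightarrow> nat \<Rightarrow> nat \<Rightarrow> nat \<Rightarrow> (nat \<Rightarrow> real vec) \<Rightarrow> real mat" where
  "page_mat q L a b v = mat_of_cols (q * L)
     (map (\<lambda>j. col_seq q (a + j * L) (a + j * L + L - 1) v) [0..<(b + 1 - a) div L])"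

definition page_exciting :: "nat \<Rightarrow> nat \<Rightarrow> nat \<Rightarrow> nat \<Rightarrow> (nat \<Rightarrow> real vec) \<Rightarrow> bool" where
  "page_exciting q L d T v \<longleftrightarrow> full_row_rank (vstack (q * L) ((T - (d - 1) * L) div L) d
     (\<lambda>k. page_mat q L (k * L + 1) (T - (d - 1 - k) * L) v))"

record data =
  U_p :: "real mat"
  Y_p :: "real mat"
  U_f :: "real mat"
  Y_f :: "real mat"
  u_p :: "real vec"
  y_p :: "real vec"

text \<open>Applied to noiseless outputs this gives the noiseless data, applied to measured outputs
  the noisy data. The sequences \<open>ur\<close>, \<open>yr\<close> are the recent ones.\<close>

definition mk_data :: "nat \<Rightarrow> nat \<Rightarrow> nat \<Rightarrow> nat \<Rightarrow> nat \<Rightarrow>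
   (nat \<Rightarrow> real vec) \<Rightarrow> (nat \<Rightarrow> real vec) \<Rightarrow> (nat \<Rightarrow> real vec) \<Rightarrow> (nat \<Rightarrow> real vec) \<Rightarrow> data" where
  "mk_data m p L lp T u y ur yr = \<lparr>
     U_p = first_rows (m * lp) (page_mat m L 1 T u),
     Y_p = first_rows (p * lp) (page_mat p L 1 T y),
     U_f = last_rows (m * (L - lp)) (page_mat m L 1 T u),
     Y_f = last_rows (p * (L - lp)) (page_mat p L 1 T y),
     u_p = col_seq m 1 lp ur,
     y_p = col_seq p 1 lp yr \<rparr>"

definition noise_bound :: "real \<Rightarrow> data \<Rightarrow> data \<Rightarrow> bool" where
  "noise_bound \<delta> dh d \<longleftrightarrow>
     Max {max_norm (Y_p dh - Y_p d), max_norm (Y_f dh - Y_f d), vnorm_inf (y_p dh - y_p d)} \<le> \<delta>"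

section \<open>Predictor and costs\<close>

definition H_mat :: "data \<Rightarrow> real mat" where
  "H_mat d = U_p d @\<^sub>r Y_p d @\<^sub>r U_f d"

definition b_vec :: "data \<Rightarrow> real vec \<Rightarrow> real vec" where
  "b_vec d uf = u_p d @\<^sub>v y_p d @\<^sub>v uf"

definition g_vec :: "data \<Rightarrow> real vec \<Rightarrow> real vec" where
  "g_vec d uf = pinv (H_mat d) *\<^sub>v b_vec d uf"

definition y_pred :: "data \<Rightarrow> real vec \<Rightarrow> real vec" where
  "y_pred d uf = Y_f d *\<^sub>v g_vec d uf"

definition reg_cost :: "data \<Rightarrow> real vec \<Rightarrow> real" where
  "reg_cost d uf = (vnorm (y_pred d uf))\<^sup>2 + (vnorm uf)\<^sup>2"

definition inputs_f :: "data \<Rightarrow> real vec set" where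
  "inputs_f d = carrier_vec (dim_row (U_f d))"

definition u_opt :: "data \<Rightarrow> real vec" where
  "u_opt d = arg_min_on (reg_cost d) (inputs_f d)"

definition C_radius :: "nat \<Rightarrow> nat \<Rightarrow> data \<Rightarrow> real vec \<Rightarrow> real" where
  "C_radius lp lh d uf = 2 * inverse (sigma_min (H_mat d)) * (sqrt lp + lh * vnorm (g_vec d uf))"

definition worst_feasible :: "nat \<Rightarrow> nat \<Rightarrow> real \<Rightarrow> data \<Rightarrow> real vec \<Rightarrow>
   real mat \<Rightarrow> real mat \<Rightarrow> real vec \<Rightarrow> real vec \<Rightarrow> real vec \<Rightarrow> bool" where
  "worst_feasible lp lh \<delta> d uf DYp DYf Dyp g yf \<longleftrightarrow>
     DYp \<in> carrier_mat (dim_row (Y_p d)) (dim_col (Y_p d)) \<and>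
     DYf \<in> carrier_mat (dim_row (Y_f d)) (dim_col (Y_f d)) \<and>
     Dyp \<in> carrier_vec (dim_vec (y_p d)) \<and>
     g \<in> carrier_vec (dim_col (H_mat d)) \<and>
     yf \<in> carrier_vec (dim_row (Y_f d)) \<and>
     U_p d *\<^sub>v g = u_p d \<and>
     (Y_p d + DYp) *\<^sub>v g = y_p d + Dyp \<and>
     U_f d *\<^sub>v g = uf \<and>
     (Y_f d + DYf) *\<^sub>v g = yf \<and>
     Max {max_norm DYp, max_norm DYf, vnorm_inf Dyp} \<le> \<delta> \<and>
     (vnorm (g - g_vec d uf))\<^sup>2 \<le> (C_radius lp lh d uf)\<^sup>2 * \<delta>\<^sup>2"

text \<open>The feasible set is compact, so that the supremum is a maximum whenever it is nonempty.\<close>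

definition c_worst :: "nat \<Rightarrow> nat \<Rightarrow> real \<Rightarrow> data \<Rightarrow> real vec \<Rightarrow> real" where
  "c_worst lp lh \<delta> d uf = Sup {(vnorm yf)\<^sup>2 + (vnorm uf)\<^sup>2 | DYp DYf Dyp g yf.
     worst_feasible lp lh \<delta> d uf DYp DYf Dyp g yf}"

section \<open>Suboptimality bound\<close>

definition K1_mat :: "data \<Rightarrow> real mat" where
  "K1_mat d = Y_f d * pinv (H_mat d)"

definition K2_mat :: "data \<Rightarrow> real mat" where
  "K2_mat d = (let k = dim_row (U_p d) + dim_row (Y_p d); mf = dim_row (U_f d) in
     K1_mat d * (0\<^sub>m k mf @\<^sub>r 1\<^sub>m mf))"

definition F1 :: "nat \<Rightarrow> real \<Rightarrow> data \<Rightarrow> real" where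
  "F1 lh \<delta> d = 2 * lh * spectral_norm (pinv (H_mat d)) *
     (1 + 4 * spectral_norm (Y_f d) * spectral_norm (pinv (H_mat d))) * \<delta>"

definition F2 :: "nat \<Rightarrow> real \<Rightarrow> data \<Rightarrow> real" where
  "F2 lh \<delta> d = (2 * spectral_norm (K1_mat d) + F1 lh \<delta> d) * F1 lh \<delta> d"

definition b0 :: "data \<Rightarrow> real vec" where
  "b0 d = b_vec d (0\<^sub>v (dim_row (U_f d)))"

definition F3 :: "nat \<Rightarrow> nat \<Rightarrow> real \<Rightarrow> data \<Rightarrow> real" where
  "F3 lp lh \<delta> d = sqrt lp * spectral_norm ((K2_mat d)\<^sup>T * K1_mat d) * \<delta> +
     (vnorm (b0 d) + sqrt lp * \<delta>) * F2 lh \<delta> d"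

definition F_bound :: "nat \<Rightarrow> nat \<Rightarrow> real \<Rightarrow> data \<Rightarrow> real" where
  "F_bound lp lh \<delta> d =
     spectral_norm (the (mat_inverse ((K2_mat d)\<^sup>T * K2_mat d + 1\<^sub>m (dim_row (U_f d))))) *
       F3 lp lh \<delta> d +
     (vnorm (((K2_mat d)\<^sup>T * K1_mat d) *\<^sub>v b0 d) + F3 lp lh \<delta> d) * F2 lh \<delta> d"

text \<open>Equals 1 by the convention for division by zero if \<open>g_vec d (u_opt d)\<close> vanishes.\<close>

definition eta :: "nat \<Rightarrow> nat \<Rightarrow> real \<Rightarrow> data \<Rightarrow> real" where
  "eta lp lh \<delta> d =
     1 + spectral_norm (pinv (H_mat d)) * F_bound lp lh \<delta> d / vnorm (g_vec d (u_opt d))"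

definition C1 :: "nat \<Rightarrow> nat \<Rightarrow> real \<Rightarrow> data \<Rightarrow> real" where
  "C1 lp lh \<delta> d = 2 * inverse (sigma_min (H_mat d)) *
     (sqrt lp + eta lp lh \<delta> d * lh * vnorm (g_vec d (u_opt d))) * \<delta>"

definition C2 :: "nat \<Rightarrow> nat \<Rightarrow> real \<Rightarrow> data \<Rightarrow> real" where
  "C2 lp lh \<delta> d = (spectral_norm (Y_f d) + lh * \<delta>) * C1 lp lh \<delta> d +
     eta lp lh \<delta> d * lh * vnorm (g_vec d (u_opt d)) * \<delta>"

definition C3 :: "nat \<Rightarrow> nat \<Rightarrow> real \<Rightarrow> data \<Rightarrow> real" where
  "C3 lp lh \<delta> d = 8 * (C2 lp lh \<delta> d)\<^sup>2 +
     4 * spectral_norm (Y_f d) * vnorm (g_vec d (u_opt d)) * eta lp lh \<delta> d * C2 lp lh \<delta> d"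

section \<open>Probability\<close>

abbreviation Rn_borel :: "nat \<Rightarrow> (nat \<Rightarrow> real) measure" where
  "Rn_borel n \<equiv> PiM {..<n} (\<lambda>_. borel)"

definition null_on_subspaces :: "nat \<Rightarrow> (nat \<Rightarrow> real) measure \<Rightarrow> bool" where
  "null_on_subspaces n Q \<longleftrightarrow> (\<forall>V. VectorSpace.subspace class_ring V (module_vec TYPE(real) n) \<and>
     V \<noteq> carrier_vec n \<longrightarrow> emeasure Q {z \<in> space Q. vec n z \<in> V} = 0)"

text \<open>The \<open>k\<close>-th input block (\<open>k = 0, 1, \<dots>\<close>) as an element of the space of \<^term>\<open>Rn_borel (m * L)\<close>.\<close>

definition block :: "nat \<Rightarrow> nat \<Rightarrow> (nat \<Rightarrow> real vec) \<Rightarrow> nat \<Rightarrow> (nat \<Rightarrow> real)" where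
  "block m L u k = (\<lambda>i\<in>{..<m * L}. col_seq m (k * L + 1) (k * L + L) u $ i)"

text \<open>The outer measure coincides with \<open>M\<close> on measurable sets; with it, no measurability of
  \<open>X \<delta>\<close> is presupposed (nor can a non-measurable event count as null).\<close>

definition tendsto_in_prob :: "'w measure \<Rightarrow> ('i \<Rightarrow> 'w \<Rightarrow> real) \<Rightarrow> real \<Rightarrow> 'i filter \<Rightarrow> bool" where
  "tendsto_in_prob M X c F \<longleftrightarrow> (\<forall>\<epsilon>>0.
     ((\<lambda>\<delta>. outer_measure_of M {\<omega> \<in> space M. \<bar>X \<delta> \<omega> - c\<bar> > \<epsilon>}) \<longlongrightarrow> 0) F)"

end

theory Submission
  imports Defs "Jordan_Normal_Form.Spectral_Radius"
begin

text \<open>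
  \<^bold>\<open>The cost estimate.\<close> Each of the two data sets, noiseless and noisy, defines an affine map from future
  inputs to predicted outputs. The noiseless prediction is feasible for the robust problem: the
  perturbations may undo the noise, and the noisy coefficients can be corrected so that they reproduce
  the noiseless right-hand side, at a distance of the order of the noise (\<open>g_witness\<close>,
  \<open>worst_feasible_witness\<close>). So the worst-case cost dominates the true cost. It is also close to the
  noisy cost, as all feasible outputs lie in a small ball around the noisy prediction
  (\<open>worst_feasible_bound\<close>). Passing from the robust input to the noisy optimum and on to the true
  optimum, by optimality of each in turn, gives the claim up to one point: at the true optimum the
  radius of that ball involves the noisy coefficients at an input which is not known. Both optima solve
  normal equations whose matrices exceed the identity, so their distance is bounded by
  \<^const>\<open>F_bound\<close> (\<open>optimal_input_diff\<close>), and \<^const>\<open>eta\<close> transfers the bound on the coefficients.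

  \<^bold>\<open>What the system contributes.\<close> The estimate presupposes that the past window and the inputs
  determine the future outputs, which is observability (\<open>consistent\<close>), and that the data matrices have
  full row rank. For the noisy matrix this follows from its smallest singular value, and the noiseless
  matrix inherits it. By contrast, the convergence statement needs full row rank of the noiseless matrix
  itself. By the fundamental lemma for Page matrices (\<open>fundamental_lemma\<close>), initial states and inputs of
  the pages are linearly unrelated; since with a single output the observability matrix over the past
  window is square and invertible, the past outputs can replace the states (\<open>H_left_kernel\<close>).

  \<^bold>\<open>Convergence in probability.\<close> As long as the noiseless data matrix is bounded away from rank
  deficiency and the data are bounded, \<^const>\<open>C3\<close> is at most a constant times the noise level
  (\<open>C3_linear_bound_noisy\<close>). The constant depends on the outcome only through a measurable function
  (\<open>conditioning\<close>), so the probability that it is large tends to zero. Measurability matters here: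
  the noise bound holds outside a null set that may vary with the noise level, hence a pointwise limit is
  not available, and outer measures are not continuous along decreasing sequences of arbitrary sets.
\<close>

(* The dot denotes the product of vectors of variable dimension throughout. *)
no_notation inner (infix \<open>\<bullet>\<close> 70)

section \<open>Euclidean and spectral norms\<close>

lemma vnorm_power2: "(vnorm v)\<^sup>2 = v \<bullet> v"
  by (simp add: vnorm_def L2_set_def sum_nonneg scalar_prod_def power2_eq_square atLeast0LessThan)

lemma vnorm_nonneg [simp]: "0 \<le> vnorm v"
  by (simp add: vnorm_def L2_set_nonneg)

lemma vnorm_zero [simp]: "vnorm (0\<^sub>v k) = 0"
  using vnorm_power2[of "0\<^sub>v k"] by simp

lemma vnorm_eq_0_imp:
  assumes "v \<in> carrier_vec k" "vnorm v = 0"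
  shows "v = 0\<^sub>v k"
  using assms by (intro eq_vecI) (auto simp: vnorm_def L2_set_eq_0_iff)

lemma scalar_prod_self_eq_0:
  assumes "(v :: real vec) \<in> carrier_vec k" "v \<bullet> v = 0"
  shows "v = 0\<^sub>v k"
  by (rule vnorm_eq_0_imp) (use assms vnorm_power2[of v] in auto)

lemma Cauchy_Schwarz_vec:
  assumes "v \<in> carrier_vec k" "w \<in> carrier_vec k"
  shows "\<bar>v \<bullet> w\<bar> \<le> vnorm v * vnorm w"
proof -
  have "\<bar>v \<bullet> w\<bar> \<le> (\<Sum>i<k. \<bar>v $ i\<bar> * \<bar>w $ i\<bar>)"
    using assms by (auto simp: scalar_prod_def atLeast0LessThan abs_mult[symmetric] intro: sum_abs)
  also have "\<dots> \<le> vnorm v * vnorm w"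
    using assms L2_set_mult_ineq[of "vec_index v" "vec_index w" "{..<k}"] by (auto simp: vnorm_def)
  finally show ?thesis .
qed

lemma vnorm_triangle:
  assumes "v \<in> carrier_vec k" "w \<in> carrier_vec k"
  shows "vnorm (v + w) \<le> vnorm v + vnorm w"
proof -
  have "vnorm (v + w) = L2_set (\<lambda>i. v $ i + w $ i) {..<k}"
    using assms by (auto simp: vnorm_def intro: L2_set_cong)
  thus ?thesis using assms L2_set_triangle_ineq[of "vec_index v" "vec_index w" "{..<k}"]
    by (auto simp: vnorm_def)
qed

lemma vnorm_smult [simp]: "vnorm (c \<cdot>\<^sub>v v) = \<bar>c\<bar> * vnorm v"
proof (rule power2_eq_imp_eq)
  show "(vnorm (c \<cdot>\<^sub>v v))\<^sup>2 = (\<bar>c\<bar> * vnorm v)\<^sup>2"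
    unfolding power_mult_distrib vnorm_power2
    by (simp add: power2_eq_square scalar_prod_def sum_distrib_left mult_ac)
qed auto

lemma vnorm_uminus [simp]: "vnorm (- v) = vnorm v"
  by (simp add: vnorm_def L2_set_def)

lemma vnorm_minus_commute:
  assumes "v \<in> carrier_vec k" "w \<in> carrier_vec k"
  shows "vnorm (v - w) = vnorm (w - v)"
proof -
  have "v - w = - (w - v)" using assms by (intro eq_vecI) auto
  thus ?thesis by simp
qed

lemma vnorm_triangle_sub:
  assumes "v \<in> carrier_vec k" "w \<in> carrier_vec k"
  shows "vnorm v \<le> vnorm w + vnorm (v - w)"
proof -
  have "v = w + (v - w)" using assms by (intro eq_vecI) auto
  thus ?thesis using vnorm_triangle[of w k "v - w"] assms by simp
qed

lemma vnorm_minus_le: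
  assumes "v \<in> carrier_vec k" "w \<in> carrier_vec k"
  shows "vnorm (v - w) \<le> vnorm v + vnorm w"
  using vnorm_triangle[of v k "- w"] assms by (simp add: minus_add_uminus_vec)

lemma vnorm_append_power2: "(vnorm (v @\<^sub>v w))\<^sup>2 = (vnorm v)\<^sup>2 + (vnorm w)\<^sup>2"
  unfolding vnorm_power2 by (rule scalar_prod_append[of _ "dim_vec v" _ "dim_vec w"]) auto

lemma vnorm_append_zero_left [simp]: "vnorm (0\<^sub>v k @\<^sub>v w) = vnorm w"
  by (rule power2_eq_imp_eq) (simp_all add: vnorm_append_power2)

lemma vnorm_append_zero_right [simp]: "vnorm (w @\<^sub>v 0\<^sub>v k) = vnorm w"
  by (rule power2_eq_imp_eq) (simp_all add: vnorm_append_power2)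

lemma vnorm_le_sqrt_times_bound:
  assumes "v \<in> carrier_vec k" "\<And>i. i < k \<Longrightarrow> \<bar>v $ i\<bar> \<le> c" "0 \<le> c"
  shows "vnorm v \<le> sqrt k * c"
proof -
  have "(\<Sum>i<k. (v $ i)\<^sup>2) \<le> (\<Sum>i<k. c\<^sup>2)"
    by (intro sum_mono) (metis assms(2) lessThan_iff power2_abs power_mono abs_ge_zero)
  hence "(vnorm v)\<^sup>2 \<le> (sqrt k * c)\<^sup>2"
    using assms(1) by (simp add: vnorm_def L2_set_def sum_nonneg power_mult_distrib)
  thus ?thesis using assms(3) by (simp add: power2_le_iff_abs_le)
qed

lemma vnorm_le_sum_abs: "vnorm v \<le> (\<Sum>i<dim_vec v. \<bar>v $ i\<bar>)"
  unfolding vnorm_def using L2_set_le_sum_abs by blast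

text \<open>Entrywise bounds enter the operator norm through the rows, by Cauchy--Schwarz.\<close>

lemma vnorm_mult_mat_vec_le_entries:
  assumes M: "M \<in> carrier_mat r c" and "x \<in> carrier_vec c"
    and le: "\<And>i j. i < r \<Longrightarrow> j < c \<Longrightarrow> \<bar>M $$ (i, j)\<bar> \<le> e" and e: "0 \<le> e"
  shows "vnorm (M *\<^sub>v x) \<le> sqrt (real r * real c) * e * vnorm x"
proof -
  have "\<bar>(M *\<^sub>v x) $ i\<bar> \<le> sqrt c * e * vnorm x" if "i < r" for i
  proof -
    have "\<bar>(M *\<^sub>v x) $ i\<bar> \<le> vnorm (row M i) * vnorm x"
      using assms that by (auto intro!: Cauchy_Schwarz_vec[of _ c])
    also have "vnorm (row M i) \<le> sqrt c * e"
      using M le that e by (intro vnorm_le_sqrt_times_bound) auto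
    finally show ?thesis by (simp add: mult_right_mono)
  qed
  hence "vnorm (M *\<^sub>v x) \<le> sqrt r * (sqrt c * e * vnorm x)"
    using M e \<open>x \<in> carrier_vec c\<close>
    by (intro vnorm_le_sqrt_times_bound) (auto intro: mult_mat_vec_carrier)
  thus ?thesis by (simp add: real_sqrt_mult mult_ac)
qed

lemma bdd_above_spectral_norm_set:
  "bdd_above {vnorm (M *\<^sub>v x) | x. x \<in> carrier_vec (dim_col M) \<and> vnorm x \<le> 1}"
proof -
  define e where "e = (\<Sum>i<dim_row M. \<Sum>j<dim_col M. \<bar>M $$ (i, j)\<bar>)"
  have e: "0 \<le> e" unfolding e_def by (intro sum_nonneg) auto
  have le: "\<bar>M $$ (i, j)\<bar> \<le> e" if "i < dim_row M" "j < dim_col M" for i j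
  proof -
    have "\<bar>M $$ (i, j)\<bar> \<le> (\<Sum>j<dim_col M. \<bar>M $$ (i, j)\<bar>)"
      using that by (intro member_le_sum[of j _ "\<lambda>j. \<bar>M $$ (i, j)\<bar>"]) auto
    also have "\<dots> \<le> e"
      unfolding e_def using that
      by (intro member_le_sum[of i _ "\<lambda>i. \<Sum>j<dim_col M. \<bar>M $$ (i, j)\<bar>"] sum_nonneg) auto
    finally show ?thesis .
  qed
  show ?thesis
  proof (rule bdd_aboveI, clarify)
    fix x assume x: "x \<in> carrier_vec (dim_col M)" "vnorm x \<le> 1"
    have "vnorm (M *\<^sub>v x) \<le> sqrt (real (dim_row M) * real (dim_col M)) * e * vnorm x"
      by (rule vnorm_mult_mat_vec_le_entries[of M "dim_row M" "dim_col M"]) (use x le e in auto)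
    also have "\<dots> \<le> sqrt (real (dim_row M) * real (dim_col M)) * e * 1"
      using x e by (intro mult_left_mono) auto
    finally show "vnorm (M *\<^sub>v x) \<le> sqrt (real (dim_row M) * real (dim_col M)) * e * 1" .
  qed
qed

lemma vnorm_mult_mat_vec_le:
  assumes "M \<in> carrier_mat r c" "x \<in> carrier_vec c"
  shows "vnorm (M *\<^sub>v x) \<le> spectral_norm M * vnorm x"
proof (cases "vnorm x = 0")
  case True
  hence "x = 0\<^sub>v c" using assms vnorm_eq_0_imp by blast
  hence "M *\<^sub>v x = 0\<^sub>v r" using assms by (intro eq_vecI) auto
  thus ?thesis using True by simp
next
  case False
  define z where "z = (1 / vnorm x) \<cdot>\<^sub>v x"
  have "vnorm z = 1" "z \<in> carrier_vec c" using False assms by (auto simp: z_def)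
  hence "vnorm (M *\<^sub>v z) \<le> spectral_norm M"
    unfolding spectral_norm_def using assms
    by (intro cSup_upper bdd_above_spectral_norm_set) auto
  moreover have "M *\<^sub>v z = (1 / vnorm x) \<cdot>\<^sub>v (M *\<^sub>v x)"
    unfolding z_def using assms by (simp add: mult_mat_vec)
  ultimately show ?thesis using False vnorm_nonneg[of x]
    by (simp add: field_simps)
qed

lemma spectral_norm_le:
  assumes "M \<in> carrier_mat r c" "0 \<le> e"
    and "\<And>x. x \<in> carrier_vec c \<Longrightarrow> vnorm (M *\<^sub>v x) \<le> e * vnorm x"
  shows "spectral_norm M \<le> e"
  unfolding spectral_norm_def
proof (rule cSup_least)
  have "0\<^sub>v (dim_col M) \<in> carrier_vec (dim_col M) \<and> vnorm (0\<^sub>v (dim_col M)) \<le> 1" by simp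
  thus "{vnorm (M *\<^sub>v x) | x. x \<in> carrier_vec (dim_col M) \<and> vnorm x \<le> 1} \<noteq> {}" by blast
  fix s assume "s \<in> {vnorm (M *\<^sub>v x) | x. x \<in> carrier_vec (dim_col M) \<and> vnorm x \<le> 1}"
  then obtain x where x: "s = vnorm (M *\<^sub>v x)" "x \<in> carrier_vec c" "vnorm x \<le> 1"
    using assms(1) by auto
  have "s \<le> e * vnorm x" using assms x by simp
  also have "\<dots> \<le> e" using x assms(2) by (simp add: mult_left_le)
  finally show "s \<le> e" .
qed

lemma spectral_norm_nonneg [simp]: "0 \<le> spectral_norm M"
proof -
  have "vnorm (M *\<^sub>v 0\<^sub>v (dim_col M)) \<le> spectral_norm M"
    unfolding spectral_norm_def by (intro cSup_upper bdd_above_spectral_norm_set CollectI)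
      (rule exI[of _ "0\<^sub>v (dim_col M)"], simp)
  thus ?thesis using vnorm_nonneg order_trans by blast
qed

lemma spectral_norm_mult_le:
  assumes "A \<in> carrier_mat r k" "B \<in> carrier_mat k c"
  shows "spectral_norm (A * B) \<le> spectral_norm A * spectral_norm B"
proof (rule spectral_norm_le[of _ r c])
  fix x :: "real vec" assume x: "x \<in> carrier_vec c"
  have "vnorm (A * B *\<^sub>v x) = vnorm (A *\<^sub>v (B *\<^sub>v x))"
    using assms x by simp
  also have "\<dots> \<le> spectral_norm A * vnorm (B *\<^sub>v x)"
    using assms x by (intro vnorm_mult_mat_vec_le[of _ r k]) auto
  also have "\<dots> \<le> spectral_norm A * (spectral_norm B * vnorm x)"
    using assms x by (intro mult_left_mono vnorm_mult_mat_vec_le[of _ k c]) auto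
  finally show "vnorm (A * B *\<^sub>v x) \<le> spectral_norm A * spectral_norm B * vnorm x" by simp
qed (use assms in auto)

lemma spectral_norm_transpose_le:
  assumes "A \<in> carrier_mat r c"
  shows "spectral_norm A\<^sup>T \<le> spectral_norm A"
proof (rule spectral_norm_le[of _ c r])
  fix x :: "real vec" assume x: "x \<in> carrier_vec r"
  let ?y = "A\<^sup>T *\<^sub>v x"
  have y: "?y \<in> carrier_vec c" using assms x by simp
  have "vnorm ?y * vnorm ?y = ?y \<bullet> ?y"
    by (simp add: vnorm_power2[symmetric] power2_eq_square)
  also have "\<dots> = x \<bullet> (A *\<^sub>v ?y)"
    using assms x y by (intro transpose_vec_mult_scalar) auto
  also have "\<dots> \<le> vnorm x * vnorm (A *\<^sub>v ?y)"
    using Cauchy_Schwarz_vec[of x r "A *\<^sub>v ?y"] assms x y by auto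
  also have "\<dots> \<le> vnorm x * (spectral_norm A * vnorm ?y)"
    using assms y by (intro mult_left_mono vnorm_mult_mat_vec_le[of _ r c]) auto
  finally have le: "vnorm ?y * vnorm ?y \<le> spectral_norm A * vnorm x * vnorm ?y"
    by (simp add: mult_ac)
  show "vnorm ?y \<le> spectral_norm A * vnorm x"
  proof (cases "vnorm ?y = 0")
    case False
    hence "0 < vnorm ?y" using vnorm_nonneg[of ?y] by linarith
    thus ?thesis using le by simp
  qed simp
qed (use assms in auto)

lemma spectral_norm_add_le:
  assumes "A \<in> carrier_mat r c" "B \<in> carrier_mat r c"
  shows "spectral_norm (A + B) \<le> spectral_norm A + spectral_norm B"
proof (rule spectral_norm_le[of _ r c])
  fix x :: "real vec" assume x: "x \<in> carrier_vec c"
  have "vnorm ((A + B) *\<^sub>v x) \<le> vnorm (A *\<^sub>v x) + vnorm (B *\<^sub>v x)"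
    using assms x by (simp add: add_mult_distrib_mat_vec[of _ r c] vnorm_triangle[of _ r])
  also have "\<dots> \<le> (spectral_norm A + spectral_norm B) * vnorm x"
    using vnorm_mult_mat_vec_le[OF assms(1) x] vnorm_mult_mat_vec_le[OF assms(2) x]
    by (simp add: algebra_simps)
  finally show "vnorm ((A + B) *\<^sub>v x) \<le> (spectral_norm A + spectral_norm B) * vnorm x" .
qed (use assms in auto)

lemma spectral_norm_le_of_diff:
  assumes "A \<in> carrier_mat r c" "B \<in> carrier_mat r c"
  shows "spectral_norm A \<le> spectral_norm B + spectral_norm (A - B)"
proof -
  have "A = B + (A - B)" using assms by (intro eq_matI) auto
  thus ?thesis using spectral_norm_add_le[of B r c "A - B"] assms by (simp add: minus_carrier_mat)
qed

lemma abs_le_max_norm: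
  assumes "i < dim_row M" "j < dim_col M"
  shows "\<bar>M $$ (i, j)\<bar> \<le> max_norm M"
proof -
  have "{\<bar>M $$ (i, j)\<bar> | i j. i < dim_row M \<and> j < dim_col M} =
    (\<lambda>(i, j). \<bar>M $$ (i, j)\<bar>) ` ({..<dim_row M} \<times> {..<dim_col M})" by auto
  thus ?thesis unfolding max_norm_def using assms by (intro Max_ge) auto
qed

lemma abs_le_vnorm_inf:
  assumes "i < dim_vec v"
  shows "\<bar>v $ i\<bar> \<le> vnorm_inf v"
proof -
  have "{\<bar>v $ i\<bar> | i. i < dim_vec v} = (\<lambda>i. \<bar>v $ i\<bar>) ` {..<dim_vec v}" by auto
  thus ?thesis unfolding vnorm_inf_def using assms by (intro Max_ge) auto
qed

text \<open>Entries of size \<open>e\<close> give an operator of norm at most \<open>sqrt (r c) e\<close>, and \<open>r \<le> c\<close>.\<close>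

lemma vnorm_mult_mat_vec_le_max_norm:
  assumes M: "M \<in> carrier_mat r c" and "r \<le> c" "0 \<le> e" "max_norm M \<le> e" "x \<in> carrier_vec c"
  shows "vnorm (M *\<^sub>v x) \<le> c * e * vnorm x"
proof -
  have "vnorm (M *\<^sub>v x) \<le> sqrt (real r * real c) * e * vnorm x"
    using assms abs_le_max_norm[of _ M]
    by (intro vnorm_mult_mat_vec_le_entries[of M r c]) (auto intro: order_trans)
  also have "sqrt (real r * real c) \<le> c"
    using assms(2) by (intro real_le_lsqrt) (auto simp: power2_eq_square intro: mult_right_mono)
  finally show ?thesis using assms(3) by (simp add: mult_right_mono)
qed

section \<open>Kernels and ranks\<close>

lemma smult_mat_mult_vec:
  assumes "(A :: real mat) \<in> carrier_mat r c" "v \<in> carrier_vec c"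
  shows "(e \<cdot>\<^sub>m A) *\<^sub>v v = e \<cdot>\<^sub>v (A *\<^sub>v v)"
  using assms by (intro eq_vecI) (auto simp: scalar_prod_def sum_distrib_left mult_ac)

lemma wide_mat_kernel:
  assumes M: "(M :: real mat) \<in> carrier_mat r c" and "r < c"
  obtains v where "v \<in> carrier_vec c" "v \<noteq> 0\<^sub>v c" "M *\<^sub>v v = 0\<^sub>v r"
proof -
  \<comment> \<open>Pad to a square matrix whose last row vanishes.\<close>
  define S where "S = mat c c (\<lambda>(i, j). if i < r then M $$ (i, j) else 0)"
  have S: "S \<in> carrier_mat c c" by (simp add: S_def)
  have "S\<^sup>T *\<^sub>v unit_vec c (c - 1) = 0\<^sub>v c"
    using \<open>r < c\<close> by (intro eq_vecI) (auto simp: S_def)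
  moreover have "unit_vec c (c - 1) \<noteq> 0\<^sub>v c" using \<open>r < c\<close> by simp
  ultimately have "det S\<^sup>T = 0"
    using S det_0_iff_vec_prod_zero_field[of "S\<^sup>T" c] unit_vec_carrier transpose_carrier_mat by blast
  hence "det S = 0" using det_transpose[OF S] by simp
  then obtain v where v: "v \<in> carrier_vec c" "v \<noteq> 0\<^sub>v c" "S *\<^sub>v v = 0\<^sub>v c"
    using det_0_iff_vec_prod_zero_field[OF S] by blast
  have "M *\<^sub>v v = 0\<^sub>v r"
  proof (intro eq_vecI)
    fix i assume "i < dim_vec (0\<^sub>v r)"
    hence i: "i < r" by simp
    have "row S i = row M i" using i \<open>r < c\<close> M by (intro eq_vecI) (auto simp: S_def)
    moreover have "(S *\<^sub>v v) $ i = 0" using v i \<open>r < c\<close> by simp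
    ultimately show "(M *\<^sub>v v) $ i = 0\<^sub>v r $ i" using i M \<open>r < c\<close> by (simp add: S_def)
  qed (use M in auto)
  thus thesis using v that by blast
qed

lemma full_col_rank_kernel:
  assumes M: "M \<in> carrier_mat r c" and "full_col_rank M"
    and v: "v \<in> carrier_vec c" "M *\<^sub>v v = 0\<^sub>v r"
  shows "v = 0\<^sub>v c"
proof -
  interpret vec_space "TYPE(real)" r .
  have rank: "rank M = c" using assms by (simp add: full_col_rank_def)
  obtain S where S: "maximal S (\<lambda>T. T \<subseteq> set (cols M) \<and> lin_indpt T)"
    using maximal_exists[of "(\<lambda>T. T \<subseteq> set (cols M) \<and> lin_indpt T)" "card (set (cols M))" "{}"]
    by (meson List.finite_set card_mono empty_iff empty_subsetI finite_lin_indpt2 rev_finite_subset)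
  have "c = card S" using rank_card_indpt[OF M S] rank by simp
  also have "\<dots> \<le> card (set (cols M))" using S by (auto simp: maximal_def intro: card_mono)
  finally have "distinct (cols M)"
    using M card_length[of "cols M"] by (intro card_distinct) simp
  thus ?thesis using full_rank_lin_indpt[OF M rank] lin_depI[OF M v(1) _ v(2)] by blast
qed

lemma full_row_rank_left_kernel:
  assumes M: "M \<in> carrier_mat r c" and "full_row_rank M"
    and v: "v \<in> carrier_vec r" "M\<^sup>T *\<^sub>v v = 0\<^sub>v c"
  shows "v = 0\<^sub>v r"
proof -
  interpret vec_space "TYPE(real)" r .
  have rank: "rank M = r" using assms by (simp add: full_row_rank_def)
  obtain S where S: "maximal S (\<lambda>T. T \<subseteq> set (cols M) \<and> lin_indpt T)"
    using maximal_exists[of "(\<lambda>T. T \<subseteq> set (cols M) \<and> lin_indpt T)" "card (set (cols M))" "{}"]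
    by (meson List.finite_set card_mono empty_iff empty_subsetI finite_lin_indpt2 rev_finite_subset)
  have sub: "S \<subseteq> set (cols M)" "lin_indpt S" using S by (auto simp: maximal_def)
  have "finite S" using sub(1) finite_subset by blast
  then obtain xs where xs: "set xs = S" "distinct xs" using finite_distinct_list by blast
  have len: "length xs = r" using rank_card_indpt[OF M S] rank xs distinct_card[of xs] by simp
  \<comment> \<open>A maximal independent set of columns forms an invertible square submatrix.\<close>
  define N where "N = mat_of_cols r xs"
  have N: "N \<in> carrier_mat r r" using len mat_of_cols_carrier(1)[of r xs] by (simp add: N_def)
  have Sr: "S \<subseteq> carrier_vec r" using sub(1) cols_dim[of M] M by auto
  have cN: "cols N = xs" unfolding N_def using Sr xs by (intro cols_mat_of_cols) auto
  have "rank N = r" by (rule lin_indpt_full_rank[OF N]) (simp_all add: cN xs sub)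
  hence "det N\<^sup>T \<noteq> 0" using det_rank_iff[OF N] det_transpose[OF N] by simp
  moreover have "N\<^sup>T *\<^sub>v v = 0\<^sub>v r"
  proof (intro eq_vecI)
    fix i assume i: "i < dim_vec (0\<^sub>v r :: real vec)"
    have "col N i \<in> set (cols M)"
      using i sub(1) xs(1) cN len N by (metis cols_length cols_nth index_zero_vec(2) nth_mem subsetD)
    then obtain j where j: "j < c" "col N i = col M j"
      using M by (auto simp: cols_def)
    have "(N\<^sup>T *\<^sub>v v) $ i = (M\<^sup>T *\<^sub>v v) $ j" using i j N M by simp
    thus "(N\<^sup>T *\<^sub>v v) $ i = 0\<^sub>v r $ i" using v j i by simp
  qed (use N in auto)
  ultimately show ?thesis
    using det_0_iff_vec_prod_zero_field[of "N\<^sup>T" r] N v(1) by auto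
qed

lemma left_kernel_trivial_le:
  assumes "(M :: real mat) \<in> carrier_mat r c"
    and "\<And>v. v \<in> carrier_vec r \<Longrightarrow> M\<^sup>T *\<^sub>v v = 0\<^sub>v c \<Longrightarrow> v = 0\<^sub>v r"
  shows "r \<le> c"
proof (rule ccontr)
  assume "\<not> r \<le> c"
  then obtain v where "v \<in> carrier_vec r" "v \<noteq> 0\<^sub>v r" "M\<^sup>T *\<^sub>v v = 0\<^sub>v c"
    using wide_mat_kernel[of "M\<^sup>T" c r] assms(1) by auto
  thus False using assms(2) by blast
qed

lemma kernel_trivial_imp_inverse:
  assumes G: "(G :: real mat) \<in> carrier_mat k k"
    and "\<And>v. v \<in> carrier_vec k \<Longrightarrow> G *\<^sub>v v = 0\<^sub>v k \<Longrightarrow> v = 0\<^sub>v k"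
  obtains Gi where "mat_inverse G = Some Gi" "G * Gi = 1\<^sub>m k" "Gi * G = 1\<^sub>m k" "Gi \<in> carrier_mat k k"
proof -
  have "det G \<noteq> 0" using assms det_0_iff_vec_prod_zero_field[OF G] by blast
  hence "G \<in> Units (ring_mat TYPE(real) k ())" by (rule det_non_zero_imp_unit[OF G])
  then obtain Gi where "mat_inverse G = Some Gi"
    using mat_inverse(1)[OF G, where b = "()"] by (cases "mat_inverse G") auto
  thus thesis using mat_inverse(2)[OF G] that by blast
qed

section \<open>The smallest singular value\<close>

text \<open>Moving from \<open>v\<close> by \<open>t\<close> in the direction \<open>w = S v\<close> changes the form by \<open>2 t |w|\<^sup>2\<close> up to second
  order in \<open>t\<close>, so \<open>w\<close> must vanish at a minimum.\<close>

lemma psd_form_zero_imp_kernel: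
  assumes S: "(S :: real mat) \<in> carrier_mat k k" and sym: "S\<^sup>T = S"
    and psd: "\<And>w. w \<in> carrier_vec k \<Longrightarrow> 0 \<le> w \<bullet> (S *\<^sub>v w)"
    and v: "v \<in> carrier_vec k" "v \<bullet> (S *\<^sub>v v) = 0"
  shows "S *\<^sub>v v = 0\<^sub>v k"
proof -
  define w where "w = S *\<^sub>v v"
  have w: "w \<in> carrier_vec k" using S v by (simp add: w_def)
  define a where "a = w \<bullet> w"
  define b where "b = w \<bullet> (S *\<^sub>v w)"
  have vSw: "v \<bullet> (S *\<^sub>v w) = a"
    using transpose_vec_mult_scalar[OF S w v(1)] by (simp add: sym a_def w_def)
  have *: "0 \<le> 2 * t * a + t\<^sup>2 * b" for t
  proof -
    have "(v + t \<cdot>\<^sub>v w) \<bullet> (S *\<^sub>v (v + t \<cdot>\<^sub>v w)) = (v + t \<cdot>\<^sub>v w) \<bullet> (w + t \<cdot>\<^sub>v (S *\<^sub>v w))"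
      using S v w by (simp add: mult_add_distrib_mat_vec[OF S] mult_mat_vec[OF S] w_def)
    also have "\<dots> = v \<bullet> w + t * (v \<bullet> (S *\<^sub>v w)) + t * (w \<bullet> w) + t * (t * (w \<bullet> (S *\<^sub>v w)))"
      using S v w by (simp add: add_scalar_prod_distrib[of _ k] scalar_prod_add_distrib[of _ k]
        algebra_simps)
    also have "\<dots> = 2 * t * a + t\<^sup>2 * b"
      using v(2) vSw by (simp add: a_def b_def w_def power2_eq_square)
    finally show ?thesis using psd[of "v + t \<cdot>\<^sub>v w"] v w by simp
  qed
  have "0 \<le> b" using psd[OF w] by (simp add: b_def)
  have "a = 0"
  proof (rule ccontr)
    assume "a \<noteq> 0"
    moreover have "0 \<le> a" using vnorm_power2[of w] by (simp add: a_def flip: vnorm_power2)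
    ultimately have "0 < a" by simp
    \<comment> \<open>Near the minimiser \<open>- a / b\<close> of the parabola, but defined for \<open>b = 0\<close> as well\<close>
    define t where "t = - a / (b + 1)"
    have "2 * t * a + t\<^sup>2 * b = a\<^sup>2 * (b - 2 * (b + 1)) / (b + 1)\<^sup>2"
    proof -
      have "a * b + a * (b * b) = a * b * (b + 1)" by (simp add: algebra_simps)
      thus ?thesis using \<open>0 \<le> b\<close>
        by (simp add: t_def divide_simps power2_eq_square) (simp add: algebra_simps)
    qed
    also have "\<dots> < 0" using \<open>0 < a\<close> \<open>0 \<le> b\<close> by (intro divide_neg_pos mult_pos_neg) auto
    finally show False using *[of t] by simp
  qed
  thus ?thesis using scalar_prod_self_eq_0[OF w] by (simp add: a_def w_def)
qed

text \<open>The minimum of the Rayleigh quotient is an eigenvalue: it is attained, since the unit sphere is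
  compact, and a minimiser lies in the kernel of the semidefinite form \<open>G - l I\<close>.\<close>

lemma symmetric_min_eigenvalue:
  assumes G: "(G :: real mat) \<in> carrier_mat k k" and sym: "G\<^sup>T = G" and "0 < k"
  obtains l where "eigenvalue G l" "\<And>w. w \<in> carrier_vec k \<Longrightarrow> l * (w \<bullet> w) \<le> w \<bullet> (G *\<^sub>v w)"
proof -
  \<comment> \<open>Vectors are modelled as functions that vanish outside \<open>{..<k}\<close>, whose product topology provides
    compactness.\<close>
  define box where "box = (PiE UNIV (\<lambda>i. if i < k then {-1..1::real} else {0}))"
  define K where "K = box \<inter> {f. (\<Sum>i<k. (f i)\<^sup>2) = 1}"
  define q where "q f = (\<Sum>i<k. f i * (\<Sum>j<k. G $$ (i, j) * f j))" for f :: "nat \<Rightarrow> real"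
  have "compact box"
    unfolding box_def using compactin_PiE[of "\<lambda>_::nat. euclidean :: real topology" UNIV]
    by (simp add: euclidean_product_topology)
  moreover have "closed {f :: nat \<Rightarrow> real. (\<Sum>i<k. (f i)\<^sup>2) = 1}"
    by (intro closed_Collect_eq continuous_intros continuous_on_product_coordinates)
  ultimately have "compact K" unfolding K_def by (rule compact_Int_closed)
  moreover have "(\<lambda>i. if i = 0 then 1 else 0) \<in> K"
    using \<open>0 < k\<close> by (auto simp: K_def box_def if_distrib[of "\<lambda>x. x\<^sup>2"] cong: if_cong)
  moreover have "continuous_on K q"
    unfolding q_def
    by (rule continuous_on_subset[OF _ subset_UNIV])
      (intro continuous_intros continuous_on_product_coordinates)
  ultimately obtain f where f: "f \<in> K" and min: "\<And>g. g \<in> K \<Longrightarrow> q f \<le> q g"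
    using continuous_attains_inf[of K q] by blast
  define v where "v = vec k f"
  define l where "l = q f"
  have v: "v \<in> carrier_vec k" by (simp add: v_def)
  have vv: "v \<bullet> v = 1" using f by (simp add: v_def scalar_prod_def K_def power2_eq_square atLeast0LessThan)
  have qvec: "w \<bullet> (G *\<^sub>v w) = q (\<lambda>i. if i < k then w $ i else 0)" if "w \<in> carrier_vec k" for w
    using G that by (simp add: q_def scalar_prod_def atLeast0LessThan)
  have "q f = q (\<lambda>i. if i < k then v $ i else 0)" by (simp add: q_def v_def)
  hence vGv: "v \<bullet> (G *\<^sub>v v) = l" using qvec[OF v] by (simp add: l_def)
  have ray: "l * (w \<bullet> w) \<le> w \<bullet> (G *\<^sub>v w)" if w: "w \<in> carrier_vec k" for w
  proof (cases "vnorm w = 0")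
    case True
    hence "w = 0\<^sub>v k" using w vnorm_eq_0_imp by blast
    thus ?thesis using G by simp
  next
    case False
    define s where "s = 1 / vnorm w"
    define z where "z = s \<cdot>\<^sub>v w"
    define g where "g = (\<lambda>i. if i < k then z $ i else 0)"
    have z: "z \<in> carrier_vec k" using w by (simp add: z_def)
    have s2: "s * s * (w \<bullet> w) = 1"
      using False by (simp add: s_def vnorm_power2[symmetric] power2_eq_square)
    have zz: "z \<bullet> z = 1" using w s2 by (simp add: z_def)
    have sum1: "(\<Sum>i<k. (z $ i)\<^sup>2) = 1"
      using zz z by (simp add: scalar_prod_def power2_eq_square atLeast0LessThan)
    have "\<bar>z $ i\<bar> \<le> 1" if "i < k" for i
    proof -
      have "(z $ i)\<^sup>2 \<le> (\<Sum>i<k. (z $ i)\<^sup>2)" using that by (intro member_le_sum) auto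
      thus ?thesis using sum1 by (simp add: abs_square_le_1)
    qed
    hence "g \<in> K" using sum1 by (fastforce simp: K_def box_def g_def)
    hence "l \<le> z \<bullet> (G *\<^sub>v z)" using min qvec[OF z] by (simp add: l_def g_def)
    also have "\<dots> = s * s * (w \<bullet> (G *\<^sub>v w))"
      using w G by (simp add: z_def mult_mat_vec[OF G])
    finally have "l * (s * s * (w \<bullet> w)) \<le> s * s * (w \<bullet> (G *\<^sub>v w))" using s2 by simp
    hence "(s * s) * (l * (w \<bullet> w)) \<le> (s * s) * (w \<bullet> (G *\<^sub>v w))" by (simp add: mult_ac)
    moreover have "0 < s * s" using False vnorm_nonneg[of w] by (simp add: s_def mult_pos_pos less_le)
    ultimately show ?thesis by (simp only: mult_le_cancel_left_pos)
  qed
  define S where "S = G - l \<cdot>\<^sub>m 1\<^sub>m k"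
  have S: "S \<in> carrier_mat k k" using G by (simp add: S_def minus_carrier_mat)
  have Sw: "S *\<^sub>v w = G *\<^sub>v w - l \<cdot>\<^sub>v w" if "w \<in> carrier_vec k" for w
    unfolding S_def using G that
    by (simp add: minus_mult_distrib_mat_vec[OF G] smult_mat_mult_vec[of _ k k])
  have Sform: "w \<bullet> (S *\<^sub>v w) = w \<bullet> (G *\<^sub>v w) - l * (w \<bullet> w)" if "w \<in> carrier_vec k" for w
    using that G by (simp add: Sw scalar_prod_minus_distrib[of _ k])
  have "S *\<^sub>v v = 0\<^sub>v k"
  proof (rule psd_form_zero_imp_kernel[OF S _ _ v])
    show "S\<^sup>T = S"
    proof (intro eq_matI)
      fix i j assume "i < dim_row S" "j < dim_col S"
      hence ij: "i < k" "j < k" using S by auto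
      have "G $$ (j, i) = G $$ (i, j)" using arg_cong[OF sym, of "\<lambda>M. M $$ (i, j)"] G ij by simp
      thus "S\<^sup>T $$ (i, j) = S $$ (i, j)" using G ij by (simp add: S_def)
    qed (use S in auto)
    show "0 \<le> w \<bullet> (S *\<^sub>v w)" if "w \<in> carrier_vec k" for w
      using Sform[OF that] ray[OF that] by simp
    show "v \<bullet> (S *\<^sub>v v) = 0" using Sform[OF v] vGv vv by simp
  qed
  hence Sv: "G *\<^sub>v v - l \<cdot>\<^sub>v v = 0\<^sub>v k" using Sw[OF v] by simp
  have Gv: "G *\<^sub>v v = l \<cdot>\<^sub>v v"
  proof (intro eq_vecI)
    fix i assume "i < dim_vec (l \<cdot>\<^sub>v v)"
    thus "(G *\<^sub>v v) $ i = (l \<cdot>\<^sub>v v) $ i"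
      using arg_cong[OF Sv, of "\<lambda>x. x $ i"] G v by simp
  qed (use G v in auto)
  have "v \<noteq> 0\<^sub>v k" using vv v by auto
  hence "eigenvalue G l"
    unfolding eigenvalue_def eigenvector_def using G v Gv by auto
  thus thesis using ray that by blast
qed

text \<open>The quadratic form of the Gram matrix \<open>H H\<^sup>T\<close> is \<open>|H\<^sup>T v|\<^sup>2\<close>. Hence the least eigenvalue, which is
  attained, gives the best constant \<open>e\<close> in \<open>e |v| \<le> |H\<^sup>T v|\<close>. All later estimates use the singular
  value in this form.\<close>

lemma sigma_min_wide:
  assumes H: "H \<in> carrier_mat r c" and "0 < r" "r \<le> c"
  shows sigma_min_lower: "\<And>v. v \<in> carrier_vec r \<Longrightarrow> sigma_min H * vnorm v \<le> vnorm (H\<^sup>T *\<^sub>v v)"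
    and sigma_min_greatest: "\<And>e. \<lbrakk>0 \<le> e; \<And>v. v \<in> carrier_vec r \<Longrightarrow> e * vnorm v \<le> vnorm (H\<^sup>T *\<^sub>v v)\<rbrakk>
      \<Longrightarrow> e \<le> sigma_min H"
proof -
  let ?G = "H * H\<^sup>T"
  have G: "?G \<in> carrier_mat r r" using H by simp
  have sym: "?G\<^sup>T = ?G" using H transpose_mult[of H r c "H\<^sup>T" r] by simp
  have form: "w \<bullet> (?G *\<^sub>v w) = (vnorm (H\<^sup>T *\<^sub>v w))\<^sup>2" if "w \<in> carrier_vec r" for w
    using H that transpose_vec_mult_scalar[of H r c "H\<^sup>T *\<^sub>v w" w] by (simp add: vnorm_power2)
  obtain l where l: "eigenvalue ?G l" and ray: "\<And>w. w \<in> carrier_vec r \<Longrightarrow> l * (w \<bullet> w) \<le> w \<bullet> (?G *\<^sub>v w)"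
    using symmetric_min_eigenvalue[OF G sym \<open>0 < r\<close>] by blast
  define E where "E = {k. eigenvalue ?G k}"
  have fin: "finite E" using card_finite_spectrum(1)[OF G] by (simp add: E_def spectrum_def)
  have eig: "\<exists>v. v \<in> carrier_vec r \<and> 0 < v \<bullet> v \<and> (vnorm (H\<^sup>T *\<^sub>v v))\<^sup>2 = k * (v \<bullet> v)" if k: "k \<in> E" for k
  proof -
    obtain v where v: "v \<in> carrier_vec r" "v \<noteq> 0\<^sub>v r" "?G *\<^sub>v v = k \<cdot>\<^sub>v v"
      using k H unfolding E_def eigenvalue_def eigenvector_def by auto
    have "v \<bullet> v \<noteq> 0" using v scalar_prod_self_eq_0 by blast
    hence "0 < v \<bullet> v" using vnorm_power2[of v] by (metis less_eq_real_def zero_le_power2)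
    thus ?thesis using form[OF v(1)] v by (intro exI[of _ v]) simp
  qed
  have "Min E = l"
  proof (rule Min_eqI[OF fin])
    show "l \<in> E" using l by (simp add: E_def)
    fix k assume "k \<in> E"
    then obtain v where v: "v \<in> carrier_vec r" "0 < v \<bullet> v" "(vnorm (H\<^sup>T *\<^sub>v v))\<^sup>2 = k * (v \<bullet> v)"
      using eig by blast
    have "l * (v \<bullet> v) \<le> k * (v \<bullet> v)" using ray[OF v(1)] form[OF v(1)] v(3) by simp
    thus "l \<le> k" using v(2) by simp
  qed
  hence sig: "sigma_min H = sqrt l"
    using H \<open>r \<le> c\<close> by (simp add: sigma_min_def E_def)
  obtain v0 where v0: "v0 \<in> carrier_vec r" "0 < v0 \<bullet> v0" "(vnorm (H\<^sup>T *\<^sub>v v0))\<^sup>2 = l * (v0 \<bullet> v0)"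
    using eig l by (auto simp: E_def)
  have l0: "0 \<le> l" using v0 by (metis zero_le_mult_iff zero_le_power2 not_less)
  show "sigma_min H * vnorm v \<le> vnorm (H\<^sup>T *\<^sub>v v)" if v: "v \<in> carrier_vec r" for v
  proof (rule power2_le_imp_le)
    show "(sigma_min H * vnorm v)\<^sup>2 \<le> (vnorm (H\<^sup>T *\<^sub>v v))\<^sup>2"
      using ray[OF v] form[OF v] l0 by (simp add: sig power_mult_distrib vnorm_power2)
  qed simp
  show "e \<le> sigma_min H" if e: "0 \<le> e" "\<And>v. v \<in> carrier_vec r \<Longrightarrow> e * vnorm v \<le> vnorm (H\<^sup>T *\<^sub>v v)" for e
  proof -
    have "(e * vnorm v0)\<^sup>2 \<le> (vnorm (H\<^sup>T *\<^sub>v v0))\<^sup>2"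
      using e v0(1) by (intro power_mono) auto
    hence "e\<^sup>2 * (v0 \<bullet> v0) \<le> l * (v0 \<bullet> v0)" using v0(3) by (simp add: power_mult_distrib vnorm_power2)
    hence "e\<^sup>2 \<le> l" using v0(2) by simp
    thus ?thesis unfolding sig by (rule real_le_rsqrt)
  qed
qed

section \<open>The pseudoinverse of a matrix of full row rank\<close>

text \<open>Penrose's argument: \<open>M X\<close> and \<open>M Y\<close> are orthogonal projections with the same range, likewise \<open>X M\<close>
  and \<open>Y M\<close>.\<close>

lemma is_pinv_unique:
  assumes X: "is_pinv M X" and Y: "is_pinv M Y"
  shows "X = Y"
proof -
  obtain r c where M: "M \<in> carrier_mat r c" by blast
  have XY: "X \<in> carrier_mat c r" "Y \<in> carrier_mat c r"
    using X Y M by (auto simp: is_pinv_def)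
  have X': "M * X * M = M" "X * M * X = X" "(M * X)\<^sup>T = M * X" "(X * M)\<^sup>T = X * M"
    and Y': "M * Y * M = M" "Y * M * Y = Y" "(M * Y)\<^sup>T = M * Y" "(Y * M)\<^sup>T = Y * M"
    using X Y by (auto simp: is_pinv_def)
  have sq: "M * X \<in> carrier_mat r r" "M * Y \<in> carrier_mat r r"
    "X * M \<in> carrier_mat c c" "Y * M \<in> carrier_mat c c"
    using M XY by auto
  have "M * X = M * Y * M * X" by (simp only: Y')
  also have "\<dots> = (M * Y) * (M * X)" using sq M XY by (intro assoc_mult_mat) auto
  also have "\<dots> = (M * Y)\<^sup>T * (M * X)\<^sup>T" by (simp only: X' Y')
  also have "\<dots> = ((M * X) * (M * Y))\<^sup>T" using sq by (intro transpose_mult[symmetric]) auto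
  also have "(M * X) * (M * Y) = M * X * M * Y" using sq M XY by (intro assoc_mult_mat[symmetric]) auto
  also have "(M * X * M * Y)\<^sup>T = M * Y" by (simp only: X' Y')
  finally have MX: "M * X = M * Y" .
  have "Y * M = Y * (M * X * M)" by (simp only: X')
  also have "\<dots> = Y * (M * (X * M))" using M XY by (subst assoc_mult_mat) auto
  also have "\<dots> = (Y * M) * (X * M)" using sq M XY by (intro assoc_mult_mat[symmetric]) auto
  also have "\<dots> = (Y * M)\<^sup>T * (X * M)\<^sup>T" by (simp only: X' Y')
  also have "\<dots> = ((X * M) * (Y * M))\<^sup>T" using sq by (intro transpose_mult[symmetric]) auto
  also have "(X * M) * (Y * M) = X * (M * (Y * M))" using sq M XY by (intro assoc_mult_mat) auto
  also have "M * (Y * M) = M * Y * M" using sq M XY by (intro assoc_mult_mat[symmetric]) auto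
  also have "(X * (M * Y * M))\<^sup>T = X * M" by (simp only: X' Y')
  finally have YM: "Y * M = X * M" .
  have "X = X * M * X" by (simp only: X')
  also have "\<dots> = X * (M * X)" using M XY by (intro assoc_mult_mat) auto
  also have "\<dots> = X * (M * Y)" by (simp only: MX)
  also have "\<dots> = X * M * Y" using M XY by (intro assoc_mult_mat[symmetric]) auto
  also have "\<dots> = Y" by (simp only: YM[symmetric] Y')
  finally show ?thesis .
qed

lemma pinv_eqI: "is_pinv M X \<Longrightarrow> pinv M = X"
  unfolding pinv_def by (rule the_equality) (auto intro: is_pinv_unique)

text \<open>For a matrix \<open>H\<close> of full row rank, quantified by \<open>e\<close>, the pseudoinverse is the right inverse
  \<open>H\<^sup>T (H H\<^sup>T)\<^sup>-\<^sup>1\<close>. Its values are of the form \<open>H\<^sup>T z\<close>, for which the lower bound on \<open>H\<^sup>T\<close> bounds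
  \<open>z\<close>, and this bounds the norm.\<close>

lemma pinv_full_row_rank:
  assumes H: "H \<in> carrier_mat r c" and e: "0 < e"
    and le: "\<And>v. v \<in> carrier_vec r \<Longrightarrow> e * vnorm v \<le> vnorm (H\<^sup>T *\<^sub>v v)"
  shows pinv_carrier: "pinv H \<in> carrier_mat c r"
    and pinv_right_inverse: "H * pinv H = 1\<^sub>m r"
    and spectral_norm_pinv_le: "spectral_norm (pinv H) \<le> 1 / e"
proof -
  define G where "G = H * H\<^sup>T"
  have G: "G \<in> carrier_mat r r" using H by (simp add: G_def)
  have GT: "G\<^sup>T = G" using H transpose_mult[of H r c "H\<^sup>T" r] by (simp add: G_def)
  have Ht: "H\<^sup>T \<in> carrier_mat c r" using H by simp
  have "v = 0\<^sub>v r" if v: "v \<in> carrier_vec r" and 0: "G *\<^sub>v v = 0\<^sub>v r" for v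
  proof -
    have "(vnorm (H\<^sup>T *\<^sub>v v))\<^sup>2 = v \<bullet> (H *\<^sub>v (H\<^sup>T *\<^sub>v v))"
      unfolding vnorm_power2 using H v by (intro transpose_vec_mult_scalar) auto
    also have "H *\<^sub>v (H\<^sup>T *\<^sub>v v) = G *\<^sub>v v" using H v by (simp add: G_def)
    finally have "vnorm (H\<^sup>T *\<^sub>v v) = 0" using 0 v by simp
    hence "e * vnorm v \<le> 0" using le[OF v] by simp
    hence "vnorm v = 0" using e vnorm_nonneg[of v] by (simp add: mult_le_0_iff)
    thus ?thesis using v vnorm_eq_0_imp by blast
  qed
  then obtain Gi where Gi: "G * Gi = 1\<^sub>m r" "Gi * G = 1\<^sub>m r" "Gi \<in> carrier_mat r r"
    using kernel_trivial_imp_inverse[OF G] by metis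
  have GiT: "Gi\<^sup>T = Gi"
  proof -
    have "Gi\<^sup>T * G = 1\<^sub>m r"
      using transpose_mult[OF G Gi(3)] Gi(1) GT by simp
    hence "Gi\<^sup>T = Gi\<^sup>T * (G * Gi)" using Gi by simp
    also have "\<dots> = Gi\<^sup>T * G * Gi" using Gi G by (intro assoc_mult_mat[symmetric]) auto
    also have "\<dots> = Gi" using Gi(3) by (simp add: \<open>Gi\<^sup>T * G = 1\<^sub>m r\<close>)
    finally show ?thesis .
  qed
  define X where "X = H\<^sup>T * Gi"
  have X: "X \<in> carrier_mat c r" using Ht Gi(3) by (simp add: X_def)
  have "H * X = G * Gi" unfolding X_def G_def using H Ht Gi(3) by (intro assoc_mult_mat[symmetric]) auto
  hence HX: "H * X = 1\<^sub>m r" by (simp only: Gi)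
  have "(X * H)\<^sup>T = H\<^sup>T * X\<^sup>T" by (rule transpose_mult[OF X H])
  also have "X\<^sup>T = Gi\<^sup>T * H\<^sup>T\<^sup>T" unfolding X_def by (rule transpose_mult[OF Ht Gi(3)])
  also have "\<dots> = Gi * H" by (simp add: GiT)
  also have "H\<^sup>T * (Gi * H) = X * H"
    unfolding X_def using H Ht Gi(3) by (intro assoc_mult_mat[symmetric]) auto
  finally have XH: "(X * H)\<^sup>T = X * H" .
  have "is_pinv H X"
    unfolding is_pinv_def using X H XH HX assoc_mult_mat[OF X H X] by simp
  hence pinv: "pinv H = X" by (rule pinv_eqI)
  show "pinv H \<in> carrier_mat c r" "H * pinv H = 1\<^sub>m r" using X HX pinv by auto
  show "spectral_norm (pinv H) \<le> 1 / e"
    unfolding pinv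
  proof (rule spectral_norm_le[OF X])
    fix w :: "real vec" assume w: "w \<in> carrier_vec r"
    define z where "z = Gi *\<^sub>v w"
    have z: "z \<in> carrier_vec r" using Gi(3) w by (simp add: z_def)
    have Xw: "X *\<^sub>v w = H\<^sup>T *\<^sub>v z" using Ht Gi(3) w by (simp add: X_def z_def)
    have "(vnorm (X *\<^sub>v w))\<^sup>2 = z \<bullet> (H *\<^sub>v (X *\<^sub>v w))"
      unfolding vnorm_power2 Xw using H z by (intro transpose_vec_mult_scalar) auto
    also have "H *\<^sub>v (X *\<^sub>v w) = w"
      using H X w HX by (simp flip: assoc_mult_mat_vec[of H r c X r w])
    also have "z \<bullet> w \<le> vnorm z * vnorm w" using Cauchy_Schwarz_vec[OF z w] by simp
    also have "vnorm z \<le> vnorm (X *\<^sub>v w) / e"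
      using le[OF z] e by (simp add: Xw field_simps)
    finally have "vnorm (X *\<^sub>v w) * vnorm (X *\<^sub>v w) \<le> (1 / e * vnorm w) * vnorm (X *\<^sub>v w)"
      by (simp add: mult_right_mono power2_eq_square field_simps)
    moreover have "0 \<le> 1 / e * vnorm w" using e by simp
    ultimately show "vnorm (X *\<^sub>v w) \<le> 1 / e * vnorm w"
      using vnorm_nonneg[of "X *\<^sub>v w"] by (metis less_eq_real_def mult_le_cancel_right_pos)
  qed (use e in simp)
qed

section \<open>The predictor of one data set\<close>

text \<open>The dimensions: \<open>a\<close> and \<open>l\<close> for past inputs and outputs, \<open>b\<close> and \<open>f\<close> for future ones, \<open>N\<close> pages.\<close>

locale data_dims =
  fixes d :: data and a l b f N :: nat
  assumes dims: "U_p d \<in> carrier_mat a N" "Y_p d \<in> carrier_mat l N" "U_f d \<in> carrier_mat b N"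
      "Y_f d \<in> carrier_mat f N" "u_p d \<in> carrier_vec a" "y_p d \<in> carrier_vec l"
begin

lemma H_carrier: "H_mat d \<in> carrier_mat (a + (l + b)) N"
  using dims by (simp add: H_mat_def carrier_append_rows)

lemma H_mult: "z \<in> carrier_vec N \<Longrightarrow> H_mat d *\<^sub>v z = (U_p d *\<^sub>v z) @\<^sub>v (Y_p d *\<^sub>v z) @\<^sub>v (U_f d *\<^sub>v z)"
  using dims by (simp add: H_mat_def mat_mult_append[of _ a N _ "l + b"]
    mat_mult_append[of _ l N _ b] carrier_append_rows)

lemma b_vec_carrier: "uf \<in> carrier_vec b \<Longrightarrow> b_vec d uf \<in> carrier_vec (a + (l + b))"
  using dims by (simp add: b_vec_def append_carrier_vec)

lemma b0_carrier: "b0 d \<in> carrier_vec (a + (l + b))"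
  unfolding b0_def by (rule b_vec_carrier) (use dims in simp)

lemma b_vec_split:
  assumes "uf \<in> carrier_vec b"
  shows "b_vec d uf = b0 d + (0\<^sub>v (a + l) @\<^sub>v uf)"
  using assms dims by (intro eq_vecI) (auto simp: b_vec_def b0_def)

end

text \<open>The number \<open>e\<close> quantifies that the data matrix has full row rank: it bounds the smallest
  singular value from below.\<close>

locale predictor = data_dims d a l b f N for d :: data and a l b f N :: nat +
  fixes e :: real
  assumes e: "0 < e" "\<And>v. v \<in> carrier_vec (a + (l + b)) \<Longrightarrow> e * vnorm v \<le> vnorm ((H_mat d)\<^sup>T *\<^sub>v v)"
begin

lemmas pinv_H = pinv_full_row_rank[OF H_carrier e]

lemma H_pinv_mult: "w \<in> carrier_vec (a + (l + b)) \<Longrightarrow> H_mat d *\<^sub>v (pinv (H_mat d) *\<^sub>v w) = w"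
  using H_carrier pinv_H by (simp flip: assoc_mult_mat_vec[of _ "a + (l + b)" N _ "a + (l + b)"])

lemma g_vec_carrier: "uf \<in> carrier_vec b \<Longrightarrow> g_vec d uf \<in> carrier_vec N"
  unfolding g_vec_def using pinv_H(1) b_vec_carrier by (intro mult_mat_vec_carrier) auto

lemma y_pred_carrier: "uf \<in> carrier_vec b \<Longrightarrow> y_pred d uf \<in> carrier_vec f"
  unfolding y_pred_def using dims g_vec_carrier by (intro mult_mat_vec_carrier) auto

lemma K1_carrier: "K1_mat d \<in> carrier_mat f (a + (l + b))"
  unfolding K1_mat_def using dims pinv_H(1) by (intro mult_carrier_mat) auto

lemma K2_carrier: "K2_mat d \<in> carrier_mat f b"
  unfolding K2_mat_def Let_def using dims K1_carrier
  by (intro mult_carrier_mat[of _ _ "a + (l + b)"]) (auto simp: add.assoc[symmetric] intro!: carrier_append_rows)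

text \<open>Selecting the last columns amounts to padding the future inputs with zeros in front.\<close>

lemma K2_mult:
  assumes "uf \<in> carrier_vec b"
  shows "K2_mat d *\<^sub>v uf = K1_mat d *\<^sub>v (0\<^sub>v (a + l) @\<^sub>v uf)"
proof -
  have E: "0\<^sub>m (a + l) b @\<^sub>r 1\<^sub>m b \<in> carrier_mat (a + (l + b)) b"
    using carrier_append_rows[of "0\<^sub>m (a + l) b" "a + l" b "1\<^sub>m b" b] by (simp add: add.assoc)
  have "K2_mat d = K1_mat d * (0\<^sub>m (a + l) b @\<^sub>r 1\<^sub>m b)"
    using dims by (simp add: K2_mat_def)
  hence "K2_mat d *\<^sub>v uf = K1_mat d *\<^sub>v ((0\<^sub>m (a + l) b @\<^sub>r 1\<^sub>m b) *\<^sub>v uf)"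
    by (simp only: assoc_mult_mat_vec[OF K1_carrier E assms])
  also have "(0\<^sub>m (a + l) b @\<^sub>r 1\<^sub>m b) *\<^sub>v uf = 0\<^sub>v (a + l) @\<^sub>v uf"
    using assms by (subst mat_mult_append[of _ "a + l" b _ b]) auto
  finally show ?thesis .
qed

lemma y_pred_eq: "uf \<in> carrier_vec b \<Longrightarrow> y_pred d uf = K1_mat d *\<^sub>v b_vec d uf"
  unfolding y_pred_def g_vec_def K1_mat_def
  using dims pinv_H(1) b_vec_carrier by (intro assoc_mult_mat_vec[symmetric]) auto

lemma y_pred_split:
  assumes "uf \<in> carrier_vec b"
  shows "y_pred d uf = K1_mat d *\<^sub>v b0 d + K2_mat d *\<^sub>v uf"
  using assms K1_carrier b0_carrier
  by (simp add: y_pred_eq b_vec_split K2_mult mult_add_distrib_mat_vec[of _ f "a + (l + b)"]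
    append_carrier_vec[of _ "a + l" _ b, unfolded add.assoc])

lemma spectral_norm_K1_le: "spectral_norm (K1_mat d) \<le> spectral_norm (Y_f d) * spectral_norm (pinv (H_mat d))"
  unfolding K1_mat_def by (rule spectral_norm_mult_le) (use dims pinv_H(1) in auto)

lemma K2_norm: "uf \<in> carrier_vec b \<Longrightarrow> vnorm (K2_mat d *\<^sub>v uf) \<le> spectral_norm (K1_mat d) * vnorm uf"
  using vnorm_mult_mat_vec_le[OF K1_carrier, of "0\<^sub>v (a + l) @\<^sub>v uf"]
  by (simp add: K2_mult append_carrier_vec[of _ "a + l" _ b, unfolded add.assoc])

lemma spectral_norm_K2_le: "spectral_norm (K2_mat d) \<le> spectral_norm (K1_mat d)"
  by (rule spectral_norm_le[OF K2_carrier]) (auto intro: K2_norm)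

lemma K2T_K1_carrier: "(K2_mat d)\<^sup>T * K1_mat d \<in> carrier_mat b (a + (l + b))"
  using K1_carrier K2_carrier by (intro mult_carrier_mat) auto

abbreviation normal_mat :: "real mat" where
  "normal_mat \<equiv> (K2_mat d)\<^sup>T * K2_mat d + 1\<^sub>m (dim_row (U_f d))"

abbreviation normal_vec :: "real vec" where
  "normal_vec \<equiv> ((K2_mat d)\<^sup>T * K1_mat d) *\<^sub>v b0 d"

lemma normal_mat_carrier: "normal_mat \<in> carrier_mat b b"
  using dims K2_carrier by auto

lemma normal_vec_carrier: "normal_vec \<in> carrier_vec b"
  using K2T_K1_carrier b0_carrier by auto

lemma normal_mat_mult:
  assumes "w \<in> carrier_vec b"
  shows "normal_mat *\<^sub>v w = (K2_mat d)\<^sup>T *\<^sub>v (K2_mat d *\<^sub>v w) + w"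
  using assms dims K2_carrier by (simp add: add_mult_distrib_mat_vec[of _ b b] transpose_carrier_mat)

text \<open>Regularisation adds the identity to a positive semidefinite matrix.\<close>

lemma vnorm_le_normal_mat:
  assumes w: "w \<in> carrier_vec b"
  shows "vnorm w \<le> vnorm (normal_mat *\<^sub>v w)"
proof -
  have Kw: "K2_mat d *\<^sub>v w \<in> carrier_vec f" using K2_carrier w by auto
  have "(vnorm w)\<^sup>2 \<le> (vnorm (K2_mat d *\<^sub>v w))\<^sup>2 + w \<bullet> w" by (simp add: vnorm_power2[of w])
  also have "(vnorm (K2_mat d *\<^sub>v w))\<^sup>2 = ((K2_mat d)\<^sup>T *\<^sub>v (K2_mat d *\<^sub>v w)) \<bullet> w"
    unfolding vnorm_power2 by (rule transpose_vec_mult_scalar[OF K2_carrier w Kw, symmetric])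
  also have "\<dots> + w \<bullet> w = (normal_mat *\<^sub>v w) \<bullet> w"
    using w K2_carrier Kw by (simp add: normal_mat_mult add_scalar_prod_distrib[of _ b] mult_mat_vec_carrier[of _ b f])
  also have "\<dots> \<le> vnorm (normal_mat *\<^sub>v w) * vnorm w"
    using Cauchy_Schwarz_vec[of "normal_mat *\<^sub>v w" b w] normal_mat_carrier w by (auto intro: mult_mat_vec_carrier)
  finally show ?thesis
    using vnorm_nonneg[of w] vnorm_nonneg[of "normal_mat *\<^sub>v w"]
    by (cases "vnorm w = 0") (auto simp: power2_eq_square)
qed

lemma normal_inverse:
  obtains Gi where "mat_inverse normal_mat = Some Gi" "normal_mat * Gi = 1\<^sub>m b" "Gi * normal_mat = 1\<^sub>m b"
    "Gi \<in> carrier_mat b b"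
proof (rule kernel_trivial_imp_inverse[OF normal_mat_carrier])
  fix v :: "real vec" assume v: "v \<in> carrier_vec b" and "normal_mat *\<^sub>v v = 0\<^sub>v b"
  hence "vnorm v = 0" using vnorm_le_normal_mat[OF v] vnorm_nonneg[of v] by simp
  thus "v = 0\<^sub>v b" using v vnorm_eq_0_imp by blast
qed

lemma vnorm_le_normal_inverse:
  assumes "w \<in> carrier_vec b"
  shows "vnorm w \<le> spectral_norm (the (mat_inverse normal_mat)) * vnorm (normal_mat *\<^sub>v w)"
proof -
  obtain Gi where Gi: "mat_inverse normal_mat = Some Gi" "Gi * normal_mat = 1\<^sub>m b" "Gi \<in> carrier_mat b b"
    using normal_inverse by metis
  have "w = Gi *\<^sub>v (normal_mat *\<^sub>v w)"
    using Gi assms normal_mat_carrier by (simp flip: assoc_mult_mat_vec[of _ b b _ b])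
  thus ?thesis
    using vnorm_mult_mat_vec_le[OF Gi(3), of "normal_mat *\<^sub>v w"] normal_mat_carrier assms
    by (simp add: Gi(1) mult_mat_vec_carrier[of _ b b])
qed

lemma spectral_norm_normal_inverse_le: "spectral_norm (the (mat_inverse normal_mat)) \<le> 1"
proof -
  obtain Gi where Gi: "mat_inverse normal_mat = Some Gi" "normal_mat * Gi = 1\<^sub>m b" "Gi \<in> carrier_mat b b"
    using normal_inverse by metis
  have "spectral_norm Gi \<le> 1"
  proof (rule spectral_norm_le[OF Gi(3)])
    fix x :: "real vec" assume x: "x \<in> carrier_vec b"
    have "vnorm (Gi *\<^sub>v x) \<le> vnorm (normal_mat *\<^sub>v (Gi *\<^sub>v x))"
      using Gi(3) x by (intro vnorm_le_normal_mat) auto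
    also have "normal_mat *\<^sub>v (Gi *\<^sub>v x) = x"
      using Gi x normal_mat_carrier by (simp flip: assoc_mult_mat_vec[of _ b b _ b])
    finally show "vnorm (Gi *\<^sub>v x) \<le> 1 * vnorm x" by simp
  qed simp
  thus ?thesis by (simp add: Gi(1))
qed

text \<open>Completing the square: at a solution of the normal equation the linear term vanishes.\<close>

lemma reg_cost_shift:
  assumes u: "u \<in> carrier_vec b" and eq: "normal_mat *\<^sub>v u = - normal_vec" and w: "w \<in> carrier_vec b"
  shows "reg_cost d u + (vnorm w)\<^sup>2 \<le> reg_cost d (u + w)"
proof -
  define y where "y = K1_mat d *\<^sub>v b0 d + K2_mat d *\<^sub>v u"
  define z where "z = K2_mat d *\<^sub>v w"
  have yz: "y \<in> carrier_vec f" "z \<in> carrier_vec f"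
    using K1_carrier K2_carrier b0_carrier u w by (auto simp: y_def z_def)
  have KT: "(K2_mat d)\<^sup>T \<in> carrier_mat b f" using K2_carrier by simp
  have "(K2_mat d)\<^sup>T *\<^sub>v y + u = normal_vec + normal_mat *\<^sub>v u"
    using KT K1_carrier K2_carrier b0_carrier u normal_vec_carrier
    by (simp add: y_def normal_mat_mult mult_add_distrib_mat_vec[OF KT] assoc_add_vec[of _ b] mult_mat_vec_carrier)
  also have "\<dots> = 0\<^sub>v b" using normal_vec_carrier by (simp add: eq)
  finally have 0: "(K2_mat d)\<^sup>T *\<^sub>v y + u = 0\<^sub>v b" .
  have "y \<bullet> z + u \<bullet> w = ((K2_mat d)\<^sup>T *\<^sub>v y) \<bullet> w + u \<bullet> w"
    using transpose_vec_mult_scalar[OF K2_carrier w yz(1)] by (simp add: z_def)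
  also have "\<dots> = ((K2_mat d)\<^sup>T *\<^sub>v y + u) \<bullet> w"
    using KT yz u w by (simp add: add_scalar_prod_distrib[of _ b] mult_mat_vec_carrier)
  also have "\<dots> = 0" using w by (simp add: 0)
  finally have cross: "y \<bullet> z + u \<bullet> w = 0" .
  have sq: "(vnorm (p + q))\<^sup>2 = (vnorm p)\<^sup>2 + 2 * (p \<bullet> q) + (vnorm q)\<^sup>2"
    if "p \<in> carrier_vec k" "q \<in> carrier_vec k" for p q :: "real vec" and k
    using that comm_scalar_prod[OF that] unfolding vnorm_power2
    by (simp add: add_scalar_prod_distrib[of _ k] scalar_prod_add_distrib[of _ k])
  have "y_pred d (u + w) = y + z"
    using u w K1_carrier K2_carrier b0_carrier
    by (simp add: y_pred_split y_def z_def mult_add_distrib_mat_vec[OF K2_carrier] assoc_add_vec[of _ f] mult_mat_vec_carrier)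
  hence "reg_cost d (u + w) = (vnorm y)\<^sup>2 + (vnorm z)\<^sup>2 + (vnorm u)\<^sup>2 + (vnorm w)\<^sup>2 + 2 * (y \<bullet> z + u \<bullet> w)"
    by (simp add: reg_cost_def sq[OF yz] sq[OF u w])
  moreover have "reg_cost d u = (vnorm y)\<^sup>2 + (vnorm u)\<^sup>2"
    using u by (simp add: reg_cost_def y_pred_split y_def)
  ultimately show ?thesis by (simp only: cross) simp
qed

lemma normal_equation_solvable:
  obtains u where "u \<in> carrier_vec b" "normal_mat *\<^sub>v u = - normal_vec"
proof -
  obtain Gi where Gi: "normal_mat * Gi = 1\<^sub>m b" "Gi \<in> carrier_mat b b" using normal_inverse by metis
  have "normal_mat *\<^sub>v (Gi *\<^sub>v (- normal_vec)) = - normal_vec"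
    using Gi normal_mat_carrier normal_vec_carrier
    by (simp flip: assoc_mult_mat_vec[of _ b b _ b])
  moreover have "Gi *\<^sub>v (- normal_vec) \<in> carrier_vec b" using Gi normal_vec_carrier by auto
  ultimately show thesis using that by blast
qed

lemma normal_equation_imp_minimal:
  assumes "u \<in> carrier_vec b" "normal_mat *\<^sub>v u = - normal_vec"
  shows "is_arg_min (reg_cost d) (\<lambda>v. v \<in> carrier_vec b) u"
proof -
  have "reg_cost d u \<le> reg_cost d v" if "v \<in> carrier_vec b" for v
  proof -
    have v: "u + (v - u) = v" using that assms by (intro eq_vecI) auto
    have "reg_cost d u \<le> reg_cost d u + (vnorm (v - u))\<^sup>2" by simp
    also have "\<dots> \<le> reg_cost d (u + (v - u))"
      by (rule reg_cost_shift[OF assms]) (use that assms in auto)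
    finally show ?thesis by (simp add: v)
  qed
  thus ?thesis using assms(1) by (simp add: is_arg_min_linorder)
qed

lemma minimal_imp_normal_equation:
  assumes "is_arg_min (reg_cost d) (\<lambda>v. v \<in> carrier_vec b) v"
  shows "v \<in> carrier_vec b" "normal_mat *\<^sub>v v = - normal_vec"
proof -
  show v: "v \<in> carrier_vec b" using assms by (simp add: is_arg_min_def)
  obtain u where u: "u \<in> carrier_vec b" "normal_mat *\<^sub>v u = - normal_vec"
    using normal_equation_solvable by blast
  have eq: "u + (v - u) = v" using v u by (intro eq_vecI) auto
  have "reg_cost d u + (vnorm (v - u))\<^sup>2 \<le> reg_cost d v"
    using reg_cost_shift[OF u, of "v - u"] v u by (simp add: eq)
  moreover have "reg_cost d v \<le> reg_cost d u" using assms u(1) by (simp add: is_arg_min_linorder)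
  ultimately have "(vnorm (v - u))\<^sup>2 \<le> 0" by linarith
  hence "v - u = 0\<^sub>v b" using v u(1) by (intro vnorm_eq_0_imp) auto
  hence "v = u" using eq u(1) by simp
  thus "normal_mat *\<^sub>v v = - normal_vec" using u(2) by simp
qed

lemma u_opt_minimal: "is_arg_min (reg_cost d) (\<lambda>v. v \<in> carrier_vec b) (u_opt d)"
proof -
  obtain u where "is_arg_min (reg_cost d) (\<lambda>v. v \<in> carrier_vec b) u"
    using normal_equation_solvable normal_equation_imp_minimal by blast
  moreover have "inputs_f d = carrier_vec b" using dims by (simp add: inputs_f_def)
  ultimately show ?thesis
    unfolding u_opt_def arg_min_on_def arg_min_def by (simp add: someI)
qed

lemmas u_opt = minimal_imp_normal_equation[OF u_opt_minimal]

text \<open>Since the matrix of the normal equation exceeds the identity, its solution is at most as long as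
  its right-hand side.\<close>

lemma vnorm_minimiser_le:
  assumes "u \<in> carrier_vec b" "normal_mat *\<^sub>v u = - normal_vec"
  shows "vnorm u \<le> vnorm normal_vec"
  using vnorm_le_normal_mat[OF assms(1)] assms(2) by simp

end

section \<open>Comparing noisy and noiseless data\<close>

lemma max_norm_minus_commute:
  assumes "A \<in> carrier_mat r c" "B \<in> carrier_mat r c"
  shows "max_norm (A - B) = max_norm (B - A)"
proof -
  have "{\<bar>(A - B) $$ (i, j)\<bar> | i j. i < r \<and> j < c} = {\<bar>(B - A) $$ (i, j)\<bar> | i j. i < r \<and> j < c}"
    using assms by (intro Collect_cong ex_cong1) (auto simp: abs_minus_commute)
  thus ?thesis using assms by (simp add: max_norm_def)
qed

lemma vnorm_inf_minus_commute:
  assumes "v \<in> carrier_vec k" "w \<in> carrier_vec k"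
  shows "vnorm_inf (v - w) = vnorm_inf (w - v)"
proof -
  have "{\<bar>(v - w) $ i\<bar> | i. i < k} = {\<bar>(w - v) $ i\<bar> | i. i < k}"
    using assms by (intro Collect_cong ex_cong1) (auto simp: abs_minus_commute)
  thus ?thesis using assms by (simp add: vnorm_inf_def)
qed

lemma vec_add_diff: "v \<in> carrier_vec k \<Longrightarrow> w \<in> carrier_vec k \<Longrightarrow> w + (v - w) = (v :: real vec)"
  by (intro eq_vecI) auto

lemma vec_add_diff_cancel: "v \<in> carrier_vec k \<Longrightarrow> w \<in> carrier_vec k \<Longrightarrow> (w + v) - w = (v :: real vec)"
  by (intro eq_vecI) auto

lemma vec_diff_diff:
  "p \<in> carrier_vec k \<Longrightarrow> q \<in> carrier_vec k \<Longrightarrow> h \<in> carrier_vec k \<Longrightarrow> p - h = (q - h) - (q - (p :: real vec))"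
  by (intro eq_vecI) auto

lemma vec_add_minus:
  "p \<in> carrier_vec k \<Longrightarrow> q \<in> carrier_vec k \<Longrightarrow> h \<in> carrier_vec k \<Longrightarrow> (p + q) - h = q - (h - (p :: real vec))"
  by (intro eq_vecI) auto

lemma mat_add_diff: "A \<in> carrier_mat r c \<Longrightarrow> B \<in> carrier_mat r c \<Longrightarrow> B + (A - B) = (A :: real mat)"
  by (intro eq_matI) auto

lemma spectral_norm_transpose_mult_diff_le:
  assumes A: "A \<in> carrier_mat k r" "A' \<in> carrier_mat k r"
    and B: "B \<in> carrier_mat k c" "B' \<in> carrier_mat k c"
  shows "spectral_norm (A'\<^sup>T * B' - A\<^sup>T * B)
    \<le> spectral_norm (A' - A) * spectral_norm B' + spectral_norm A * spectral_norm (B' - B)"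
proof -
  have AT: "A\<^sup>T \<in> carrier_mat r k" "(A' - A)\<^sup>T \<in> carrier_mat r k" using A by auto
  have "A'\<^sup>T * B' - A\<^sup>T * B = (A' - A)\<^sup>T * B' + A\<^sup>T * (B' - B)"
  proof (intro eq_matI)
    fix i j assume "i < dim_row ((A' - A)\<^sup>T * B' + A\<^sup>T * (B' - B))" "j < dim_col ((A' - A)\<^sup>T * B' + A\<^sup>T * (B' - B))"
    hence "i < r" "j < c" using A B by auto
    thus "(A'\<^sup>T * B' - A\<^sup>T * B) $$ (i, j) = ((A' - A)\<^sup>T * B' + A\<^sup>T * (B' - B)) $$ (i, j)"
      using A B by (simp add: scalar_prod_def sum_subtractf[symmetric] sum.distrib[symmetric] algebra_simps)
  qed (use A B in auto)
  also have "spectral_norm \<dots> \<le> spectral_norm ((A' - A)\<^sup>T * B') + spectral_norm (A\<^sup>T * (B' - B))"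
    using A B by (intro spectral_norm_add_le[of _ r c]) auto
  also have "\<dots> \<le> spectral_norm (A' - A)\<^sup>T * spectral_norm B' + spectral_norm A\<^sup>T * spectral_norm (B' - B)"
    using AT B by (intro add_mono spectral_norm_mult_le[of _ r k _ c]) (auto simp: minus_carrier_mat)
  also have "\<dots> \<le> spectral_norm (A' - A) * spectral_norm B' + spectral_norm A * spectral_norm (B' - B)"
    using A by (intro add_mono mult_right_mono spectral_norm_transpose_le[of _ k r]) (auto simp: minus_carrier_mat)
  finally show ?thesis .
qed

text \<open>\<open>d\<close> are the noiseless and \<open>dh\<close> the noisy data. As the output blocks have at most \<open>N\<close> rows, entrywise
  noise of size \<open>\<delta>\<close> is noise of size \<open>N * \<delta>\<close> in the operator norm.\<close>

locale noisy_data = bar: data_dims d a l b f N + hat: data_dims dh a l b f N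
  for d dh :: data and a l b f N :: nat +
  fixes \<delta> :: real
  assumes inputs_eq: "U_p dh = U_p d" "U_f dh = U_f d" "u_p dh = u_p d"
    and noise: "0 < \<delta>" "noise_bound \<delta> dh d"
    and le_N: "l \<le> N" "f \<le> N"
begin

lemma noise_le: "max_norm (Y_p dh - Y_p d) \<le> \<delta>" "max_norm (Y_f dh - Y_f d) \<le> \<delta>"
    "vnorm_inf (y_p dh - y_p d) \<le> \<delta>"
  using noise(2) by (auto simp: noise_bound_def)

lemma Y_f_noise:
  assumes "z \<in> carrier_vec N"
  shows "vnorm ((Y_f dh - Y_f d) *\<^sub>v z) \<le> N * \<delta> * vnorm z"
  using assms bar.dims hat.dims noise le_N noise_le
  by (intro vnorm_mult_mat_vec_le_max_norm[of _ f N]) auto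

lemma H_noise_vec:
  assumes z: "z \<in> carrier_vec N"
  shows "vnorm (H_mat dh *\<^sub>v z - H_mat d *\<^sub>v z) \<le> N * \<delta> * vnorm z"
proof -
  have Y: "Y_p d *\<^sub>v z \<in> carrier_vec l" "Y_p dh *\<^sub>v z \<in> carrier_vec l"
    using bar.dims hat.dims z by (auto intro: mult_mat_vec_carrier)
  have "H_mat dh *\<^sub>v z - H_mat d *\<^sub>v z
    = 0\<^sub>v a @\<^sub>v (Y_p dh *\<^sub>v z - Y_p d *\<^sub>v z) @\<^sub>v 0\<^sub>v b"
    using z Y bar.dims hat.dims by (intro eq_vecI) (auto simp: bar.H_mult hat.H_mult inputs_eq)
  also have "vnorm \<dots> = vnorm ((Y_p dh - Y_p d) *\<^sub>v z)"
    using z bar.dims hat.dims by (simp add: minus_mult_distrib_mat_vec[of _ l N])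
  also have "\<dots> \<le> N * \<delta> * vnorm z"
    using z bar.dims hat.dims noise le_N noise_le
    by (intro vnorm_mult_mat_vec_le_max_norm[of _ l N]) auto
  finally show ?thesis .
qed

lemma spectral_norm_H_noise: "spectral_norm (H_mat dh - H_mat d) \<le> N * \<delta>"
proof (rule spectral_norm_le[of _ "a + (l + b)" N])
  fix z :: "real vec" assume "z \<in> carrier_vec N"
  thus "vnorm ((H_mat dh - H_mat d) *\<^sub>v z) \<le> N * \<delta> * vnorm z"
    using H_noise_vec bar.H_carrier hat.H_carrier
    by (simp add: minus_mult_distrib_mat_vec[of _ "a + (l + b)" N])
qed (use bar.H_carrier noise in \<open>auto simp: minus_carrier_mat\<close>)

text \<open>Full row rank is stable: either of the two data matrices inherits it from the other one.\<close>

lemma H_transpose_noise: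
  assumes v: "v \<in> carrier_vec (a + (l + b))"
  shows "\<bar>vnorm ((H_mat dh)\<^sup>T *\<^sub>v v) - vnorm ((H_mat d)\<^sup>T *\<^sub>v v)\<bar> \<le> N * \<delta> * vnorm v"
proof -
  let ?D = "H_mat dh - H_mat d"
  have D: "?D \<in> carrier_mat (a + (l + b)) N" using bar.H_carrier by (simp add: minus_carrier_mat)
  have H: "(H_mat dh)\<^sup>T \<in> carrier_mat N (a + (l + b))" "(H_mat d)\<^sup>T \<in> carrier_mat N (a + (l + b))"
    using bar.H_carrier hat.H_carrier by auto
  have "(H_mat dh)\<^sup>T *\<^sub>v v - (H_mat d)\<^sup>T *\<^sub>v v = ?D\<^sup>T *\<^sub>v v"
    using H v transpose_minus[of "H_mat dh" "a + (l + b)" N "H_mat d"] bar.H_carrier hat.H_carrier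
    by (simp add: minus_mult_distrib_mat_vec[of _ N "a + (l + b)"])
  also have "vnorm \<dots> \<le> spectral_norm ?D\<^sup>T * vnorm v"
    by (rule vnorm_mult_mat_vec_le[of _ N "a + (l + b)"]) (use D v in auto)
  also have "\<dots> \<le> N * \<delta> * vnorm v"
    using spectral_norm_transpose_le[OF D] spectral_norm_H_noise by (intro mult_right_mono) auto
  finally have *: "vnorm ((H_mat dh)\<^sup>T *\<^sub>v v - (H_mat d)\<^sup>T *\<^sub>v v) \<le> N * \<delta> * vnorm v" .
  have c: "(H_mat dh)\<^sup>T *\<^sub>v v \<in> carrier_vec N" "(H_mat d)\<^sup>T *\<^sub>v v \<in> carrier_vec N" using H v by auto
  show ?thesis
    using * vnorm_triangle_sub[OF c] vnorm_triangle_sub[OF c(2,1)] vnorm_minus_commute[OF c] by linarith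
qed

lemma y_p_noise: "vnorm (y_p dh - y_p d) \<le> sqrt l * \<delta>"
  using noise noise_le abs_le_vnorm_inf[of _ "y_p dh - y_p d"] bar.dims hat.dims
  by (intro vnorm_le_sqrt_times_bound) (auto intro: order_trans)

lemma b_vec_noise:
  assumes "u \<in> carrier_vec b"
  shows "vnorm (b_vec dh u - b_vec d u) \<le> sqrt l * \<delta>"
proof -
  have "b_vec dh u - b_vec d u = 0\<^sub>v a @\<^sub>v (y_p dh - y_p d) @\<^sub>v 0\<^sub>v b"
    using assms bar.dims hat.dims by (intro eq_vecI) (auto simp: b_vec_def inputs_eq)
  thus ?thesis using y_p_noise by simp
qed

lemma b0_noise: "vnorm (b0 dh - b0 d) \<le> sqrt l * \<delta>"
  using b_vec_noise[of "0\<^sub>v b"] bar.dims hat.dims by (simp add: b0_def inputs_eq)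

end

text \<open>The hypothesis \<open>consistent\<close> is the only trace of the linear system: the past window and the
  inputs determine the future outputs. It turns \<open>K1_mat d\<close> into a genuine model of the data, with
  \<open>K1_mat d * H_mat d = Y_f d\<close>. If the noise is \<open>small\<close>, then the noiseless data matrix retains at least
  half of the bound \<open>e\<close> on the singular values.\<close>

locale noisy_predictor = noisy_data d dh a l b f N \<delta> +
    bar: predictor d a l b f N "e / 2" + hat: predictor dh a l b f N e
  for d dh :: data and a l b f N :: nat and \<delta> e :: real +
  assumes consistent: "\<And>z. z \<in> carrier_vec N \<Longrightarrow> H_mat d *\<^sub>v z = 0\<^sub>v (a + (l + b)) \<Longrightarrow> Y_f d *\<^sub>v z = 0\<^sub>v f"
    and small: "2 * N * \<delta> \<le> e"
begin

lemma Y_f_cong: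
  assumes z: "z \<in> carrier_vec N" "z' \<in> carrier_vec N" and eq: "H_mat d *\<^sub>v z = H_mat d *\<^sub>v z'"
  shows "Y_f d *\<^sub>v z = Y_f d *\<^sub>v z'"
proof -
  have "H_mat d *\<^sub>v (z - z') = 0\<^sub>v (a + (l + b))"
    using z bar.H_carrier eq by (simp add: mult_minus_distrib_mat_vec[OF bar.H_carrier] mult_mat_vec_carrier)
  hence "Y_f d *\<^sub>v (z - z') = 0\<^sub>v f" using z by (intro consistent) auto
  hence 0: "Y_f d *\<^sub>v z - Y_f d *\<^sub>v z' = 0\<^sub>v f"
    using z bar.dims by (simp add: mult_minus_distrib_mat_vec[of _ f N])
  show ?thesis
  proof (intro eq_vecI)
    fix i assume "i < dim_vec (Y_f d *\<^sub>v z')"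
    thus "(Y_f d *\<^sub>v z) $ i = (Y_f d *\<^sub>v z') $ i"
      using arg_cong[OF 0, of "\<lambda>v. v $ i"] bar.dims by simp
  qed (use bar.dims in auto)
qed

lemma K1_H_mult:
  assumes z: "z \<in> carrier_vec N"
  shows "K1_mat d *\<^sub>v (H_mat d *\<^sub>v z) = Y_f d *\<^sub>v z"
proof -
  have Hz: "H_mat d *\<^sub>v z \<in> carrier_vec (a + (l + b))" using bar.H_carrier z by auto
  have P: "pinv (H_mat d) *\<^sub>v (H_mat d *\<^sub>v z) \<in> carrier_vec N" using bar.pinv_H(1) Hz by auto
  have "K1_mat d *\<^sub>v (H_mat d *\<^sub>v z) = Y_f d *\<^sub>v (pinv (H_mat d) *\<^sub>v (H_mat d *\<^sub>v z))"
    unfolding K1_mat_def by (rule assoc_mult_mat_vec[OF bar.dims(4) bar.pinv_H(1) Hz])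
  also have "\<dots> = Y_f d *\<^sub>v z" by (rule Y_f_cong[OF P z bar.H_pinv_mult[OF Hz]])
  finally show ?thesis .
qed

subsection \<open>The noiseless prediction is feasible for the robust problem\<close>

text \<open>The noiseless coefficients \<open>g_vec d u\<close> need not be close to \<open>g_vec dh u\<close>, since the two lie in
  different row spaces. The witness is instead the correction of \<open>g_vec dh u\<close> that is smallest among
  those that reproduce the noiseless right-hand side; it predicts the same outputs.\<close>

definition g_witness :: "real vec \<Rightarrow> real vec" where
  "g_witness u = g_vec dh u + pinv (H_mat d) *\<^sub>v (b_vec d u - H_mat d *\<^sub>v g_vec dh u)"

lemma g_witness:
  assumes u: "u \<in> carrier_vec b"
  shows "g_witness u \<in> carrier_vec N" "H_mat d *\<^sub>v g_witness u = b_vec d u"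
    "Y_f d *\<^sub>v g_witness u = y_pred d u"
    "vnorm (g_witness u - g_vec dh u) \<le> 2 / e * (sqrt l + N * vnorm (g_vec dh u)) * \<delta>"
proof -
  let ?g = "g_vec dh u" and ?r = "b_vec d u - H_mat d *\<^sub>v g_vec dh u"
  have g: "?g \<in> carrier_vec N" by (rule hat.g_vec_carrier[OF u])
  have bb: "b_vec d u \<in> carrier_vec (a + (l + b))" "b_vec dh u \<in> carrier_vec (a + (l + b))"
    using u bar.b_vec_carrier hat.b_vec_carrier by auto
  have Hg: "H_mat d *\<^sub>v ?g \<in> carrier_vec (a + (l + b))" using bar.H_carrier g by auto
  have r: "?r \<in> carrier_vec (a + (l + b))" using bb Hg by auto
  have Pr: "pinv (H_mat d) *\<^sub>v ?r \<in> carrier_vec N" using bar.pinv_H(1) r by auto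
  show w: "g_witness u \<in> carrier_vec N" using g Pr by (simp add: g_witness_def)
  have "H_mat d *\<^sub>v g_witness u = H_mat d *\<^sub>v ?g + ?r"
    unfolding g_witness_def using g Pr r
    by (simp add: mult_add_distrib_mat_vec[OF bar.H_carrier] bar.H_pinv_mult)
  also have "\<dots> = b_vec d u" by (rule vec_add_diff[OF bb(1) Hg])
  finally show Hw: "H_mat d *\<^sub>v g_witness u = b_vec d u" .
  have "H_mat d *\<^sub>v g_vec d u = b_vec d u"
    unfolding g_vec_def by (rule bar.H_pinv_mult[OF bb(1)])
  thus "Y_f d *\<^sub>v g_witness u = y_pred d u"
    unfolding y_pred_def using Hw w bar.g_vec_carrier[OF u] by (intro Y_f_cong) auto
  have "H_mat dh *\<^sub>v ?g = b_vec dh u"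
    unfolding g_vec_def by (rule hat.H_pinv_mult[OF bb(2)])
  hence "?r = (H_mat dh *\<^sub>v ?g - H_mat d *\<^sub>v ?g) - (b_vec dh u - b_vec d u)"
    using vec_diff_diff[OF bb(1,2) Hg] by simp
  also have "vnorm \<dots> \<le> N * \<delta> * vnorm ?g + sqrt l * \<delta>"
    using H_noise_vec[OF g] b_vec_noise[OF u]
      vnorm_minus_le[OF minus_carrier_vec[OF mult_mat_vec_carrier[OF hat.H_carrier g] Hg]
        minus_carrier_vec[OF bb(2,1)]]
    by linarith
  finally have r_le: "vnorm ?r \<le> (sqrt l + N * vnorm ?g) * \<delta>" by (simp add: algebra_simps)
  have "g_witness u - ?g = pinv (H_mat d) *\<^sub>v ?r"
    unfolding g_witness_def by (rule vec_add_diff_cancel[OF Pr g])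
  also have "vnorm \<dots> \<le> spectral_norm (pinv (H_mat d)) * vnorm ?r"
    by (rule vnorm_mult_mat_vec_le[OF bar.pinv_H(1) r])
  also have "\<dots> \<le> 2 / e * ((sqrt l + N * vnorm ?g) * \<delta>)"
    using bar.pinv_H(3) r_le hat.e by (intro mult_mono) auto
  finally show "vnorm (g_witness u - ?g) \<le> 2 / e * (sqrt l + N * vnorm ?g) * \<delta>" by (simp add: mult_ac)
qed

lemma worst_feasible_witness:
  assumes u: "u \<in> carrier_vec b" and sig: "sigma_min (H_mat dh) = e"
  shows "worst_feasible l N \<delta> dh u (Y_p d - Y_p dh) (Y_f d - Y_f dh) (y_p d - y_p dh)
    (g_witness u) (y_pred d u)"
proof -
  note w = g_witness[OF u]
  have "(U_p d *\<^sub>v g_witness u) @\<^sub>v (Y_p d *\<^sub>v g_witness u) @\<^sub>v (U_f d *\<^sub>v g_witness u) = u_p d @\<^sub>v y_p d @\<^sub>v u"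
    using w(2) bar.H_mult[OF w(1)] by (simp add: b_vec_def)
  hence eqs: "U_p d *\<^sub>v g_witness u = u_p d" "Y_p d *\<^sub>v g_witness u = y_p d" "U_f d *\<^sub>v g_witness u = u"
    using bar.dims w(1) append_vec_eq[of "U_p d *\<^sub>v g_witness u" a "u_p d"]
      append_vec_eq[of "Y_p d *\<^sub>v g_witness u" l "y_p d"]
    by auto
  have "max_norm (Y_p d - Y_p dh) \<le> \<delta>" "max_norm (Y_f d - Y_f dh) \<le> \<delta>" "vnorm_inf (y_p d - y_p dh) \<le> \<delta>"
    using noise_le max_norm_minus_commute[OF bar.dims(2) hat.dims(2)]
      max_norm_minus_commute[OF bar.dims(4) hat.dims(4)] vnorm_inf_minus_commute[OF bar.dims(6) hat.dims(6)]
    by auto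
  moreover have "(vnorm (g_witness u - g_vec dh u))\<^sup>2 \<le> (C_radius l N dh u)\<^sup>2 * \<delta>\<^sup>2"
    unfolding power_mult_distrib[symmetric]
    using w(4) by (intro power_mono) (simp_all add: C_radius_def sig field_simps)
  ultimately show ?thesis
    unfolding worst_feasible_def
    using bar.dims hat.dims hat.H_carrier w(1,3) eqs vec_add_diff[OF bar.dims(6) hat.dims(6)]
      mat_add_diff[OF bar.dims(2) hat.dims(2)] mat_add_diff[OF bar.dims(4) hat.dims(4)]
      mult_mat_vec_carrier[OF bar.dims(4) w(1)]
    by (auto simp: inputs_eq minus_carrier_mat)
qed

text \<open>All feasible outputs lie in one ball around the noisy prediction: both the coefficients and the
  output block deviate by amounts of the order of the noise. As the noiseless prediction is feasible,
  the same estimate compares the noiseless with the noisy prediction.\<close>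

lemma worst_feasible_bound:
  fixes \<gamma> :: real
  assumes u: "u \<in> carrier_vec b" and sig: "sigma_min (H_mat dh) = e"
    and feas: "worst_feasible l N \<delta> dh u DYp DYf Dyp g yf"
    and G: "vnorm (g_vec dh u) \<le> \<gamma>"
  shows "vnorm (yf - y_pred dh u) \<le>
    ((spectral_norm (Y_f dh) + N * \<delta>) * (2 / e * (sqrt l + N * \<gamma>) * \<delta>) + N * \<gamma> * \<delta>)"
proof -
  let ?g = "g_vec dh u"
  have gh: "?g \<in> carrier_vec N" by (rule hat.g_vec_carrier[OF u])
  have fe: "DYf \<in> carrier_mat f N" "g \<in> carrier_vec N" "yf = (Y_f dh + DYf) *\<^sub>v g" "max_norm DYf \<le> \<delta>"
    "(vnorm (g - ?g))\<^sup>2 \<le> (C_radius l N dh u)\<^sup>2 * \<delta>\<^sup>2"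
    using feas hat.dims hat.H_carrier by (auto simp: worst_feasible_def)
  have "vnorm (g - ?g) \<le> C_radius l N dh u * \<delta>"
  proof (rule power2_le_imp_le)
    show "(vnorm (g - ?g))\<^sup>2 \<le> (C_radius l N dh u * \<delta>)\<^sup>2" using fe(5) by (simp only: power_mult_distrib)
    show "0 \<le> C_radius l N dh u * \<delta>" using hat.e(1) noise(1) by (simp add: C_radius_def sig)
  qed
  also have "\<dots> = 2 / e * (sqrt l + N * vnorm ?g) * \<delta>" by (simp add: C_radius_def sig divide_inverse)
  also have "\<dots> \<le> 2 / e * (sqrt l + N * \<gamma>) * \<delta>"
    using G hat.e noise by (intro mult_right_mono mult_left_mono add_left_mono) auto
  finally have dg: "vnorm (g - ?g) \<le> 2 / e * (sqrt l + N * \<gamma>) * \<delta>" .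
  have D: "vnorm (DYf *\<^sub>v z) \<le> N * \<delta> * vnorm z" if "z \<in> carrier_vec N" for z
    using that fe noise le_N by (intro vnorm_mult_mat_vec_le_max_norm[of _ f N]) auto
  define p q r where "p = Y_f dh *\<^sub>v (g - ?g)" and "q = DYf *\<^sub>v (g - ?g)" and "r = DYf *\<^sub>v ?g"
  have c: "p \<in> carrier_vec f" "q \<in> carrier_vec f" "r \<in> carrier_vec f" "y_pred dh u \<in> carrier_vec f"
    using hat.dims fe gh by (auto simp: p_def q_def r_def y_pred_def intro!: mult_mat_vec_carrier)
  have gsum: "g = ?g + (g - ?g)" by (rule vec_add_diff[OF fe(2) gh, symmetric])
  have "yf = Y_f dh *\<^sub>v (?g + (g - ?g)) + DYf *\<^sub>v (?g + (g - ?g))"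
    using fe(1,2) hat.dims by (simp only: fe(3) gsum[symmetric]) (simp add: add_mult_distrib_mat_vec[of _ f N])
  also have "\<dots> = (y_pred dh u + p) + (r + q)"
    using fe gh hat.dims
    by (simp add: mult_add_distrib_mat_vec[of _ f N] p_def q_def r_def y_pred_def)
  finally have "yf - y_pred dh u = (p + q) + r" using c by (intro eq_vecI) auto
  also have "vnorm \<dots> \<le> (vnorm p + vnorm q) + vnorm r"
    using c by (intro order_trans[OF vnorm_triangle[of _ f]] add_mono vnorm_triangle[of _ f]) auto
  also have "vnorm p \<le> spectral_norm (Y_f dh) * vnorm (g - ?g)"
    unfolding p_def using hat.dims fe gh by (intro vnorm_mult_mat_vec_le[of _ f N]) auto
  also have "vnorm q \<le> N * \<delta> * vnorm (g - ?g)" unfolding q_def using fe gh by (intro D) auto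
  also have "spectral_norm (Y_f dh) * vnorm (g - ?g) + N * \<delta> * vnorm (g - ?g)
    = (spectral_norm (Y_f dh) + N * \<delta>) * vnorm (g - ?g)" by (simp add: algebra_simps)
  also have "\<dots> \<le> (spectral_norm (Y_f dh) + N * \<delta>) * (2 / e * (sqrt l + N * \<gamma>) * \<delta>)"
    using dg noise by (intro mult_left_mono) auto
  also have "vnorm r \<le> N * \<delta> * \<gamma>"
    unfolding r_def using G noise by (intro order_trans[OF D[OF gh]] mult_left_mono) auto
  finally show ?thesis by (simp add: mult_ac)
qed

lemma bdd_above_worst:
  assumes u: "u \<in> carrier_vec b" and sig: "sigma_min (H_mat dh) = e"
  shows "bdd_above {(vnorm yf)\<^sup>2 + (vnorm u)\<^sup>2 | DYp DYf Dyp g yf. worst_feasible l N \<delta> dh u DYp DYf Dyp g yf}"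
proof (rule bdd_aboveI, clarify)
  fix DYp DYf Dyp g yf
  let ?c = "((spectral_norm (Y_f dh) + N * \<delta>) * (2 / e * (sqrt l + N * vnorm (g_vec dh u)) * \<delta>)
    + N * vnorm (g_vec dh u) * \<delta>)"
  assume feas: "worst_feasible l N \<delta> dh u DYp DYf Dyp g yf"
  hence "yf \<in> carrier_vec f" using hat.dims by (auto simp: worst_feasible_def)
  hence "vnorm yf \<le> vnorm (y_pred dh u) + vnorm (yf - y_pred dh u)"
    using hat.y_pred_carrier[OF u] by (rule vnorm_triangle_sub)
  also have "\<dots> \<le> vnorm (y_pred dh u) + ?c"
    using worst_feasible_bound[OF u sig feas order_refl] by simp
  finally show "(vnorm yf)\<^sup>2 + (vnorm u)\<^sup>2 \<le> (vnorm (y_pred dh u) + ?c)\<^sup>2 + (vnorm u)\<^sup>2"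
    by (simp add: power_mono)
qed

lemma reg_cost_le_c_worst:
  assumes u: "u \<in> carrier_vec b" and sig: "sigma_min (H_mat dh) = e"
  shows "reg_cost d u \<le> c_worst l N \<delta> dh u"
  unfolding c_worst_def reg_cost_def
  using worst_feasible_witness[OF assms] by (intro cSup_upper bdd_above_worst[OF assms]) blast

subsection \<open>Perturbation of the optimal inputs\<close>

text \<open>Since \<open>K1_mat d\<close> maps \<open>H_mat d *\<^sub>v z\<close> to \<open>Y_f d *\<^sub>v z\<close>, evaluating both predictors at the
  vectors \<open>H_mat dh *\<^sub>v z\<close> shows that they differ by the noise only, times a factor that involves the
  noiseless predictor; smallness of the noise absorbs this factor.\<close>

lemma K1_diff: "spectral_norm (K1_mat d - K1_mat dh) \<le> F1 N \<delta> dh"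
proof -
  let ?K = "K1_mat d" and ?Kh = "K1_mat dh" and ?P = "pinv (H_mat dh)"
  define h where "h = spectral_norm ?P"
  define x where "x = spectral_norm (?K - ?Kh)"
  have h: "0 \<le> h" "h \<le> 1 / e" using hat.pinv_H(3) by (auto simp: h_def)
  have "N * \<delta> * h \<le> N * \<delta> * (1 / e)" using h noise by (intro mult_left_mono) auto
  also have "\<dots> \<le> 1 / 2" using small hat.e by (simp add: field_simps)
  finally have half: "N * \<delta> * h \<le> 1 / 2" .
  have x_le: "x \<le> (1 + spectral_norm ?K) * (N * \<delta> * h)"
    unfolding x_def
  proof (rule spectral_norm_le[of _ f "a + (l + b)"])
    fix w :: "real vec" assume w: "w \<in> carrier_vec (a + (l + b))"
    define z where "z = ?P *\<^sub>v w"
    have z: "z \<in> carrier_vec N" using hat.pinv_H(1) w by (auto simp: z_def)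
    have Hz: "H_mat dh *\<^sub>v z = w" unfolding z_def by (rule hat.H_pinv_mult[OF w])
    define v where "v = H_mat dh *\<^sub>v z - H_mat d *\<^sub>v z"
    have Hdz: "H_mat d *\<^sub>v z \<in> carrier_vec (a + (l + b))" using bar.H_carrier z by auto
    have v: "v \<in> carrier_vec (a + (l + b))" using Hdz Hz w by (simp add: v_def)
    have Yc: "Y_f d *\<^sub>v z \<in> carrier_vec f" "Y_f dh *\<^sub>v z \<in> carrier_vec f" "?K *\<^sub>v v \<in> carrier_vec f"
      using bar.dims hat.dims z bar.K1_carrier v by (auto intro: mult_mat_vec_carrier)
    have wsum: "w = H_mat d *\<^sub>v z + v" unfolding v_def Hz by (rule vec_add_diff[OF w Hdz, symmetric])
    have Kw: "?K *\<^sub>v w = Y_f d *\<^sub>v z + ?K *\<^sub>v v"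
      unfolding wsum using Hdz v z by (simp add: mult_add_distrib_mat_vec[OF bar.K1_carrier] K1_H_mult)
    have Khw: "?Kh *\<^sub>v w = Y_f dh *\<^sub>v z"
      unfolding K1_mat_def z_def by (rule assoc_mult_mat_vec[OF hat.dims(4) hat.pinv_H(1) w])
    have "(?K - ?Kh) *\<^sub>v w = ?K *\<^sub>v w - ?Kh *\<^sub>v w"
      by (rule minus_mult_distrib_mat_vec[OF bar.K1_carrier hat.K1_carrier w])
    also have "\<dots> = ?K *\<^sub>v v - (Y_f dh - Y_f d) *\<^sub>v z"
      unfolding Kw Khw minus_mult_distrib_mat_vec[OF hat.dims(4) bar.dims(4) z]
      by (rule vec_add_minus[OF Yc(1,3,2)])
    also have "vnorm \<dots> \<le> vnorm (?K *\<^sub>v v) + vnorm ((Y_f dh - Y_f d) *\<^sub>v z)"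
      using Yc z bar.dims hat.dims by (intro vnorm_minus_le[of _ f]) (auto intro!: mult_mat_vec_carrier minus_carrier_mat)
    also have "\<dots> \<le> spectral_norm ?K * (N * \<delta> * vnorm z) + N * \<delta> * vnorm z"
      using H_noise_vec[OF z] unfolding v_def[symmetric]
      by (intro add_mono Y_f_noise[OF z] order_trans[OF vnorm_mult_mat_vec_le[OF bar.K1_carrier v]] mult_left_mono) auto
    also have "\<dots> = (1 + spectral_norm ?K) * (N * \<delta>) * vnorm z" by (simp add: algebra_simps)
    also have "\<dots> \<le> (1 + spectral_norm ?K) * (N * \<delta>) * (h * vnorm w)"
      unfolding z_def h_def using noise
      by (intro mult_left_mono vnorm_mult_mat_vec_le[OF hat.pinv_H(1) w]) auto
    finally show "vnorm ((?K - ?Kh) *\<^sub>v w) \<le> (1 + spectral_norm ?K) * (N * \<delta> * h) * vnorm w"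
      by (simp add: mult_ac)
  qed (use hat.K1_carrier noise h in \<open>auto simp: minus_carrier_mat\<close>)
  have "(1 + spectral_norm ?K) * (N * \<delta> * h) \<le> (1 + spectral_norm ?Kh + x) * (N * \<delta> * h)"
    using spectral_norm_le_of_diff[OF bar.K1_carrier hat.K1_carrier] noise h
    by (intro mult_right_mono) (auto simp: x_def)
  also have "\<dots> \<le> (1 + spectral_norm ?Kh) * (N * \<delta> * h) + x * (1 / 2)"
    using mult_left_mono[OF half, of x] by (simp add: distrib_right x_def)
  finally have "x \<le> 2 * (N * \<delta> * h) * (1 + spectral_norm ?Kh)" using x_le by (simp add: algebra_simps)
  also have "\<dots> \<le> 2 * (N * \<delta> * h) * (1 + 4 * spectral_norm (Y_f dh) * h)"
  proof -
    have "spectral_norm ?Kh \<le> spectral_norm (Y_f dh) * h" using hat.spectral_norm_K1_le by (simp add: h_def)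
    moreover have "0 \<le> spectral_norm (Y_f dh) * h" using h by simp
    ultimately have "spectral_norm ?Kh \<le> 4 * (spectral_norm (Y_f dh) * h)" by linarith
    thus ?thesis using noise h by (intro mult_left_mono) (auto simp: mult.assoc)
  qed
  finally show ?thesis by (simp add: F1_def x_def h_def mult_ac)
qed

lemma F1_nonneg: "0 \<le> F1 N \<delta> dh"
  using K1_diff spectral_norm_nonneg order_trans by blast

lemma K2_diff: "spectral_norm (K2_mat d - K2_mat dh) \<le> F1 N \<delta> dh"
proof (rule spectral_norm_le[of _ f b])
  fix w :: "real vec" assume w: "w \<in> carrier_vec b"
  let ?w = "0\<^sub>v (a + l) @\<^sub>v w"
  have w': "?w \<in> carrier_vec (a + (l + b))" using w append_carrier_vec[of "0\<^sub>v (a + l)" "a + l" w b] by (simp add: add.assoc)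
  have "(K2_mat d - K2_mat dh) *\<^sub>v w = (K1_mat d - K1_mat dh) *\<^sub>v ?w"
    using w w' by (simp add: minus_mult_distrib_mat_vec[OF bar.K2_carrier hat.K2_carrier]
      minus_mult_distrib_mat_vec[OF bar.K1_carrier hat.K1_carrier] bar.K2_mult hat.K2_mult)
  also have "vnorm \<dots> \<le> spectral_norm (K1_mat d - K1_mat dh) * vnorm ?w"
    using w' hat.K1_carrier by (intro vnorm_mult_mat_vec_le[of _ f "a + (l + b)"]) (auto simp: minus_carrier_mat)
  also have "\<dots> \<le> F1 N \<delta> dh * vnorm w" using K1_diff by (simp add: mult_right_mono)
  finally show "vnorm ((K2_mat d - K2_mat dh) *\<^sub>v w) \<le> F1 N \<delta> dh * vnorm w" .
qed (use F1_nonneg hat.K2_carrier in \<open>auto simp: minus_carrier_mat\<close>)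

lemma K1_bar_le: "spectral_norm (K1_mat d) \<le> spectral_norm (K1_mat dh) + F1 N \<delta> dh"
  using spectral_norm_le_of_diff[OF bar.K1_carrier hat.K1_carrier] K1_diff by linarith

text \<open>The two products formed from \<^const>\<open>K2_mat\<close> in the normal equation are perturbed in the same way;
  \<^const>\<open>F2\<close> comes from \<open>X'\<^sup>T Y' - X\<^sup>T Y = (X' - X)\<^sup>T Y' + X\<^sup>T (Y' - Y)\<close>.\<close>

lemma K2T_mult_diff:
  assumes "B \<in> carrier_mat f c" "B' \<in> carrier_mat f c" "spectral_norm (B' - B) \<le> F1 N \<delta> dh"
    "spectral_norm B' \<le> spectral_norm (K1_mat dh) + F1 N \<delta> dh"
  shows "spectral_norm ((K2_mat d)\<^sup>T * B' - (K2_mat dh)\<^sup>T * B) \<le> F2 N \<delta> dh"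
proof -
  have "spectral_norm ((K2_mat d)\<^sup>T * B' - (K2_mat dh)\<^sup>T * B)
    \<le> spectral_norm (K2_mat d - K2_mat dh) * spectral_norm B' + spectral_norm (K2_mat dh) * spectral_norm (B' - B)"
    by (rule spectral_norm_transpose_mult_diff_le[OF hat.K2_carrier bar.K2_carrier assms(1,2)])
  also have "\<dots> \<le> F1 N \<delta> dh * (spectral_norm (K1_mat dh) + F1 N \<delta> dh) + spectral_norm (K1_mat dh) * F1 N \<delta> dh"
    using K2_diff assms F1_nonneg hat.spectral_norm_K2_le by (intro add_mono mult_mono) auto
  finally show ?thesis by (simp add: F2_def algebra_simps)
qed

lemma K2T_K1_diff: "spectral_norm ((K2_mat d)\<^sup>T * K1_mat d - (K2_mat dh)\<^sup>T * K1_mat dh) \<le> F2 N \<delta> dh"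
  by (rule K2T_mult_diff[OF hat.K1_carrier bar.K1_carrier K1_diff K1_bar_le])

lemma K2T_K2_diff: "spectral_norm ((K2_mat d)\<^sup>T * K2_mat d - (K2_mat dh)\<^sup>T * K2_mat dh) \<le> F2 N \<delta> dh"
  by (rule K2T_mult_diff[OF hat.K2_carrier bar.K2_carrier K2_diff])
    (use bar.spectral_norm_K2_le K1_bar_le in linarith)

lemma F2_nonneg: "0 \<le> F2 N \<delta> dh"
  using K2T_K1_diff spectral_norm_nonneg order_trans by blast

lemma normal_vec_diff: "vnorm (bar.normal_vec - hat.normal_vec) \<le> F3 l N \<delta> dh"
proof -
  let ?M = "(K2_mat d)\<^sup>T * K1_mat d" and ?Mh = "(K2_mat dh)\<^sup>T * K1_mat dh"
  note M = bar.K2T_K1_carrier and Mh = hat.K2T_K1_carrier and bd = bar.b0_carrier and bh = hat.b0_carrier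
  have D: "?M - ?Mh \<in> carrier_mat b (a + (l + b))" using Mh by (rule minus_carrier_mat)
  have "bar.normal_vec - hat.normal_vec = (?M - ?Mh) *\<^sub>v b0 d + ?Mh *\<^sub>v (b0 d - b0 dh)"
    unfolding minus_mult_distrib_mat_vec[OF M Mh bd] mult_minus_distrib_mat_vec[OF Mh bd bh]
    using mult_mat_vec_carrier[OF M bd] mult_mat_vec_carrier[OF Mh bd] mult_mat_vec_carrier[OF Mh bh]
    by (intro eq_vecI) auto
  also have "vnorm \<dots> \<le> vnorm ((?M - ?Mh) *\<^sub>v b0 d) + vnorm (?Mh *\<^sub>v (b0 d - b0 dh))"
    using D Mh bd bh by (intro vnorm_triangle[of _ b]) (auto intro!: mult_mat_vec_carrier)
  also have "vnorm ((?M - ?Mh) *\<^sub>v b0 d) \<le> spectral_norm (?M - ?Mh) * vnorm (b0 d)"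
    by (rule vnorm_mult_mat_vec_le[OF D bd])
  also have "\<dots> \<le> F2 N \<delta> dh * (vnorm (b0 dh) + sqrt l * \<delta>)"
    using K2T_K1_diff vnorm_triangle_sub[OF bd bh] b0_noise vnorm_minus_commute[OF bd bh] F2_nonneg
    by (intro mult_mono) auto
  also have "vnorm (?Mh *\<^sub>v (b0 d - b0 dh)) \<le> spectral_norm ?Mh * vnorm (b0 d - b0 dh)"
    using bd bh by (intro vnorm_mult_mat_vec_le[OF Mh]) auto
  also have "\<dots> \<le> spectral_norm ?Mh * (sqrt l * \<delta>)"
    using b0_noise vnorm_minus_commute[OF bd bh] by (intro mult_left_mono) auto
  finally show ?thesis by (simp add: F3_def mult_ac)
qed

text \<open>Both optimal inputs solve normal equations. Applied to the difference of the inputs, the noisy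
  matrix yields the perturbation of the right-hand side plus the perturbation of the matrix applied to
  the true optimum. The latter is at most as long as its own right-hand side.\<close>

lemma optimal_input_diff:
  assumes u: "u \<in> carrier_vec b" "bar.normal_mat *\<^sub>v u = - bar.normal_vec"
    and v: "v \<in> carrier_vec b" "hat.normal_mat *\<^sub>v v = - hat.normal_vec"
  shows "vnorm (u - v) \<le> F_bound l N \<delta> dh"
proof -
  let ?S = "(K2_mat d)\<^sup>T * K2_mat d" and ?Sh = "(K2_mat dh)\<^sup>T * K2_mat dh"
  let ?h = "vnorm hat.normal_vec" and ?g = "spectral_norm (the (mat_inverse hat.normal_mat))"
  let ?F2 = "F2 N \<delta> dh" and ?F3 = "F3 l N \<delta> dh"
  have S: "?S \<in> carrier_mat b b" "?Sh \<in> carrier_mat b b" "?S - ?Sh \<in> carrier_mat b b"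
    using bar.K2_carrier hat.K2_carrier by (auto simp: minus_carrier_mat)
  note nv = bar.normal_vec_carrier hat.normal_vec_carrier
  have F3: "0 \<le> ?F3" using normal_vec_diff vnorm_nonneg order_trans by blast
  have "vnorm u \<le> vnorm bar.normal_vec" by (rule bar.vnorm_minimiser_le[OF u])
  also have "\<dots> \<le> ?h + ?F3" using vnorm_triangle_sub[OF nv] normal_vec_diff by linarith
  finally have u_le: "vnorm u \<le> ?h + ?F3" .
  have mult_S: "bar.normal_mat *\<^sub>v u = ?S *\<^sub>v u + u" "hat.normal_mat *\<^sub>v u = ?Sh *\<^sub>v u + u"
    using u S bar.dims hat.dims by (simp_all add: add_mult_distrib_mat_vec[of _ b b])
  have Su: "?S *\<^sub>v u \<in> carrier_vec b" "?Sh *\<^sub>v u \<in> carrier_vec b" using S u(1) by (auto intro: mult_mat_vec_carrier)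
  have aux: "t + u - - q = - ((p - q) + (s - t))"
    if c: "s \<in> carrier_vec b" "t \<in> carrier_vec b" "p \<in> carrier_vec b" "q \<in> carrier_vec b"
      and eq: "s + u = - p" for s t p q :: "real vec"
  proof (intro eq_vecI)
    fix i assume "i < dim_vec (- ((p - q) + (s - t)))"
    hence i: "i < b" using c by simp
    hence "s $ i + u $ i = - (p $ i)" using arg_cong[OF eq, of "\<lambda>w. w $ i"] c u(1) by simp
    thus "(t + u - - q) $ i = (- ((p - q) + (s - t))) $ i" using i c u(1) by simp
  qed (use c u(1) in auto)
  have "?S *\<^sub>v u + u = - bar.normal_vec" using u(2) by (simp only: mult_S(1))
  have "hat.normal_mat *\<^sub>v (u - v) = hat.normal_mat *\<^sub>v u - hat.normal_mat *\<^sub>v v"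
    by (rule mult_minus_distrib_mat_vec[OF hat.normal_mat_carrier u(1) v(1)])
  also have "\<dots> = - ((bar.normal_vec - hat.normal_vec) + (?S - ?Sh) *\<^sub>v u)"
    unfolding v(2) mult_S(2) minus_mult_distrib_mat_vec[OF S(1,2) u(1)]
    by (rule aux[OF Su nv \<open>?S *\<^sub>v u + u = - bar.normal_vec\<close>])
  also have "vnorm \<dots> \<le> vnorm (bar.normal_vec - hat.normal_vec) + vnorm ((?S - ?Sh) *\<^sub>v u)"
    unfolding vnorm_uminus using nv S u by (intro vnorm_triangle[of _ b]) (auto intro!: mult_mat_vec_carrier)
  also have "vnorm ((?S - ?Sh) *\<^sub>v u) \<le> ?F2 * (?h + ?F3)"
    using K2T_K2_diff u_le F2_nonneg
    by (intro order_trans[OF vnorm_mult_mat_vec_le[OF S(3) u(1)]] mult_mono) auto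
  finally have le: "vnorm (hat.normal_mat *\<^sub>v (u - v)) \<le> ?F3 + ?F2 * (?h + ?F3)"
    using normal_vec_diff by linarith
  have "vnorm (u - v) \<le> ?g * vnorm (hat.normal_mat *\<^sub>v (u - v))"
    using u v by (intro hat.vnorm_le_normal_inverse) auto
  also have "\<dots> \<le> ?g * (?F3 + ?F2 * (?h + ?F3))" using le by (intro mult_left_mono) auto
  also have "\<dots> = ?g * ?F3 + ?g * (?F2 * (?h + ?F3))" by (simp add: distrib_left)
  also have "\<dots> \<le> ?g * ?F3 + 1 * (?F2 * (?h + ?F3))"
    using hat.spectral_norm_normal_inverse_le F2_nonneg F3 by (intro add_left_mono mult_right_mono) auto
  finally show ?thesis by (simp add: F_bound_def mult_ac)
qed

subsection \<open>The suboptimality bound\<close>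

text \<open>The optimal inputs differ by at most \<^const>\<open>F_bound\<close>, and the pseudoinverse turns this into a
  difference of coefficients; \<^const>\<open>eta\<close> states it relative to the coefficients at the noisy optimum.\<close>

lemma vnorm_g_vec_optimal_le:
  assumes u: "u \<in> carrier_vec b" "bar.normal_mat *\<^sub>v u = - bar.normal_vec"
    and nz: "vnorm (g_vec dh (u_opt dh)) \<noteq> 0"
  shows "vnorm (g_vec dh u) \<le> eta l N \<delta> dh * vnorm (g_vec dh (u_opt dh))" "1 \<le> eta l N \<delta> dh"
proof -
  let ?P = "pinv (H_mat dh)" and ?v = "u_opt dh"
  have F: "vnorm (u - ?v) \<le> F_bound l N \<delta> dh" by (rule optimal_input_diff[OF u hat.u_opt])
  hence F0: "0 \<le> F_bound l N \<delta> dh" using vnorm_nonneg order_trans by blast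
  have b: "b_vec dh u \<in> carrier_vec (a + (l + b))" "b_vec dh ?v \<in> carrier_vec (a + (l + b))"
    using u hat.u_opt hat.b_vec_carrier by auto
  have "b_vec dh u - b_vec dh ?v = 0\<^sub>v a @\<^sub>v 0\<^sub>v l @\<^sub>v (u - ?v)"
    using u(1) hat.u_opt(1) hat.dims by (intro eq_vecI) (auto simp: b_vec_def)
  hence bd: "vnorm (b_vec dh u - b_vec dh ?v) = vnorm (u - ?v)" by simp
  have "g_vec dh u - g_vec dh ?v = ?P *\<^sub>v (b_vec dh u - b_vec dh ?v)"
    unfolding g_vec_def by (rule mult_minus_distrib_mat_vec[OF hat.pinv_H(1) b, symmetric])
  also have "vnorm \<dots> \<le> spectral_norm ?P * vnorm (u - ?v)"
    unfolding bd[symmetric] using b by (intro vnorm_mult_mat_vec_le[OF hat.pinv_H(1)]) auto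
  also have "\<dots> \<le> spectral_norm ?P * F_bound l N \<delta> dh" using F by (intro mult_left_mono) auto
  finally have "vnorm (g_vec dh u) \<le> vnorm (g_vec dh ?v) + spectral_norm ?P * F_bound l N \<delta> dh"
    using vnorm_triangle_sub[OF hat.g_vec_carrier[OF u(1)] hat.g_vec_carrier[OF hat.u_opt(1)]] by linarith
  also have "\<dots> = eta l N \<delta> dh * vnorm (g_vec dh ?v)" using nz by (simp add: eta_def field_simps)
  finally show "vnorm (g_vec dh u) \<le> eta l N \<delta> dh * vnorm (g_vec dh ?v)" .
  show "1 \<le> eta l N \<delta> dh" using F0 by (simp add: eta_def)
qed

text \<open>With \<open>v\<close> the noisy optimum and \<open>c\<close> the radius of the ball of feasible outputs, the true cost of the
  robust input is at most its worst-case cost, hence at most the worst-case cost of \<open>v\<close>. This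
  exceeds the noisy cost of \<open>v\<close>, and thus that of the true optimum, by at most \<open>2 c Y \<gamma> + c\<^sup>2\<close>.
  Passing from the noisy to the true cost at the true optimum costs another \<open>2 c Y \<gamma>\<close>. Here \<open>Y \<gamma>\<close>
  bounds the noisy predictions at both inputs.\<close>

theorem suboptimality:
  assumes sig: "sigma_min (H_mat dh) = e"
    and nz: "vnorm (g_vec dh (u_opt dh)) \<noteq> 0"
    and check: "is_arg_min (c_worst l N \<delta> dh) (\<lambda>v. v \<in> carrier_vec b) ucheck"
    and star: "is_arg_min (reg_cost d) (\<lambda>v. v \<in> carrier_vec b) ustar"
  shows "reg_cost d ucheck - reg_cost d ustar \<le> C3 l N \<delta> dh"
proof -
  let ?v = "u_opt dh"
  define Y where "Y = spectral_norm (Y_f dh)"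
  define \<gamma> where "\<gamma> = eta l N \<delta> dh * vnorm (g_vec dh ?v)"
  define c where "c = C2 l N \<delta> dh"
  note s = bar.minimal_imp_normal_equation[OF star]
  note v = hat.u_opt
  have ucheck: "ucheck \<in> carrier_vec b" using check by (simp add: is_arg_min_def)
  have gs: "vnorm (g_vec dh ustar) \<le> \<gamma>" and eta: "1 \<le> eta l N \<delta> dh"
    using vnorm_g_vec_optimal_le[OF s nz] by (auto simp: \<gamma>_def)
  have gv: "vnorm (g_vec dh ?v) \<le> \<gamma>"
    using eta mult_right_mono[of 1 "eta l N \<delta> dh" "vnorm (g_vec dh ?v)"] by (simp add: \<gamma>_def)
  have "0 \<le> \<gamma>" using gv vnorm_nonneg order_trans by blast
  have c_eq: "c = (Y + N * \<delta>) * (2 / e * (sqrt l + N * \<gamma>) * \<delta>) + N * \<gamma> * \<delta>"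
    by (simp add: c_def C2_def C1_def \<gamma>_def Y_def sig divide_inverse mult_ac)
  have "0 \<le> c" unfolding c_eq using \<open>0 \<le> \<gamma>\<close> hat.e noise by (simp add: Y_def)
  have yv: "vnorm (y_pred dh ?v) \<le> Y * \<gamma>"
    unfolding y_pred_def Y_def using gv
    by (intro order_trans[OF vnorm_mult_mat_vec_le[OF hat.dims(4) hat.g_vec_carrier[OF v(1)]]] mult_left_mono) auto
  have "c_worst l N \<delta> dh ?v \<le> (vnorm (y_pred dh ?v) + c)\<^sup>2 + (vnorm ?v)\<^sup>2"
    unfolding c_worst_def
  proof (rule cSup_least)
    show "{(vnorm yf)\<^sup>2 + (vnorm ?v)\<^sup>2 | DYp DYf Dyp g yf. worst_feasible l N \<delta> dh ?v DYp DYf Dyp g yf} \<noteq> {}"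
      using worst_feasible_witness[OF v(1) sig] by blast
    fix k assume "k \<in> {(vnorm yf)\<^sup>2 + (vnorm ?v)\<^sup>2 | DYp DYf Dyp g yf. worst_feasible l N \<delta> dh ?v DYp DYf Dyp g yf}"
    then obtain DYp DYf Dyp g yf where k: "k = (vnorm yf)\<^sup>2 + (vnorm ?v)\<^sup>2"
      and feas: "worst_feasible l N \<delta> dh ?v DYp DYf Dyp g yf" by blast
    have "yf \<in> carrier_vec f" using feas hat.dims by (auto simp: worst_feasible_def)
    hence "vnorm yf \<le> vnorm (y_pred dh ?v) + vnorm (yf - y_pred dh ?v)"
      using hat.y_pred_carrier[OF v(1)] by (rule vnorm_triangle_sub)
    hence "vnorm yf \<le> vnorm (y_pred dh ?v) + c"
      using worst_feasible_bound[OF v(1) sig feas gv] by (simp add: c_eq Y_def)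
    thus "k \<le> (vnorm (y_pred dh ?v) + c)\<^sup>2 + (vnorm ?v)\<^sup>2" by (simp add: k power_mono)
  qed
  also have "\<dots> = reg_cost dh ?v + 2 * c * vnorm (y_pred dh ?v) + c\<^sup>2"
    by (simp add: reg_cost_def power2_sum mult_ac)
  also have "\<dots> \<le> reg_cost dh ?v + 2 * c * (Y * \<gamma>) + c\<^sup>2"
    using yv \<open>0 \<le> c\<close> by (simp add: mult_left_mono)
  finally have worst: "c_worst l N \<delta> dh ?v \<le> reg_cost dh ?v + 2 * c * (Y * \<gamma>) + c\<^sup>2" .
  have ys: "vnorm (y_pred dh ustar) \<le> Y * \<gamma>"
    unfolding y_pred_def Y_def using gs
    by (intro order_trans[OF vnorm_mult_mat_vec_le[OF hat.dims(4) hat.g_vec_carrier[OF s(1)]]] mult_left_mono) auto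
  have yd: "vnorm (y_pred dh ustar) \<le> vnorm (y_pred d ustar) + c"
    using worst_feasible_bound[OF s(1) sig worst_feasible_witness[OF s(1) sig] gs]
      vnorm_triangle_sub[OF hat.y_pred_carrier bar.y_pred_carrier, OF s(1) s(1)]
      vnorm_minus_commute[OF hat.y_pred_carrier bar.y_pred_carrier, OF s(1) s(1)]
    by (simp add: c_eq Y_def)
  have "(vnorm (y_pred dh ustar))\<^sup>2 \<le> (vnorm (y_pred d ustar))\<^sup>2 + 2 * c * (Y * \<gamma>)"
  proof (cases "vnorm (y_pred dh ustar) \<le> vnorm (y_pred d ustar)")
    case True
    hence "(vnorm (y_pred dh ustar))\<^sup>2 \<le> (vnorm (y_pred d ustar))\<^sup>2" by (intro power_mono) auto
    moreover have "0 \<le> 2 * c * (Y * \<gamma>)" using \<open>0 \<le> c\<close> \<open>0 \<le> \<gamma>\<close> by (simp add: Y_def)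
    ultimately show ?thesis by linarith
  next
    case False
    let ?p = "vnorm (y_pred dh ustar)" and ?q = "vnorm (y_pred d ustar)"
    have "?p\<^sup>2 - ?q\<^sup>2 = (?p - ?q) * (?p + ?q)" by (simp add: power2_eq_square algebra_simps)
    also have "\<dots> \<le> c * (2 * (Y * \<gamma>))"
      using False yd ys \<open>0 \<le> c\<close> by (intro mult_mono) (auto intro: add_nonneg_nonneg)
    finally show ?thesis by simp
  qed
  hence cost_s: "reg_cost dh ustar \<le> reg_cost d ustar + 2 * c * (Y * \<gamma>)"
    by (simp add: reg_cost_def)
  have "reg_cost d ucheck \<le> c_worst l N \<delta> dh ucheck" by (rule reg_cost_le_c_worst[OF ucheck sig])
  also have "\<dots> \<le> c_worst l N \<delta> dh ?v" using check v(1) by (simp add: is_arg_min_linorder)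
  also note worst
  also have "reg_cost dh ?v \<le> reg_cost dh ustar"
    using hat.u_opt_minimal s(1) by (simp add: is_arg_min_linorder)
  also note cost_s
  finally have "reg_cost d ucheck - reg_cost d ustar \<le> c\<^sup>2 + 4 * c * (Y * \<gamma>)" by (simp add: algebra_simps)
  also have "\<dots> \<le> C3 l N \<delta> dh"
    by (simp add: C3_def c_def[symmetric] Y_def[symmetric] \<gamma>_def mult_ac)
  finally show ?thesis .
qed

end

section \<open>Trajectories seen through the adjoint system\<close>

text \<open>A linear functional of the state at a later time is pulled back to the initial state by the
  transposed dynamics. Working with functionals keeps the contributions of the inputs explicit, one
  vector per time, without block Toeplitz matrices.\<close>

definition adjoint_orbit :: "real mat \<Rightarrow> real vec \<Rightarrow> nat \<Rightarrow> real vec" where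
  "adjoint_orbit A \<xi> k = ((\<lambda>v. A\<^sup>T *\<^sub>v v) ^^ k) \<xi>"

lemma adjoint_orbit_0 [simp]: "adjoint_orbit A \<xi> 0 = \<xi>"
  by (simp add: adjoint_orbit_def)

lemma adjoint_orbit_Suc: "adjoint_orbit A \<xi> (Suc k) = A\<^sup>T *\<^sub>v adjoint_orbit A \<xi> k"
  by (simp add: adjoint_orbit_def)

lemma adjoint_orbit_step: "adjoint_orbit A (A\<^sup>T *\<^sub>v \<xi>) k = adjoint_orbit A \<xi> (Suc k)"
  by (simp only: adjoint_orbit_def funpow_Suc_right comp_apply)

lemma adjoint_orbit_carrier:
  assumes "A \<in> carrier_mat n n" "\<xi> \<in> carrier_vec n"
  shows "adjoint_orbit A \<xi> k \<in> carrier_vec n"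
proof (induction k)
  case (Suc k)
  thus ?case using assms mult_mat_vec_carrier[of "A\<^sup>T" n n] by (simp add: adjoint_orbit_Suc)
qed (use assms in simp)

lemma adjoint_orbit_pow:
  assumes "A \<in> carrier_mat n n" "\<xi> \<in> carrier_vec n"
  shows "adjoint_orbit A \<xi> k = (A ^\<^sub>m k)\<^sup>T *\<^sub>v \<xi>"
proof (induction k)
  case 0
  show ?case using assms by simp
next
  case (Suc k)
  have P: "A ^\<^sub>m k \<in> carrier_mat n n" using assms by simp
  have "(A ^\<^sub>m Suc k)\<^sup>T = A\<^sup>T * (A ^\<^sub>m k)\<^sup>T" using transpose_mult[OF P assms(1)] by simp
  hence "(A ^\<^sub>m Suc k)\<^sup>T *\<^sub>v \<xi> = A\<^sup>T *\<^sub>v ((A ^\<^sub>m k)\<^sup>T *\<^sub>v \<xi>)"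
    using assms P by (simp add: assoc_mult_mat_vec[of _ n n _ n])
  thus ?case by (simp add: adjoint_orbit_Suc Suc.IH)
qed

lemma scalar_prod_trajectory:
  assumes A: "A \<in> carrier_mat n n" and B: "B \<in> carrier_mat n m" and "\<xi> \<in> carrier_vec n"
    and "\<And>s. s < i \<Longrightarrow> x (t + s) \<in> carrier_vec n \<and> u (t + s) \<in> carrier_vec m \<and>
      x (Suc (t + s)) = A *\<^sub>v x (t + s) + B *\<^sub>v u (t + s)"
  shows "\<xi> \<bullet> x (t + i) = adjoint_orbit A \<xi> i \<bullet> x t
    + (\<Sum>s<i. (B\<^sup>T *\<^sub>v adjoint_orbit A \<xi> (i - 1 - s)) \<bullet> u (t + s))"
  using assms(3,4)
proof (induction i arbitrary: \<xi>)
  case (Suc i)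
  have xu: "x (t + i) \<in> carrier_vec n" "u (t + i) \<in> carrier_vec m"
    "x (t + Suc i) = A *\<^sub>v x (t + i) + B *\<^sub>v u (t + i)"
    using Suc.prems(2)[of i] by auto
  have "\<xi> \<bullet> x (t + Suc i) = \<xi> \<bullet> (A *\<^sub>v x (t + i)) + \<xi> \<bullet> (B *\<^sub>v u (t + i))"
    unfolding xu(3) using A B xu Suc.prems(1)
    by (intro scalar_prod_add_distrib[of _ n]) (auto intro: mult_mat_vec_carrier)
  also have "\<xi> \<bullet> (A *\<^sub>v x (t + i)) = (A\<^sup>T *\<^sub>v \<xi>) \<bullet> x (t + i)"
    by (rule transpose_vec_mult_scalar[OF A xu(1) Suc.prems(1), symmetric])
  also have "\<dots> = adjoint_orbit A (A\<^sup>T *\<^sub>v \<xi>) i \<bullet> x t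
    + (\<Sum>s<i. (B\<^sup>T *\<^sub>v adjoint_orbit A (A\<^sup>T *\<^sub>v \<xi>) (i - 1 - s)) \<bullet> u (t + s))"
  proof (rule Suc.IH)
    show "A\<^sup>T *\<^sub>v \<xi> \<in> carrier_vec n" using A Suc.prems(1) mult_mat_vec_carrier[of "A\<^sup>T" n n] by simp
  qed (use Suc.prems(2) in auto)
  also have "\<xi> \<bullet> (B *\<^sub>v u (t + i)) = (B\<^sup>T *\<^sub>v \<xi>) \<bullet> u (t + i)"
    by (rule transpose_vec_mult_scalar[OF B xu(2) Suc.prems(1), symmetric])
  also have "(\<Sum>s<i. (B\<^sup>T *\<^sub>v adjoint_orbit A (A\<^sup>T *\<^sub>v \<xi>) (i - 1 - s)) \<bullet> u (t + s))
    = (\<Sum>s<i. (B\<^sup>T *\<^sub>v adjoint_orbit A \<xi> (Suc i - 1 - s)) \<bullet> u (t + s))"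
    by (intro sum.cong) (auto simp: adjoint_orbit_step Suc_diff_Suc)
  finally show ?case by (simp add: adjoint_orbit_step)
qed simp

lemma controllable_adjoint:
  assumes A: "A \<in> carrier_mat n n" and B: "B \<in> carrier_mat n m" and \<xi>: "\<xi> \<in> carrier_vec n"
    and "controllable A B" and 0: "\<And>k. k < n \<Longrightarrow> B\<^sup>T *\<^sub>v adjoint_orbit A \<xi> k = 0\<^sub>v m"
  shows "\<xi> = 0\<^sub>v n"
proof (rule full_row_rank_left_kernel)
  let ?R = "ctrb_mat A B n"
  show R: "?R \<in> carrier_mat n (m * n)" using A B by (simp add: ctrb_mat_def)
  show "full_row_rank ?R" using assms by (simp add: controllable_def)
  show "?R\<^sup>T *\<^sub>v \<xi> = 0\<^sub>v (m * n)"
  proof (intro eq_vecI)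
    fix j assume "j < dim_vec (0\<^sub>v (m * n) :: real vec)"
    hence j: "j < m * n" by simp
    hence "0 < m" by (cases m) auto
    define k e where "k = j div m" and "e = j mod m"
    have k: "k < n" using j by (simp add: k_def less_mult_imp_div_less mult.commute)
    have e: "e < m" using \<open>0 < m\<close> by (simp add: e_def)
    have P: "A ^\<^sub>m k \<in> carrier_mat n n" using A by simp
    have "col ?R j = col (A ^\<^sub>m k * B) e"
      using R P A B j e by (intro eq_vecI) (auto simp: ctrb_mat_def k_def e_def)
    hence "(?R\<^sup>T *\<^sub>v \<xi>) $ j = ((A ^\<^sub>m k * B)\<^sup>T *\<^sub>v \<xi>) $ e" using R P B j e by simp
    also have "(A ^\<^sub>m k * B)\<^sup>T *\<^sub>v \<xi> = B\<^sup>T *\<^sub>v adjoint_orbit A \<xi> k"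
      unfolding adjoint_orbit_pow[OF A \<xi>] transpose_mult[OF P B]
      using P B \<xi> by (intro assoc_mult_mat_vec[of _ m n _ n]) auto
    finally show "(?R\<^sup>T *\<^sub>v \<xi>) $ j = 0\<^sub>v (m * n) $ j" using 0[OF k] e j by simp
  qed (use R in simp)
qed (rule \<xi>)

section \<open>Page matrices\<close>

lemma page_mat_carrier: "0 < L \<Longrightarrow> page_mat q L a b v \<in> carrier_mat (q * L) ((b + 1 - a) div L)"
  by (auto simp: page_mat_def)

lemma page_mat_index:
  assumes "0 < L" "i < q * L" "j < (b + 1 - a) div L"
  shows "page_mat q L a b v $$ (i, j) = v (a + j * L + i div q) $ (i mod q)"
  using assms by (simp add: page_mat_def mat_of_cols_index col_seq_def)

lemma sum_mult_group:
  assumes "0 < (m :: nat)"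
  shows "(\<Sum>i<m * K. f (i div m) (i mod m)) = (\<Sum>\<tau><K. \<Sum>e<m. f \<tau> e :: real)"
proof -
  have "(\<Sum>i<m * K. f (i div m) (i mod m)) = (\<Sum>\<tau><K. \<Sum>i=\<tau> * m..<\<tau> * m + m. f (i div m) (i mod m))"
    by (simp add: sum.nat_group mult.commute)
  also have "\<dots> = (\<Sum>\<tau><K. \<Sum>e<m. f \<tau> e)"
  proof (rule sum.cong[OF refl])
    fix \<tau>
    have "(\<Sum>i=\<tau> * m..<\<tau> * m + m. f (i div m) (i mod m)) = (\<Sum>e=0..<m. f ((e + \<tau> * m) div m) ((e + \<tau> * m) mod m))"
      using sum.shift_bounds_nat_ivl[of "\<lambda>i. f (i div m) (i mod m)" 0 "\<tau> * m" m] by (simp add: add.commute)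
    also have "\<dots> = (\<Sum>e<m. f \<tau> e)" using assms by (intro sum.cong) auto
    finally show "(\<Sum>i=\<tau> * m..<\<tau> * m + m. f (i div m) (i mod m)) = (\<Sum>e<m. f \<tau> e)" .
  qed
  finally show ?thesis .
qed

text \<open>Column \<open>j\<close> of the stacked Page matrices lists the inputs during the pages \<open>j\<close> to \<open>j + k\<close> in their
  temporal order, so that a left kernel vector amounts to one coefficient vector \<open>c \<tau>\<close> per time.\<close>

lemma page_exciting_left_kernel:
  assumes exc: "page_exciting m L (Suc k) T u" and pos: "0 < L" "0 < m"
    and u: "\<And>t. t \<in> {1..T} \<Longrightarrow> u t \<in> carrier_vec m"
    and c: "\<And>\<tau>. \<tau> < L * Suc k \<Longrightarrow> c \<tau> \<in> carrier_vec m"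
    and 0: "\<And>j. (j + Suc k) * L \<le> T \<Longrightarrow> (\<Sum>\<tau><L * Suc k. c \<tau> \<bullet> u (j * L + 1 + \<tau>)) = 0"
    and \<tau>: "\<tau> < L * Suc k"
  shows "c \<tau> = 0\<^sub>v m"
proof -
  define N' where "N' = (T - k * L) div L"
  define M where "M = vstack (m * L) N' (Suc k) (\<lambda>i. page_mat m L (i * L + 1) (T - (Suc k - 1 - i) * L) u)"
  have M: "M \<in> carrier_mat (m * L * Suc k) N'" by (simp add: M_def vstack_def)
  have rank: "full_row_rank M" using exc by (simp add: page_exciting_def M_def N'_def)
  have jT: "(j + Suc k) * L \<le> T" if "j < N'" for j
  proof -
    have "Suc j * L \<le> T - k * L"
      using that pos by (simp add: N'_def less_eq_div_iff_mult_less_eq Suc_le_eq[symmetric])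
    moreover have "0 < Suc j * L" using pos by simp
    ultimately have "Suc j * L + k * L \<le> T" by linarith
    thus ?thesis by (simp add: algebra_simps)
  qed
  have entry: "M $$ (i, j) = u (j * L + 1 + i div m) $ (i mod m)" if i: "i < m * L * Suc k" and j: "j < N'" for i j
  proof -
    define q where "q = i div (m * L)"
    have q: "q \<le> k" using i by (simp add: q_def less_mult_imp_div_less less_Suc_eq_le[symmetric] mult.commute)
    have cols: "(T - (k - q) * L + 1 - (q * L + 1)) div L = N'"
      using q by (simp add: N'_def diff_mult_distrib)
    have "0 < m * L" using pos by simp
    hence "i mod (m * L) < m * L" by simp
    hence "M $$ (i, j) = u (q * L + 1 + j * L + i mod (m * L) div m) $ (i mod (m * L) mod m)"
      using page_mat_index[OF pos(1), of "i mod (m * L)" m j "T - (k - q) * L" "q * L + 1" u] i j cols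
      by (simp add: M_def vstack_def q_def)
    also have "i mod (m * L) mod m = i mod m" by (simp add: mod_mult2_eq)
    also have "q * L + 1 + j * L + i mod (m * L) div m = j * L + 1 + i div m"
    proof -
      have "i mod (m * L) div m = i div m mod L" using pos by (simp add: mod_mult2_eq)
      moreover have "q = i div m div L" by (simp add: q_def div_mult2_eq)
      ultimately have "q * L + i mod (m * L) div m = i div m" by (simp add: div_mult_mod_eq)
      thus ?thesis by simp
    qed
    finally show ?thesis .
  qed
  define v where "v = vec (m * L * Suc k) (\<lambda>i. c (i div m) $ (i mod m))"
  have v: "v \<in> carrier_vec (m * L * Suc k)" by (simp add: v_def)
  have "M\<^sup>T *\<^sub>v v = 0\<^sub>v N'"
  proof (intro eq_vecI)
    fix j assume "j < dim_vec (0\<^sub>v N' :: real vec)"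
    hence j: "j < N'" by simp
    have "(M\<^sup>T *\<^sub>v v) $ j = (\<Sum>i<m * (L * Suc k). u (j * L + 1 + i div m) $ (i mod m) * (c (i div m) $ (i mod m)))"
      using M j by (simp add: scalar_prod_def atLeast0LessThan v_def entry mult.assoc del: mult_Suc_right)
    also have "\<dots> = (\<Sum>\<tau><L * Suc k. \<Sum>e<m. u (j * L + 1 + \<tau>) $ e * (c \<tau> $ e))"
      by (rule sum_mult_group[OF pos(2)])
    also have "\<dots> = (\<Sum>\<tau><L * Suc k. c \<tau> \<bullet> u (j * L + 1 + \<tau>))"
    proof (rule sum.cong[OF refl])
      fix \<tau> assume "\<tau> \<in> {..<L * Suc k}"
      hence "j * L + 1 + \<tau> \<le> j * L + L * Suc k" by simp
      also have "\<dots> \<le> T" using jT[OF j] by (simp add: algebra_simps)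
      finally have "u (j * L + 1 + \<tau>) \<in> carrier_vec m" by (intro u) simp
      thus "(\<Sum>e<m. u (j * L + 1 + \<tau>) $ e * (c \<tau> $ e)) = c \<tau> \<bullet> u (j * L + 1 + \<tau>)"
        by (simp add: scalar_prod_def atLeast0LessThan mult.commute)
    qed
    finally show "(M\<^sup>T *\<^sub>v v) $ j = 0\<^sub>v N' $ j" using 0[OF jT[OF j]] j by simp
  qed (use M in simp)
  hence v0: "v = 0\<^sub>v (m * L * Suc k)" using full_row_rank_left_kernel[OF M rank v] by simp
  show ?thesis
  proof (intro eq_vecI)
    fix e assume "e < dim_vec (0\<^sub>v m :: real vec)"
    hence e: "e < m" by simp
    have "\<tau> * m + e < Suc \<tau> * m" using e by simp
    also have "\<dots> \<le> (L * Suc k) * m" using \<tau> by (intro mult_right_mono) auto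
    also have "\<dots> = m * L * Suc k" by (simp only: mult_ac)
    finally have lt: "\<tau> * m + e < m * L * Suc k" .
    have "c \<tau> $ e = v $ (\<tau> * m + e)" using lt e by (simp add: v_def)
    also have "\<dots> = 0" using lt by (simp add: v0)
    finally show "c \<tau> $ e = 0\<^sub>v m $ e" using e by simp
  qed (use c[OF \<tau>] in simp)
qed

text \<open>The Page matrix version of Willems' fundamental lemma: states at the beginning of the pages and
  inputs during the pages satisfy no linear relation. A relation also holds for the states \<open>k\<close> pages
  later, which the dynamics expresses by the initial state and the inputs in between. As \<open>n + 1\<close>
  functionals on the state space are dependent, the initial state can be eliminated, which leaves a
  relation among the inputs of \<open>n + 1\<close> pages. All its coefficients vanish by excitation; those of the
  last two pages involved yield the claim, as \<open>n\<close> inputs already reach every state.\<close>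

lemma fundamental_lemma:
  assumes A: "A \<in> carrier_mat n n" and B: "B \<in> carrier_mat n m" and ctrb: "controllable A B"
    and pos: "0 < m" "n < L"
    and traj: "\<And>t. t \<in> {1..T} \<Longrightarrow> x t \<in> carrier_vec n \<and> u t \<in> carrier_vec m \<and> x (Suc t) = A *\<^sub>v x t + B *\<^sub>v u t"
    and exc: "page_exciting m L (Suc n) T u"
    and \<xi>: "\<xi> \<in> carrier_vec n" and \<zeta>: "\<And>i. i < L \<Longrightarrow> \<zeta> i \<in> carrier_vec m"
    and rel: "\<And>j. Suc j * L \<le> T \<Longrightarrow> \<xi> \<bullet> x (j * L + 1) + (\<Sum>i<L. \<zeta> i \<bullet> u (j * L + 1 + i)) = 0"
  shows "\<xi> = 0\<^sub>v n \<and> (\<forall>i<L. \<zeta> i = 0\<^sub>v m)"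
proof -
  have L: "0 < L" using pos by simp
  define \<theta> where "\<theta> = adjoint_orbit A \<xi>"
  define \<beta> where "\<beta> k = B\<^sup>T *\<^sub>v \<theta> k" for k
  have \<theta>: "\<theta> k \<in> carrier_vec n" for k unfolding \<theta>_def by (rule adjoint_orbit_carrier[OF A \<xi>])
  have \<beta>: "\<beta> k \<in> carrier_vec m" for k
    unfolding \<beta>_def using B \<theta> mult_mat_vec_carrier[of "B\<^sup>T" m n] by simp
  define W where "W = mat n (Suc n) (\<lambda>(k, s). \<theta> (s * L) $ k)"
  have "W \<in> carrier_mat n (Suc n)" by (simp add: W_def)
  then obtain \<alpha>v where \<alpha>v: "\<alpha>v \<in> carrier_vec (Suc n)" "\<alpha>v \<noteq> 0\<^sub>v (Suc n)" "W *\<^sub>v \<alpha>v = 0\<^sub>v n"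
    using wide_mat_kernel[of W n "Suc n"] by auto
  define \<alpha> where "\<alpha> s = \<alpha>v $ s" for s
  have \<alpha>0: "(\<Sum>s<Suc n. \<alpha> s * \<theta> (s * L) $ k) = 0" if "k < n" for k
    using arg_cong[OF \<alpha>v(3), of "\<lambda>v. v $ k"] that \<alpha>v(1)
    by (simp add: W_def scalar_prod_def atLeast0LessThan \<alpha>_def mult.commute)
  have "\<exists>s<Suc n. \<alpha> s \<noteq> 0" using \<alpha>v(1,2) unfolding \<alpha>_def by (metis carrier_vecD eq_vecI index_zero_vec)
  then obtain s0 where s0: "s0 < Suc n" "\<alpha> s0 \<noteq> 0" by blast
  define S where "S = Max {s. s < Suc n \<and> \<alpha> s \<noteq> 0}"
  have fin: "finite {s. s < Suc n \<and> \<alpha> s \<noteq> 0}" by simp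
  have "S \<in> {s. s < Suc n \<and> \<alpha> s \<noteq> 0}"
    unfolding S_def by (rule Max_in[OF fin]) (use s0 in blast)
  hence S: "S < Suc n" "\<alpha> S \<noteq> 0" by auto
  have S_max: "\<alpha> s = 0" if "S < s" "s < Suc n" for s
  proof (rule ccontr)
    assume "\<alpha> s \<noteq> 0"
    hence "s \<le> S" unfolding S_def using that by (intro Max_ge[OF fin]) simp
    thus False using that by simp
  qed
  \<comment> \<open>The coefficients of the inputs after the elimination of the state\<close>
  define coef where "coef \<tau> = vec m (\<lambda>e. \<alpha> (\<tau> div L) * \<zeta> (\<tau> mod L) $ e +
    (\<Sum>s<Suc n. if \<tau> < s * L then \<alpha> s * \<beta> (s * L - 1 - \<tau>) $ e else 0))" for \<tau>
  have coef_prod: "coef \<tau> \<bullet> w = \<alpha> (\<tau> div L) * (\<zeta> (\<tau> mod L) \<bullet> w) +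
      (\<Sum>s<Suc n. if \<tau> < s * L then \<alpha> s * (\<beta> (s * L - 1 - \<tau>) \<bullet> w) else 0)" if w: "w \<in> carrier_vec m" for \<tau> w
  proof -
    have "coef \<tau> \<bullet> w = (\<Sum>e<m. \<alpha> (\<tau> div L) * (\<zeta> (\<tau> mod L) $ e * w $ e)) +
      (\<Sum>e<m. \<Sum>s<Suc n. if \<tau> < s * L then \<alpha> s * (\<beta> (s * L - 1 - \<tau>) $ e * w $ e) else 0)"
      unfolding sum.distrib[symmetric] using w
      by (simp add: scalar_prod_def coef_def atLeast0LessThan distrib_right sum_distrib_right mult.assoc
        if_distrib[of "\<lambda>x. x * _"] cong: if_cong del: sum.lessThan_Suc)
    also have "(\<Sum>e<m. \<Sum>s<Suc n. if \<tau> < s * L then \<alpha> s * (\<beta> (s * L - 1 - \<tau>) $ e * w $ e) else 0)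
      = (\<Sum>s<Suc n. if \<tau> < s * L then \<alpha> s * (\<beta> (s * L - 1 - \<tau>) \<bullet> w) else 0)"
      using w by (subst sum.swap, intro sum.cong)
        (auto simp: scalar_prod_def atLeast0LessThan sum_distrib_left)
    finally show ?thesis using w by (simp add: scalar_prod_def atLeast0LessThan sum_distrib_left del: sum.lessThan_Suc)
  qed
  have coef0: "coef \<tau> = 0\<^sub>v m" if "\<tau> < L * Suc n" for \<tau>
  proof (rule page_exciting_left_kernel[OF exc L pos(1) _ _ _ that])
    fix j assume j: "(j + Suc n) * L \<le> T"
    let ?u = "\<lambda>\<tau>. u (j * L + 1 + \<tau>)"
    have tr: "x (j * L + 1 + \<tau>) \<in> carrier_vec n \<and> ?u \<tau> \<in> carrier_vec m \<and>
        x (Suc (j * L + 1 + \<tau>)) = A *\<^sub>v x (j * L + 1 + \<tau>) + B *\<^sub>v ?u \<tau>" if "\<tau> < L * Suc n" for \<tau>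
    proof (rule traj)
      have "j * L + 1 + \<tau> \<le> j * L + L * Suc n" using that by simp
      also have "\<dots> \<le> T" using j by (simp add: algebra_simps)
      finally show "j * L + 1 + \<tau> \<in> {1..T}" by simp
    qed
    have x0: "x (j * L + 1) \<in> carrier_vec n" using tr[of 0] L by simp
    have sL: "s * L + L \<le> L * Suc n" if "s < Suc n" for s
    proof -
      have "Suc s * L \<le> Suc n * L" using that by (intro mult_right_mono) auto
      thus ?thesis by (simp add: algebra_simps)
    qed
    have "(\<Sum>\<tau><L * Suc n. coef \<tau> \<bullet> ?u \<tau>)
      = (\<Sum>\<tau><L * Suc n. \<alpha> (\<tau> div L) * (\<zeta> (\<tau> mod L) \<bullet> ?u \<tau>)) +
        (\<Sum>\<tau><L * Suc n. \<Sum>s<Suc n. if \<tau> < s * L then \<alpha> s * (\<beta> (s * L - 1 - \<tau>) \<bullet> ?u \<tau>) else 0)"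
      unfolding sum.distrib[symmetric]
    proof (rule sum.cong[OF refl], rule coef_prod)
      fix \<tau> assume "\<tau> \<in> {..<L * Suc n}"
      thus "?u \<tau> \<in> carrier_vec m" using tr[of \<tau>] by blast
    qed
    also have "(\<Sum>\<tau><L * Suc n. \<alpha> (\<tau> div L) * (\<zeta> (\<tau> mod L) \<bullet> ?u \<tau>))
      = (\<Sum>\<tau><L * Suc n. \<alpha> (\<tau> div L) * (\<zeta> (\<tau> mod L) \<bullet> ?u (\<tau> div L * L + \<tau> mod L)))"
      by simp
    also have "\<dots> = (\<Sum>s<Suc n. \<Sum>i<L. \<alpha> s * (\<zeta> i \<bullet> ?u (s * L + i)))"
      by (rule sum_mult_group[OF L])
    also have "(\<Sum>\<tau><L * Suc n. \<Sum>s<Suc n. if \<tau> < s * L then \<alpha> s * (\<beta> (s * L - 1 - \<tau>) \<bullet> ?u \<tau>) else 0)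
      = (\<Sum>s<Suc n. \<alpha> s * (\<Sum>\<tau><s * L. \<beta> (s * L - 1 - \<tau>) \<bullet> ?u \<tau>))"
    proof (subst sum.swap, rule sum.cong[OF refl])
      fix s assume "s \<in> {..<Suc n}"
      hence "s * L \<le> L * Suc n" using add_leD1[OF sL] by blast
      hence "{..<L * Suc n} \<inter> {\<tau>. \<tau> < s * L} = {..<s * L}" by (auto intro: less_le_trans)
      thus "(\<Sum>\<tau><L * Suc n. if \<tau> < s * L then \<alpha> s * (\<beta> (s * L - 1 - \<tau>) \<bullet> ?u \<tau>) else 0)
        = \<alpha> s * (\<Sum>\<tau><s * L. \<beta> (s * L - 1 - \<tau>) \<bullet> ?u \<tau>)"
        by (simp add: sum.If_cases sum_distrib_left)
    qed
    also have "(\<Sum>s<Suc n. \<Sum>i<L. \<alpha> s * (\<zeta> i \<bullet> ?u (s * L + i))) +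
        (\<Sum>s<Suc n. \<alpha> s * (\<Sum>\<tau><s * L. \<beta> (s * L - 1 - \<tau>) \<bullet> ?u \<tau>))
      = (\<Sum>s<Suc n. - (\<alpha> s * (\<theta> (s * L) \<bullet> x (j * L + 1))))"
      unfolding sum.distrib[symmetric]
    proof (rule sum.cong[OF refl])
      fix s assume "s \<in> {..<Suc n}"
      hence s: "s < Suc n" by simp
      have "\<xi> \<bullet> x (j * L + 1 + s * L) = \<theta> (s * L) \<bullet> x (j * L + 1) + (\<Sum>\<tau><s * L. \<beta> (s * L - 1 - \<tau>) \<bullet> ?u \<tau>)"
        unfolding \<theta>_def \<beta>_def
        by (rule scalar_prod_trajectory[OF A B \<xi>], rule tr, erule less_le_trans, rule add_leD1[OF sL[OF s]])
      moreover have "\<xi> \<bullet> x ((j + s) * L + 1) + (\<Sum>i<L. \<zeta> i \<bullet> u ((j + s) * L + 1 + i)) = 0"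
      proof (rule rel)
        have "Suc (j + s) * L \<le> (j + Suc n) * L" using s by (intro mult_right_mono) auto
        thus "Suc (j + s) * L \<le> T" using j by (rule le_trans)
      qed
      ultimately have "\<theta> (s * L) \<bullet> x (j * L + 1) + (\<Sum>\<tau><s * L. \<beta> (s * L - 1 - \<tau>) \<bullet> ?u \<tau>)
          + (\<Sum>i<L. \<zeta> i \<bullet> ?u (s * L + i)) = 0"
        by (simp add: add_mult_distrib add_ac)
      hence "\<alpha> s * (\<theta> (s * L) \<bullet> x (j * L + 1) + (\<Sum>\<tau><s * L. \<beta> (s * L - 1 - \<tau>) \<bullet> ?u \<tau>)
          + (\<Sum>i<L. \<zeta> i \<bullet> ?u (s * L + i))) = 0" by simp
      thus "(\<Sum>i<L. \<alpha> s * (\<zeta> i \<bullet> ?u (s * L + i))) + \<alpha> s * (\<Sum>\<tau><s * L. \<beta> (s * L - 1 - \<tau>) \<bullet> ?u \<tau>)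
        = - (\<alpha> s * (\<theta> (s * L) \<bullet> x (j * L + 1)))"
        by (simp only: sum_distrib_left[symmetric] distrib_left)
    qed
    also have "\<dots> = - (\<Sum>k<n. (\<Sum>s<Suc n. \<alpha> s * \<theta> (s * L) $ k) * x (j * L + 1) $ k)"
      unfolding sum_negf using x0
      by (subst sum_distrib_right, subst sum.swap)
        (simp add: scalar_prod_def atLeast0LessThan sum_distrib_left mult_ac del: sum.lessThan_Suc)
    also have "\<dots> = 0" using \<alpha>0 by (simp del: sum.lessThan_Suc)
    finally show "(\<Sum>\<tau><L * Suc n. coef \<tau> \<bullet> ?u \<tau>) = 0" .
  qed (use traj in \<open>auto simp: coef_def\<close>)
  have coef_index: "\<alpha> (\<tau> div L) * \<zeta> (\<tau> mod L) $ e +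
      (\<Sum>s<Suc n. if \<tau> < s * L then \<alpha> s * \<beta> (s * L - 1 - \<tau>) $ e else 0) = 0"
    if "\<tau> < L * Suc n" "e < m" for \<tau> e
    using arg_cong[OF coef0[OF that(1)], of "\<lambda>v. v $ e"] that(2) by (simp add: coef_def del: sum.lessThan_Suc)
  have SL: "S * L + L \<le> L * Suc n"
  proof -
    have "Suc S * L \<le> Suc n * L" using S by (intro mult_right_mono) auto
    thus ?thesis by (simp add: algebra_simps)
  qed
  \<comment> \<open>The last page involved carries the coefficients \<open>\<zeta>\<close> alone, \<dots>\<close>
  have \<zeta>0: "\<zeta> i = 0\<^sub>v m" if i: "i < L" for i
  proof (intro eq_vecI)
    fix e assume "e < dim_vec (0\<^sub>v m :: real vec)"
    hence e: "e < m" by simp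
    have "(\<Sum>s<Suc n. if S * L + i < s * L then \<alpha> s * \<beta> (s * L - 1 - (S * L + i)) $ e else 0) = 0"
    proof (intro sum.neutral ballI)
      fix s assume "s \<in> {..<Suc n}"
      moreover have "S < s" if "S * L + i < s * L"
        using that by (metis add_lessD1 mult_less_cancel2)
      ultimately show "(if S * L + i < s * L then \<alpha> s * \<beta> (s * L - 1 - (S * L + i)) $ e else 0) = 0"
        using S_max by auto
    qed
    moreover have "(S * L + i) div L = S" "(S * L + i) mod L = i" using i by auto
    moreover have "S * L + i < L * Suc n" using i SL by linarith
    ultimately have "\<alpha> S * \<zeta> i $ e = 0"
      using coef_index[of "S * L + i" e] e by (simp del: sum.lessThan_Suc mult_Suc_right)
    thus "\<zeta> i $ e = 0\<^sub>v m $ e" using S e by simp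
  qed (use \<zeta>[OF i] in simp)
  have "\<xi> = 0\<^sub>v n"
  proof (cases S)
    case 0
    have "\<xi> $ k = 0" if "k < n" for k
    proof -
      have "(\<Sum>s<Suc n. \<alpha> s * \<theta> (s * L) $ k) = \<alpha> 0 * \<theta> 0 $ k"
        using S_max by (subst sum.lessThan_Suc_shift) (simp add: 0)
      thus ?thesis using \<alpha>0[OF that] S by (simp add: 0 \<theta>_def)
    qed
    thus ?thesis using \<xi> by (intro eq_vecI) auto
  next
    \<comment> \<open>\<dots> and, once these vanish, the page before it carries the orbit of \<open>\<xi>\<close> alone.\<close>
    case (Suc S')
    have "\<beta> k = 0\<^sub>v m" if k: "k < L" for k
    proof (intro eq_vecI)
      fix e assume "e < dim_vec (0\<^sub>v m :: real vec)"
      hence e: "e < m" by simp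
      define \<tau> where "\<tau> = S * L - 1 - k"
      have \<tau>: "S' * L \<le> \<tau>" "\<tau> < S * L" "S * L - 1 - \<tau> = k" using k by (auto simp: \<tau>_def Suc)
      have "(\<Sum>s<Suc n. if \<tau> < s * L then \<alpha> s * \<beta> (s * L - 1 - \<tau>) $ e else 0)
        = (\<Sum>s<Suc n. if s = S then \<alpha> S * \<beta> k $ e else 0)"
      proof (rule sum.cong[OF refl])
        fix s assume "s \<in> {..<Suc n}"
        moreover have "\<not> \<tau> < s * L" if "s < S"
        proof -
          have "s * L \<le> S' * L" using that by (intro mult_right_mono) (auto simp: Suc)
          thus ?thesis using \<tau>(1) by linarith
        qed
        ultimately show "(if \<tau> < s * L then \<alpha> s * \<beta> (s * L - 1 - \<tau>) $ e else 0) = (if s = S then \<alpha> S * \<beta> k $ e else 0)"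
          using S_max[of s] \<tau> by (cases s S rule: linorder_cases) auto
      qed
      also have "\<dots> = \<alpha> S * \<beta> k $ e" using S by (simp del: sum.lessThan_Suc)
      moreover have "\<tau> < L * Suc n" using \<tau>(2) SL by linarith
      ultimately have "\<alpha> S * \<beta> k $ e = 0"
        using coef_index[of \<tau> e] e \<zeta>0[of "\<tau> mod L"] L by (simp del: sum.lessThan_Suc mult_Suc_right)
      thus "\<beta> k $ e = 0\<^sub>v m $ e" using S e by simp
    qed (use \<beta> in simp)
    thus ?thesis using pos unfolding \<beta>_def \<theta>_def by (intro controllable_adjoint[OF A B \<xi> ctrb]) auto
  qed
  thus ?thesis using \<zeta>0 by blast
qed

section \<open>Data generated by a linear system with one output\<close>

lemma sum_lessThan_add: "(\<Sum>\<tau><a + (k :: nat). g \<tau>) = (\<Sum>\<tau><a. g \<tau>) + (\<Sum>\<tau><k. (g (a + \<tau>) :: real))"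
  by (induction k) auto

lemma (in data_dims) H_kernel:
  assumes z: "z \<in> carrier_vec N" and "H_mat d *\<^sub>v z = 0\<^sub>v (a + (l + b))"
  shows "U_p d *\<^sub>v z = 0\<^sub>v a" "Y_p d *\<^sub>v z = 0\<^sub>v l" "U_f d *\<^sub>v z = 0\<^sub>v b"
proof -
  have split: "0\<^sub>v (a + (l + b)) = 0\<^sub>v a @\<^sub>v 0\<^sub>v l @\<^sub>v (0\<^sub>v b :: real vec)" by (intro eq_vecI) auto
  have c: "U_p d *\<^sub>v z \<in> carrier_vec a" "Y_p d *\<^sub>v z \<in> carrier_vec l"
    using dims z by (auto intro: mult_mat_vec_carrier)
  have "(U_p d *\<^sub>v z) @\<^sub>v (Y_p d *\<^sub>v z) @\<^sub>v (U_f d *\<^sub>v z) = 0\<^sub>v a @\<^sub>v 0\<^sub>v l @\<^sub>v 0\<^sub>v b"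
    using assms H_mult[OF z] split by simp
  thus "U_p d *\<^sub>v z = 0\<^sub>v a" "Y_p d *\<^sub>v z = 0\<^sub>v l" "U_f d *\<^sub>v z = 0\<^sub>v b"
    using append_vec_eq[OF c(1) zero_carrier_vec] append_vec_eq[OF c(2) zero_carrier_vec] by auto
qed

lemma mk_data_dims:
  assumes "0 < L" "lp < L"
  shows "data_dims (mk_data m 1 L lp T u y ur yr) (m * lp) lp (m * (L - lp)) (L - lp) (T div L)"
  using assms page_mat_carrier[of L m 1 T u] page_mat_carrier[of L 1 1 T y]
  by unfold_locales (auto simp: mk_data_def first_rows_def last_rows_def col_seq_def)

lemma mk_data_index:
  fixes u y ur yr :: "nat \<Rightarrow> real vec" and m L lp T i j :: nat
  assumes L: "0 < L" "lp < L" and j: "j < T div L"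
  defines "d \<equiv> mk_data m 1 L lp T u y ur yr"
  shows "i < m * lp \<Longrightarrow> U_p d $$ (i, j) = u (j * L + 1 + i div m) $ (i mod m)"
    and "i < m * (L - lp) \<Longrightarrow> U_f d $$ (i, j) = u (j * L + 1 + (lp + i div m)) $ (i mod m)"
    and "i < lp \<Longrightarrow> Y_p d $$ (i, j) = y (j * L + 1 + i) $ 0"
    and "i < L - lp \<Longrightarrow> Y_f d $$ (i, j) = y (j * L + 1 + (lp + i)) $ 0"
proof -
  note P = page_mat_carrier[OF L(1), of m 1 T u] page_mat_carrier[OF L(1), of 1 1 T y]
  have mL: "m * L = m * lp + m * (L - lp)" using L by (simp flip: distrib_left)
  show "U_p d $$ (i, j) = u (j * L + 1 + i div m) $ (i mod m)" if "i < m * lp"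
    using that j L P page_mat_index[OF L(1), of i m j T 1 u] mL by (simp add: d_def mk_data_def first_rows_def)
  show "U_f d $$ (i, j) = u (j * L + 1 + (lp + i div m)) $ (i mod m)" if i: "i < m * (L - lp)"
  proof -
    have "0 < m" using i by (cases m) auto
    hence "(m * lp + i) div m = lp + i div m" "(m * lp + i) mod m = i mod m" by simp_all
    moreover have "U_f d $$ (i, j) = page_mat m L 1 T u $$ (m * lp + i, j)"
      using i j P mL by (simp add: d_def mk_data_def last_rows_def)
    ultimately show ?thesis using page_mat_index[OF L(1), of "m * lp + i" m j T 1 u] i j mL by simp
  qed
  show "Y_p d $$ (i, j) = y (j * L + 1 + i) $ 0" if "i < lp"
    using that j L P page_mat_index[OF L(1), of i 1 j T 1 y] by (simp add: d_def mk_data_def first_rows_def)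
  show "Y_f d $$ (i, j) = y (j * L + 1 + (lp + i)) $ 0" if "i < L - lp"
    using that j L P page_mat_index[OF L(1), of "lp + i" 1 j T 1 y] by (simp add: d_def mk_data_def last_rows_def)
qed

locale miso_data =
  fixes A B C D :: "real mat" and n m L lp T :: nat and x u y ur yr :: "nat \<Rightarrow> real vec"
  assumes system: "A \<in> carrier_mat n n" "B \<in> carrier_mat n m" "C \<in> carrier_mat 1 n" "D \<in> carrier_mat 1 m"
      "0 < n" "0 < m"
    and minimal: "controllable A B" "observable A C"
    and lp: "lp = obs_index A C" "lp < L"
    and traj: "is_trajectory A B C D 1 T x u y"
begin

abbreviation c :: "real vec" where "c \<equiv> row C 0"

abbreviation dd :: "real vec" where "dd \<equiv> row D 0"

abbreviation N :: nat where "N \<equiv> T div L"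

abbreviation d :: data where "d \<equiv> mk_data m 1 L lp T u y ur yr"

sublocale data_dims d "m * lp" lp "m * (L - lp)" "L - lp" N
  by (rule mk_data_dims) (use lp in auto)

lemma L_pos: "0 < L" using lp by simp

lemma c_carrier: "c \<in> carrier_vec n" "dd \<in> carrier_vec m"
  using system by auto

lemma trajD:
  assumes "t \<in> {1..T}"
  shows "x t \<in> carrier_vec n \<and> u t \<in> carrier_vec m \<and> x (Suc t) = A *\<^sub>v x t + B *\<^sub>v u t"
    and "y t $ 0 = c \<bullet> x t + dd \<bullet> u t"
  using traj assms system unfolding is_trajectory_def by (auto simp: carrier_matD)

lemma time_in_range:
  assumes "j < N" "\<tau> < L"
  shows "j * L + 1 + \<tau> \<in> {1..T}" "Suc j * L \<le> T"
proof -
  show "Suc j * L \<le> T" using assms L_pos by (simp add: less_eq_div_iff_mult_less_eq Suc_le_eq[symmetric])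
  thus "j * L + 1 + \<tau> \<in> {1..T}" using assms by simp
qed

lemma x_by_adjoint:
  assumes "j < N" "i < L"
  shows "c \<bullet> x (j * L + 1 + i) = adjoint_orbit A c i \<bullet> x (j * L + 1)
    + (\<Sum>s<i. (B\<^sup>T *\<^sub>v adjoint_orbit A c (i - 1 - s)) \<bullet> u (j * L + 1 + s))"
proof (rule scalar_prod_trajectory[OF system(1,2) c_carrier(1)], rule trajD(1))
  fix s assume "s < i"
  thus "j * L + 1 + s \<in> {1..T}" using assms by (intro time_in_range) auto
qed

lemma adjoint_c: "adjoint_orbit A c i \<in> carrier_vec n" "B\<^sup>T *\<^sub>v adjoint_orbit A c i \<in> carrier_vec m"
proof -
  show *: "adjoint_orbit A c i \<in> carrier_vec n" by (rule adjoint_orbit_carrier[OF system(1) c_carrier(1)])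
  show "B\<^sup>T *\<^sub>v adjoint_orbit A c i \<in> carrier_vec m"
    using * system(2) mult_mat_vec_carrier[of "B\<^sup>T" m n] by simp
qed

subsection \<open>Observability over the past window\<close>

lemma obs_mat_carrier: "obs_mat A C k \<in> carrier_mat k n"
  using system by (simp add: obs_mat_def vstack_def)

lemma obs_mat_row:
  assumes "i < k"
  shows "row (obs_mat A C k) i = adjoint_orbit A c i"
proof -
  have P: "A ^\<^sub>m i \<in> carrier_mat n n" using system by simp
  show ?thesis
    unfolding adjoint_orbit_pow[OF system(1) c_carrier(1)]
  proof (intro eq_vecI)
    fix e assume "e < dim_vec ((A ^\<^sub>m i)\<^sup>T *\<^sub>v c)"
    hence e: "e < n" using carrier_matD(2)[OF P] by simp
    have col: "col (A ^\<^sub>m i) e \<in> carrier_vec n" using col_dim[of "A ^\<^sub>m i" e] carrier_matD(1)[OF P] by simp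
    have "row (obs_mat A C k) i $ e = obs_mat A C k $$ (i, e)"
      using assms e obs_mat_carrier[of k] by simp
    also have "\<dots> = (C * A ^\<^sub>m i) $$ (0, e)"
      using assms e system by (simp add: obs_mat_def vstack_def)
    also have "\<dots> = c \<bullet> col (A ^\<^sub>m i) e"
      using e system carrier_matD(2)[OF P] by simp
    also have "\<dots> = ((A ^\<^sub>m i)\<^sup>T *\<^sub>v c) $ e"
      using e carrier_matD(2)[OF P] comm_scalar_prod[OF c_carrier(1) col] by simp
    finally show "row (obs_mat A C k) i $ e = ((A ^\<^sub>m i)\<^sup>T *\<^sub>v c) $ e" .
  qed (use assms obs_mat_carrier[of k] carrier_matD(2)[OF P] in simp)
qed

lemma obs_index: "0 < lp" "full_col_rank (obs_mat A C lp)" "lp \<le> n"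
proof -
  have n: "0 < n \<and> full_col_rank (obs_mat A C n)" using minimal system by (simp add: observable_def)
  show "0 < lp" "full_col_rank (obs_mat A C lp)"
    using LeastI[of "\<lambda>l. 0 < l \<and> full_col_rank (obs_mat A C l)", OF n] by (auto simp: lp obs_index_def)
  show "lp \<le> n" unfolding lp obs_index_def by (rule Least_le) (rule n)
qed

lemma obs_kernel:
  assumes "X \<in> carrier_vec n" "\<And>i. i < lp \<Longrightarrow> adjoint_orbit A c i \<bullet> X = 0"
  shows "X = 0\<^sub>v n"
proof (rule full_col_rank_kernel[OF obs_mat_carrier obs_index(2) assms(1)])
  show "obs_mat A C lp *\<^sub>v X = 0\<^sub>v lp"
    using assms obs_mat_carrier[of lp] by (intro eq_vecI) (auto simp: obs_mat_row)
qed

text \<open>With a single output, the observability matrix over the past window is square. This is where the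
  restriction to one output enters: the past outputs satisfy no linear relation.\<close>

lemma lp_eq_n: "lp = n"
proof (rule ccontr)
  assume "lp \<noteq> n"
  then obtain v where "v \<in> carrier_vec n" "v \<noteq> 0\<^sub>v n" "obs_mat A C lp *\<^sub>v v = 0\<^sub>v lp"
    using wide_mat_kernel[OF obs_mat_carrier[of lp]] obs_index(3) by (metis le_neq_implies_less)
  thus False using full_col_rank_kernel[OF obs_mat_carrier obs_index(2)] by blast
qed

lemma obs_left_kernel:
  assumes psi: "\<psi> \<in> carrier_vec lp" and 0: "\<And>k. k < n \<Longrightarrow> (\<Sum>i<lp. \<psi> $ i * adjoint_orbit A c i $ k) = 0"
  shows "\<psi> = 0\<^sub>v lp"
proof -
  let ?O = "obs_mat A C lp"
  have O: "?O \<in> carrier_mat n n" using obs_mat_carrier[of lp] by (simp add: lp_eq_n)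
  have "\<not> (\<exists>v. v \<in> carrier_vec n \<and> v \<noteq> 0\<^sub>v n \<and> ?O *\<^sub>v v = 0\<^sub>v n)"
    using full_col_rank_kernel[OF obs_mat_carrier obs_index(2)] by (auto simp: lp_eq_n)
  hence "det ?O \<noteq> 0" using det_0_iff_vec_prod_zero_field[OF O] by blast
  hence "det ?O\<^sup>T \<noteq> 0" using det_transpose[OF O] by simp
  moreover have "?O\<^sup>T *\<^sub>v \<psi> = 0\<^sub>v n"
  proof (intro eq_vecI)
    fix k assume "k < dim_vec (0\<^sub>v n :: real vec)"
    hence k: "k < n" by simp
    have entry: "?O $$ (i, k) = adjoint_orbit A c i $ k" if "i < lp" for i
      using obs_mat_row[OF that] obs_mat_carrier[of lp] that k by (metis carrier_matD index_row(1))
    have "(?O\<^sup>T *\<^sub>v \<psi>) $ k = (\<Sum>i<lp. \<psi> $ i * ?O $$ (i, k))"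
      using k obs_mat_carrier[of lp] psi by (simp add: scalar_prod_def atLeast0LessThan mult.commute)
    also have "\<dots> = 0" using 0[OF k] entry by simp
    finally show "(?O\<^sup>T *\<^sub>v \<psi>) $ k = 0\<^sub>v n $ k" using k by simp
  qed (use O in simp)
  ultimately show ?thesis
    using det_0_iff_vec_prod_zero_field[of "?O\<^sup>T" n] O psi by (auto simp: lp_eq_n)
qed

subsection \<open>Past window and inputs determine the outputs\<close>

text \<open>A linear combination of pages is a trajectory. If its inputs and its past outputs vanish, then
  so does its initial state, by observability, and hence all its outputs.\<close>

lemma consistent:
  assumes z: "z \<in> carrier_vec N" and H: "H_mat d *\<^sub>v z = 0\<^sub>v (m * lp + (lp + m * (L - lp)))"
  shows "Y_f d *\<^sub>v z = 0\<^sub>v (L - lp)"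
proof -
  note K = H_kernel[OF z H]
  note idx = mk_data_index[OF L_pos lp(2)]
  have u0: "(\<Sum>j<N. z $ j * u (j * L + 1 + \<tau>) $ e) = 0" if \<tau>: "\<tau> < L" and e: "e < m" for \<tau> e
  proof -
    have lt: "\<tau>' * m + e < m * k" if "\<tau>' < k" for \<tau>' k
    proof -
      have "\<tau>' * m + e < Suc \<tau>' * m" using e by simp
      also have "\<dots> \<le> k * m" using that by (intro mult_right_mono) auto
      finally show ?thesis by (simp add: mult.commute)
    qed
    show ?thesis
    proof (cases "\<tau> < lp")
      case True
      have i: "\<tau> * m + e < m * lp" by (rule lt[OF True])
      have "(U_p d *\<^sub>v z) $ (\<tau> * m + e) = (\<Sum>j<N. U_p d $$ (\<tau> * m + e, j) * z $ j)"
        using i dims z by (simp add: scalar_prod_def atLeast0LessThan)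
      also have "\<dots> = (\<Sum>j<N. z $ j * u (j * L + 1 + \<tau>) $ e)"
        using idx(1)[OF _ i] e by (intro sum.cong) auto
      finally show ?thesis using K(1) i by simp
    next
      case False
      define \<tau>' where "\<tau>' = \<tau> - lp"
      have \<tau>': "\<tau> = lp + \<tau>'" "\<tau>' < L - lp" using False \<tau> by (auto simp: \<tau>'_def)
      have i: "\<tau>' * m + e < m * (L - lp)" by (rule lt[OF \<tau>'(2)])
      have "(U_f d *\<^sub>v z) $ (\<tau>' * m + e) = (\<Sum>j<N. U_f d $$ (\<tau>' * m + e, j) * z $ j)"
        using i dims z by (simp add: scalar_prod_def atLeast0LessThan)
      also have "\<dots> = (\<Sum>j<N. z $ j * u (j * L + 1 + \<tau>) $ e)"
        using idx(2)[OF _ i] e by (intro sum.cong) (auto simp: \<tau>'(1))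
      finally show ?thesis using K(3) i by simp
    qed
  qed
  have w0: "(\<Sum>j<N. z $ j * (w \<bullet> u (j * L + 1 + \<tau>))) = 0" if "w \<in> carrier_vec m" "\<tau> < L" for w \<tau>
  proof -
    have "(\<Sum>j<N. z $ j * (w \<bullet> u (j * L + 1 + \<tau>))) = (\<Sum>j<N. \<Sum>e<m. w $ e * (z $ j * u (j * L + 1 + \<tau>) $ e))"
    proof (rule sum.cong[OF refl])
      fix j assume "j \<in> {..<N}"
      hence "u (j * L + 1 + \<tau>) \<in> carrier_vec m" using trajD(1)[OF time_in_range(1)] that by blast
      thus "z $ j * (w \<bullet> u (j * L + 1 + \<tau>)) = (\<Sum>e<m. w $ e * (z $ j * u (j * L + 1 + \<tau>) $ e))"
        by (simp add: scalar_prod_def atLeast0LessThan sum_distrib_left mult_ac)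
    qed
    also have "\<dots> = (\<Sum>e<m. w $ e * (\<Sum>j<N. z $ j * u (j * L + 1 + \<tau>) $ e))"
      by (subst sum.swap) (simp add: sum_distrib_left)
    also have "\<dots> = 0" using u0[OF that(2)] by simp
    finally show ?thesis .
  qed
  define X where "X = vec n (\<lambda>k. \<Sum>j<N. z $ j * x (j * L + 1) $ k)"
  have X: "X \<in> carrier_vec n" by (simp add: X_def)
  have out: "(\<Sum>j<N. z $ j * y (j * L + 1 + i) $ 0) = adjoint_orbit A c i \<bullet> X" if i: "i < L" for i
  proof -
    have "(\<Sum>j<N. z $ j * y (j * L + 1 + i) $ 0)
      = (\<Sum>j<N. z $ j * (adjoint_orbit A c i \<bullet> x (j * L + 1)) +
          (\<Sum>s<i. z $ j * ((B\<^sup>T *\<^sub>v adjoint_orbit A c (i - 1 - s)) \<bullet> u (j * L + 1 + s))) +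
          z $ j * (dd \<bullet> u (j * L + 1 + i)))"
    proof (rule sum.cong[OF refl])
      fix j assume "j \<in> {..<N}"
      hence j: "j < N" by simp
      show "z $ j * y (j * L + 1 + i) $ 0 = z $ j * (adjoint_orbit A c i \<bullet> x (j * L + 1)) +
          (\<Sum>s<i. z $ j * ((B\<^sup>T *\<^sub>v adjoint_orbit A c (i - 1 - s)) \<bullet> u (j * L + 1 + s))) +
          z $ j * (dd \<bullet> u (j * L + 1 + i))"
        unfolding trajD(2)[OF time_in_range(1)[OF j i]] x_by_adjoint[OF j i]
        by (simp add: distrib_left sum_distrib_left)
    qed
    also have "\<dots> = (\<Sum>j<N. z $ j * (adjoint_orbit A c i \<bullet> x (j * L + 1)))
      + (\<Sum>s<i. \<Sum>j<N. z $ j * ((B\<^sup>T *\<^sub>v adjoint_orbit A c (i - 1 - s)) \<bullet> u (j * L + 1 + s)))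
      + (\<Sum>j<N. z $ j * (dd \<bullet> u (j * L + 1 + i)))"
      by (simp add: sum.distrib sum.swap[of _ "{..<i}"])
    also have "\<dots> = (\<Sum>j<N. z $ j * (adjoint_orbit A c i \<bullet> x (j * L + 1)))"
      using w0[OF c_carrier(2) i] w0[OF adjoint_c(2)] i by simp
    also have "\<dots> = (\<Sum>j<N. \<Sum>k<n. adjoint_orbit A c i $ k * (z $ j * x (j * L + 1) $ k))"
    proof (rule sum.cong[OF refl])
      fix j assume "j \<in> {..<N}"
      hence "x (j * L + 1) \<in> carrier_vec n" using trajD(1)[OF time_in_range(1)[of j 0]] L_pos by simp
      thus "z $ j * (adjoint_orbit A c i \<bullet> x (j * L + 1)) = (\<Sum>k<n. adjoint_orbit A c i $ k * (z $ j * x (j * L + 1) $ k))"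
        by (simp add: scalar_prod_def atLeast0LessThan sum_distrib_left mult_ac)
    qed
    also have "\<dots> = adjoint_orbit A c i \<bullet> X"
      by (subst sum.swap) (simp add: scalar_prod_def atLeast0LessThan X_def sum_distrib_left)
    finally show ?thesis .
  qed
  have "X = 0\<^sub>v n"
  proof (rule obs_kernel[OF X])
    fix i assume i: "i < lp"
    have "(Y_p d *\<^sub>v z) $ i = (\<Sum>j<N. z $ j * y (j * L + 1 + i) $ 0)"
      using i dims z idx(3)[OF _ i] by (simp add: scalar_prod_def atLeast0LessThan mult.commute)
    thus "adjoint_orbit A c i \<bullet> X = 0" using K(2) i out[of i] lp by simp
  qed
  show ?thesis
  proof (intro eq_vecI)
    fix i assume "i < dim_vec (0\<^sub>v (L - lp) :: real vec)"
    hence i: "i < L - lp" by simp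
    have "(Y_f d *\<^sub>v z) $ i = (\<Sum>j<N. z $ j * y (j * L + 1 + (lp + i)) $ 0)"
      using i dims z idx(4)[OF _ i] by (simp add: scalar_prod_def atLeast0LessThan mult.commute)
    also have "\<dots> = 0" using out[of "lp + i"] i \<open>X = 0\<^sub>v n\<close> adjoint_c(1) by simp
    finally show "(Y_f d *\<^sub>v z) $ i = 0\<^sub>v (L - lp) $ i" using i by simp
  qed (use dims in auto)
qed

subsection \<open>Full row rank of the data matrix\<close>

text \<open>Expressing the past outputs by the initial state of the page turns a left kernel vector into a
  relation among initial states and inputs, so that the fundamental lemma applies. It annihilates the
  coefficient of the state, and observability recovers the weights of the past outputs from it.\<close>

lemma H_left_kernel:
  assumes exc: "page_exciting m L (Suc n) T u"
    and v: "v \<in> carrier_vec (m * lp + (lp + m * (L - lp)))"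
    and 0: "(H_mat d)\<^sup>T *\<^sub>v v = 0\<^sub>v N"
  shows "v = 0\<^sub>v (m * lp + (lp + m * (L - lp)))"
proof -
  note idx = mk_data_index[OF L_pos lp(2)]
  define vp where "vp = vec (m * lp) (\<lambda>i. v $ i)"
  define \<psi> where "\<psi> = vec lp (\<lambda>i. v $ (m * lp + i))"
  define vf where "vf = vec (m * (L - lp)) (\<lambda>i. v $ (m * lp + lp + i))"
  have v_split: "v = vp @\<^sub>v \<psi> @\<^sub>v vf"
    using v by (intro eq_vecI) (auto simp: vp_def \<psi>_def vf_def)
  have vc: "vp \<in> carrier_vec (m * lp)" "\<psi> \<in> carrier_vec lp" "vf \<in> carrier_vec (m * (L - lp))"
    by (auto simp: vp_def \<psi>_def vf_def)
  define w where "w \<tau> = vec m (\<lambda>e. if \<tau> < lp then vp $ (\<tau> * m + e) else vf $ ((\<tau> - lp) * m + e))" for \<tau>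
  define \<xi> where "\<xi> = vec n (\<lambda>k. \<Sum>i<lp. \<psi> $ i * adjoint_orbit A c i $ k)"
  define \<beta> where "\<beta> k = B\<^sup>T *\<^sub>v adjoint_orbit A c k" for k
  define \<zeta> where "\<zeta> \<tau> = vec m (\<lambda>e. w \<tau> $ e + (if \<tau> < lp then \<psi> $ \<tau> * dd $ e else 0)
    + (\<Sum>i<lp. if \<tau> < i then \<psi> $ i * \<beta> (i - 1 - \<tau>) $ e else 0))" for \<tau>
  have \<beta>: "\<beta> k \<in> carrier_vec m" for k using adjoint_c(2) by (simp add: \<beta>_def)
  have rel: "\<xi> \<bullet> x (j * L + 1) + (\<Sum>\<tau><L. \<zeta> \<tau> \<bullet> u (j * L + 1 + \<tau>)) = 0" if "Suc j * L \<le> T" for j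
  proof -
    let ?u = "\<lambda>\<tau>. u (j * L + 1 + \<tau>)"
    have j: "j < N" using that L_pos by (simp add: less_eq_div_iff_mult_less_eq Suc_le_eq[symmetric])
    have uc: "?u \<tau> \<in> carrier_vec m" if "\<tau> < L" for \<tau> using trajD(1)[OF time_in_range(1)[OF j that]] by blast
    have xc: "x (j * L + 1) \<in> carrier_vec n" using trajD(1)[OF time_in_range(1)[OF j L_pos]] by simp
    let ?z = "unit_vec N j :: real vec"
    have z: "?z \<in> carrier_vec N" by simp
    have Mz: "M *\<^sub>v ?z = col M j" if "M \<in> carrier_mat r N" for M :: "real mat" and r
      using that j by (intro eq_vecI) auto
    have cols: "col (U_p d) j \<in> carrier_vec (m * lp)" "col (Y_p d) j \<in> carrier_vec lp"
        "col (U_f d) j \<in> carrier_vec (m * (L - lp))"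
      using dims(1,2,3) by (metis carrier_matD(1) col_dim)+
    have "0 = ((H_mat d)\<^sup>T *\<^sub>v v) \<bullet> ?z" using 0 j by simp
    also have "\<dots> = v \<bullet> (H_mat d *\<^sub>v ?z)" by (rule transpose_vec_mult_scalar[OF H_carrier z v])
    also have "H_mat d *\<^sub>v ?z = col (U_p d) j @\<^sub>v col (Y_p d) j @\<^sub>v col (U_f d) j"
      by (simp only: H_mult[OF z] Mz[OF dims(1)] Mz[OF dims(2)] Mz[OF dims(3)])
    also have "v \<bullet> \<dots> = vp \<bullet> col (U_p d) j + (\<psi> \<bullet> col (Y_p d) j + vf \<bullet> col (U_f d) j)"
      unfolding v_split using vc cols by (simp add: append_carrier_vec
        scalar_prod_append[of _ "m * lp" _ "lp + m * (L - lp)"] scalar_prod_append[of _ lp _ "m * (L - lp)"])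
    also have "vp \<bullet> col (U_p d) j = (\<Sum>\<tau><lp. w \<tau> \<bullet> ?u \<tau>)"
    proof -
      have "vp \<bullet> col (U_p d) j = (\<Sum>i<m * lp. vp $ (i div m * m + i mod m) * u (j * L + 1 + i div m) $ (i mod m))"
        using dims j by (simp add: scalar_prod_def atLeast0LessThan idx(1) del: One_nat_def)
      also have "\<dots> = (\<Sum>\<tau><lp. \<Sum>e<m. vp $ (\<tau> * m + e) * u (j * L + 1 + \<tau>) $ e)"
        by (rule sum_mult_group[OF system(6)])
      also have "\<dots> = (\<Sum>\<tau><lp. w \<tau> \<bullet> ?u \<tau>)"
      proof (rule sum.cong[OF refl])
        fix \<tau> assume "\<tau> \<in> {..<lp}"
        thus "(\<Sum>e<m. vp $ (\<tau> * m + e) * u (j * L + 1 + \<tau>) $ e) = w \<tau> \<bullet> ?u \<tau>"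
          using uc[of \<tau>] lp by (simp add: scalar_prod_def atLeast0LessThan w_def)
      qed
      finally show ?thesis .
    qed
    also have "vf \<bullet> col (U_f d) j = (\<Sum>\<tau><L - lp. w (lp + \<tau>) \<bullet> ?u (lp + \<tau>))"
    proof -
      have "vf \<bullet> col (U_f d) j = (\<Sum>i<m * (L - lp). vf $ (i div m * m + i mod m) * u (j * L + 1 + (lp + i div m)) $ (i mod m))"
        using dims j by (simp add: scalar_prod_def atLeast0LessThan idx(2) del: One_nat_def)
      also have "\<dots> = (\<Sum>\<tau><L - lp. \<Sum>e<m. vf $ (\<tau> * m + e) * u (j * L + 1 + (lp + \<tau>)) $ e)"
        by (rule sum_mult_group[OF system(6)])
      also have "\<dots> = (\<Sum>\<tau><L - lp. w (lp + \<tau>) \<bullet> ?u (lp + \<tau>))"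
      proof (rule sum.cong[OF refl])
        fix \<tau> assume "\<tau> \<in> {..<L - lp}"
        hence "lp + \<tau> < L" by auto
        thus "(\<Sum>e<m. vf $ (\<tau> * m + e) * u (j * L + 1 + (lp + \<tau>)) $ e) = w (lp + \<tau>) \<bullet> ?u (lp + \<tau>)"
          using uc[of "lp + \<tau>"] by (simp add: scalar_prod_def atLeast0LessThan w_def)
      qed
      finally show ?thesis .
    qed
    also have "\<psi> \<bullet> col (Y_p d) j = (\<Sum>i<lp. \<psi> $ i * (adjoint_orbit A c i \<bullet> x (j * L + 1))
        + (\<Sum>s<i. \<psi> $ i * (\<beta> (i - 1 - s) \<bullet> ?u s)) + \<psi> $ i * (dd \<bullet> ?u i))"
    proof -
      have "\<psi> \<bullet> col (Y_p d) j = (\<Sum>i<lp. \<psi> $ i * y (j * L + 1 + i) $ 0)"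
        using dims j by (simp add: scalar_prod_def atLeast0LessThan idx(3) del: One_nat_def)
      also have "\<dots> = (\<Sum>i<lp. \<psi> $ i * (adjoint_orbit A c i \<bullet> x (j * L + 1))
        + (\<Sum>s<i. \<psi> $ i * (\<beta> (i - 1 - s) \<bullet> ?u s)) + \<psi> $ i * (dd \<bullet> ?u i))"
      proof (rule sum.cong[OF refl])
        fix i assume "i \<in> {..<lp}"
        hence i: "i < L" using lp by simp
        show "\<psi> $ i * y (j * L + 1 + i) $ 0 = \<psi> $ i * (adjoint_orbit A c i \<bullet> x (j * L + 1))
          + (\<Sum>s<i. \<psi> $ i * (\<beta> (i - 1 - s) \<bullet> ?u s)) + \<psi> $ i * (dd \<bullet> ?u i)"
          unfolding trajD(2)[OF time_in_range(1)[OF j i]] x_by_adjoint[OF j i] \<beta>_def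
          by (simp add: distrib_left sum_distrib_left)
      qed
      finally show ?thesis .
    qed
    finally have sum0: "(\<Sum>\<tau><lp. w \<tau> \<bullet> ?u \<tau>) + (\<Sum>\<tau><L - lp. w (lp + \<tau>) \<bullet> ?u (lp + \<tau>))
      + (\<Sum>i<lp. \<psi> $ i * (adjoint_orbit A c i \<bullet> x (j * L + 1)))
      + (\<Sum>i<lp. \<Sum>s<i. \<psi> $ i * (\<beta> (i - 1 - s) \<bullet> ?u s)) + (\<Sum>i<lp. \<psi> $ i * (dd \<bullet> ?u i)) = 0"
      by (simp add: sum.distrib)
    have \<zeta>u: "\<zeta> \<tau> \<bullet> ?u \<tau> = w \<tau> \<bullet> ?u \<tau> + (if \<tau> < lp then \<psi> $ \<tau> * (dd \<bullet> ?u \<tau>) else 0)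
      + (\<Sum>i<lp. if \<tau> < i then \<psi> $ i * (\<beta> (i - 1 - \<tau>) \<bullet> ?u \<tau>) else 0)" if "\<tau> < L" for \<tau>
    proof -
      define g where "g = ?u \<tau>"
      have g: "dim_vec g = m" using uc[OF that] by (simp add: g_def)
      have "\<zeta> \<tau> \<bullet> g = (\<Sum>e<m. w \<tau> $ e * g $ e) + (\<Sum>e<m. if \<tau> < lp then \<psi> $ \<tau> * (dd $ e * g $ e) else 0)
        + (\<Sum>e<m. \<Sum>i<lp. if \<tau> < i then \<psi> $ i * (\<beta> (i - 1 - \<tau>) $ e * g $ e) else 0)"
        unfolding sum.distrib[symmetric] using g
        by (simp add: scalar_prod_def \<zeta>_def atLeast0LessThan distrib_right sum_distrib_right mult.assoc
          if_distrib[of "\<lambda>x. x * _"] cong: if_cong)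
      also have "(\<Sum>e<m. \<Sum>i<lp. if \<tau> < i then \<psi> $ i * (\<beta> (i - 1 - \<tau>) $ e * g $ e) else 0)
        = (\<Sum>i<lp. if \<tau> < i then \<psi> $ i * (\<beta> (i - 1 - \<tau>) \<bullet> g) else 0)"
        using g by (subst sum.swap, intro sum.cong) (auto simp: scalar_prod_def atLeast0LessThan sum_distrib_left)
      also have "(\<Sum>e<m. w \<tau> $ e * g $ e) = w \<tau> \<bullet> g"
        using g by (simp add: scalar_prod_def atLeast0LessThan)
      also have "(\<Sum>e<m. if \<tau> < lp then \<psi> $ \<tau> * (dd $ e * g $ e) else 0) = (if \<tau> < lp then \<psi> $ \<tau> * (dd \<bullet> g) else 0)"
        using g by (simp add: scalar_prod_def atLeast0LessThan sum_distrib_left)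
      finally show ?thesis by (simp only: g_def)
    qed
    have "(\<Sum>\<tau><L. \<zeta> \<tau> \<bullet> ?u \<tau>) = (\<Sum>\<tau><L. w \<tau> \<bullet> ?u \<tau>) + (\<Sum>\<tau><L. if \<tau> < lp then \<psi> $ \<tau> * (dd \<bullet> ?u \<tau>) else 0)
      + (\<Sum>\<tau><L. \<Sum>i<lp. if \<tau> < i then \<psi> $ i * (\<beta> (i - 1 - \<tau>) \<bullet> ?u \<tau>) else 0)"
      unfolding sum.distrib[symmetric] by (intro sum.cong refl \<zeta>u) simp
    also have "(\<Sum>\<tau><L. w \<tau> \<bullet> ?u \<tau>) = (\<Sum>\<tau><lp. w \<tau> \<bullet> ?u \<tau>) + (\<Sum>\<tau><L - lp. w (lp + \<tau>) \<bullet> ?u (lp + \<tau>))"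
      using sum_lessThan_add[of "\<lambda>\<tau>. w \<tau> \<bullet> ?u \<tau>" lp "L - lp"] lp by simp
    also have "(\<Sum>\<tau><L. if \<tau> < lp then \<psi> $ \<tau> * (dd \<bullet> ?u \<tau>) else 0) = (\<Sum>i<lp. \<psi> $ i * (dd \<bullet> ?u i))"
    proof -
      have "{..<L} \<inter> {\<tau>. \<tau> < lp} = {..<lp}" using lp by auto
      thus ?thesis by (simp add: sum.If_cases)
    qed
    also have "(\<Sum>\<tau><L. \<Sum>i<lp. if \<tau> < i then \<psi> $ i * (\<beta> (i - 1 - \<tau>) \<bullet> ?u \<tau>) else 0)
      = (\<Sum>i<lp. \<Sum>s<i. \<psi> $ i * (\<beta> (i - 1 - s) \<bullet> ?u s))"
    proof (subst sum.swap, rule sum.cong[OF refl])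
      fix i assume "i \<in> {..<lp}"
      hence "{..<L} \<inter> {\<tau>. \<tau> < i} = {..<i}" using lp by auto
      thus "(\<Sum>\<tau><L. if \<tau> < i then \<psi> $ i * (\<beta> (i - 1 - \<tau>) \<bullet> ?u \<tau>) else 0) = (\<Sum>s<i. \<psi> $ i * (\<beta> (i - 1 - s) \<bullet> ?u s))"
        by (simp add: sum.If_cases)
    qed
    moreover have "\<xi> \<bullet> x (j * L + 1) = (\<Sum>i<lp. \<psi> $ i * (adjoint_orbit A c i \<bullet> x (j * L + 1)))"
    proof -
      have "\<xi> \<bullet> x (j * L + 1) = (\<Sum>k<n. \<Sum>i<lp. \<psi> $ i * (adjoint_orbit A c i $ k * x (j * L + 1) $ k))"
        using xc by (simp add: \<xi>_def scalar_prod_def atLeast0LessThan sum_distrib_right mult.assoc)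
      also have "\<dots> = (\<Sum>i<lp. \<psi> $ i * (adjoint_orbit A c i \<bullet> x (j * L + 1)))"
        using xc by (subst sum.swap) (simp add: scalar_prod_def atLeast0LessThan sum_distrib_left)
      finally show ?thesis .
    qed
    ultimately show ?thesis using sum0 by linarith
  qed
  have "\<xi> = 0\<^sub>v n \<and> (\<forall>\<tau><L. \<zeta> \<tau> = 0\<^sub>v m)"
    by (rule fundamental_lemma[OF system(1,2) minimal(1) system(6) _ _ exc _ _ rel])
      (use trajD(1) lp lp_eq_n in \<open>auto simp: \<xi>_def \<zeta>_def\<close>)
  hence \<xi>0: "\<xi> = 0\<^sub>v n" and \<zeta>0: "\<And>\<tau>. \<tau> < L \<Longrightarrow> \<zeta> \<tau> = 0\<^sub>v m" by auto
  have \<psi>0: "\<psi> = 0\<^sub>v lp"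
  proof (rule obs_left_kernel[OF vc(2)])
    fix k assume "k < n"
    thus "(\<Sum>i<lp. \<psi> $ i * adjoint_orbit A c i $ k) = 0"
      using arg_cong[OF \<xi>0, of "\<lambda>v. v $ k"] by (simp add: \<xi>_def)
  qed
  have w0: "w \<tau> $ e = 0" if "\<tau> < L" "e < m" for \<tau> e
  proof -
    have "(\<Sum>i<lp. if \<tau> < i then \<psi> $ i * \<beta> (i - 1 - \<tau>) $ e else 0) = 0"
      "(if \<tau> < lp then \<psi> $ \<tau> * dd $ e else 0) = 0"
      by (intro sum.neutral) (auto simp: \<psi>0)
    moreover have "\<zeta> \<tau> $ e = 0" using \<zeta>0[OF that(1)] that(2) by simp
    ultimately show ?thesis using that(2) by (simp add: \<zeta>_def)
  qed
  have "vp $ i = 0" if i: "i < m * lp" for i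
  proof -
    have "i div m < lp" "i mod m < m" using i system(6) by (auto simp: less_mult_imp_div_less mult.commute)
    thus ?thesis using w0[of "i div m" "i mod m"] lp by (simp add: w_def)
  qed
  moreover have "vf $ i = 0" if i: "i < m * (L - lp)" for i
  proof -
    have "i div m < L - lp" "i mod m < m" using i system(6) by (auto simp: less_mult_imp_div_less mult.commute)
    thus ?thesis using w0[of "lp + i div m" "i mod m"] by (simp add: w_def)
  qed
  ultimately show ?thesis
    unfolding v_split using vc \<psi>0 by (intro eq_vecI) auto
qed

lemma H_rows_le:
  assumes "page_exciting m L (Suc n) T u"
  shows "m * lp + (lp + m * (L - lp)) \<le> N"
  by (rule left_kernel_trivial_le[OF H_carrier H_left_kernel[OF assms]])

end

section \<open>The bound is of the order of the noise\<close>

text \<open>Up to the quotient in \<^const>\<open>eta\<close>, the bound is a polynomial with nonnegative coefficients in the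
  noise level, in norms of the data and in quantities that are under control as long as the data matrix
  stays away from rank deficiency. As \<^const>\<open>eta\<close> occurs only in its product with the size of the
  coefficients, the quotient does no harm even if the latter vanish.\<close>

lemma C3_linear_bound:
  fixes \<kappa> :: real and l N :: nat
  assumes \<kappa>: "1 \<le> \<kappa>"
  obtains q where "0 \<le> q"
    "\<And>d a b f e \<delta>. \<lbrakk>predictor d a l b f N e; 0 < a + (l + b); a + (l + b) \<le> N; 1 / e \<le> \<kappa>;
      spectral_norm (Y_f d) \<le> \<kappa>; vnorm (b0 d) \<le> \<kappa>; 0 < \<delta>; \<delta> \<le> 1\<rbrakk> \<Longrightarrow> \<bar>C3 l N \<delta> d\<bar> \<le> q * \<delta>"
proof -
  \<comment> \<open>The constants bound, in this order, the factor \<^const>\<open>K1_mat\<close>, the rates of \<^const>\<open>F1\<close>,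
    \<^const>\<open>F2\<close> and \<^const>\<open>F3\<close>, the value of \<^const>\<open>F_bound\<close>, the product of \<^const>\<open>eta\<close> with the size of
    the coefficients, and the rates of \<^const>\<open>C1\<close>, \<^const>\<open>C2\<close> and \<^const>\<open>C3\<close>.\<close>
  define K where "K = \<kappa> * \<kappa>"
  define p1 where "p1 = 2 * N * \<kappa> * (1 + 4 * \<kappa> * \<kappa>)"
  define p2 where "p2 = (2 * K + p1) * p1"
  define p3 where "p3 = sqrt l * (K * K) + (\<kappa> + sqrt l) * p2"
  define p4 where "p4 = p3 + (K * K * \<kappa> + p3) * p2"
  define E where "E = \<kappa> * (\<kappa> + K * K * \<kappa>) + \<kappa> * p4"
  define q1 where "q1 = 2 * \<kappa> * (sqrt l + E * N)"
  define q2 where "q2 = (\<kappa> + N) * q1 + E * N"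
  define q3 where "q3 = 8 * (q2 * q2) + 4 * \<kappa> * E * q2"
  have \<kappa>0: "0 \<le> \<kappa>" using \<kappa> by simp
  have K0: "0 \<le> K" using \<kappa>0 by (simp add: K_def)
  have p10: "0 \<le> p1" using \<kappa>0 by (simp add: p1_def)
  have p20: "0 \<le> p2" using p10 K0 by (simp add: p2_def)
  have p30: "0 \<le> p3" using p20 K0 \<kappa>0 by (simp add: p3_def)
  have p40: "0 \<le> p4" using p30 p20 K0 \<kappa>0 by (simp add: p4_def)
  have E0: "0 \<le> E" using p40 K0 \<kappa>0 by (simp add: E_def)
  have q10: "0 \<le> q1" using E0 \<kappa>0 by (simp add: q1_def)
  have q20: "0 \<le> q2" using q10 E0 \<kappa>0 by (simp add: q2_def)
  have q30: "0 \<le> q3" using q20 E0 \<kappa>0 by (simp add: q3_def)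
  show thesis
  proof (rule that[OF q30])
    fix d a b f and e \<delta> :: real
    assume P: "predictor d a l b f N e" and r: "0 < a + (l + b)" "a + (l + b) \<le> N" and e\<kappa>: "1 / e \<le> \<kappa>"
      and Y: "spectral_norm (Y_f d) \<le> \<kappa>" and b0: "vnorm (b0 d) \<le> \<kappa>" and \<delta>: "0 < \<delta>" "\<delta> \<le> 1"
    interpret predictor d a l b f N e by (rule P)
    have le1: "s * \<delta> \<le> s" if "0 \<le> s" for s using that \<delta> by (simp add: mult_left_le)
    define h where "h = spectral_norm (pinv (H_mat d))"
    have h: "0 \<le> h" "h \<le> \<kappa>" using pinv_H(3) e\<kappa> by (auto simp: h_def)
    have "e \<le> sigma_min (H_mat d)" by (rule sigma_min_greatest[OF H_carrier r]) (use e in auto)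
    hence sig: "0 \<le> inverse (sigma_min (H_mat d))" "inverse (sigma_min (H_mat d)) \<le> \<kappa>"
      using e(1) e\<kappa> le_imp_inverse_le[of e "sigma_min (H_mat d)"] by (auto simp: inverse_eq_divide)
    have F1: "0 \<le> F1 N \<delta> d" "F1 N \<delta> d \<le> p1 * \<delta>"
    proof -
      have "F1 N \<delta> d = 2 * N * h * (1 + 4 * spectral_norm (Y_f d) * h) * \<delta>" by (simp add: F1_def h_def)
      moreover have "\<dots> \<le> p1 * \<delta>"
        unfolding p1_def using h Y \<delta> \<kappa>0
        by (intro mult_right_mono mult_mono add_left_mono mult_left_mono) auto
      ultimately show "F1 N \<delta> d \<le> p1 * \<delta>" by simp
      show "0 \<le> F1 N \<delta> d" using h \<delta> by (simp add: F1_def h_def)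
    qed
    have K1: "spectral_norm (K1_mat d) \<le> K"
      using spectral_norm_K1_le Y h \<kappa>0 unfolding K_def h_def by (elim order_trans, intro mult_mono) auto
    have F2: "0 \<le> F2 N \<delta> d" "F2 N \<delta> d \<le> p2 * \<delta>"
    proof -
      show "0 \<le> F2 N \<delta> d" using F1 by (simp add: F2_def)
      have "F2 N \<delta> d \<le> (2 * K + p1) * (p1 * \<delta>)"
        unfolding F2_def using F1 K1 K0 p10 le1[OF p10] by (intro mult_mono add_mono) auto
      thus "F2 N \<delta> d \<le> p2 * \<delta>" by (simp add: p2_def)
    qed
    have K21: "spectral_norm ((K2_mat d)\<^sup>T * K1_mat d) \<le> K * K"
    proof -
      have "spectral_norm ((K2_mat d)\<^sup>T * K1_mat d) \<le> spectral_norm (K2_mat d)\<^sup>T * spectral_norm (K1_mat d)"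
        by (rule spectral_norm_mult_le[of _ b f]) (use K1_carrier K2_carrier in auto)
      also have "\<dots> \<le> K * K"
        using spectral_norm_transpose_le[OF K2_carrier] spectral_norm_K2_le K1 K0 by (intro mult_mono) auto
      finally show ?thesis .
    qed
    have F3: "0 \<le> F3 l N \<delta> d" "F3 l N \<delta> d \<le> p3 * \<delta>"
    proof -
      show "0 \<le> F3 l N \<delta> d" using F2 \<delta> by (simp add: F3_def)
      have "sqrt l * \<delta> \<le> sqrt l" by (rule le1) simp
      hence "F3 l N \<delta> d \<le> sqrt l * (K * K) * \<delta> + (\<kappa> + sqrt l) * (p2 * \<delta>)"
        unfolding F3_def using F2 K21 b0 \<delta> \<kappa>0
        by (intro add_mono mult_right_mono mult_left_mono mult_mono) auto
      thus "F3 l N \<delta> d \<le> p3 * \<delta>" by (simp add: p3_def algebra_simps)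
    qed
    have nv: "vnorm normal_vec \<le> K * K * \<kappa>"
      using K21 b0 K0 by (intro order_trans[OF vnorm_mult_mat_vec_le[OF K2T_K1_carrier b0_carrier]] mult_mono) auto
    have F: "0 \<le> F_bound l N \<delta> d" "F_bound l N \<delta> d \<le> p4"
    proof -
      show "0 \<le> F_bound l N \<delta> d" using F2 F3 by (simp add: F_bound_def)
      have F3': "F3 l N \<delta> d \<le> p3" using F3 le1[OF p30] by linarith
      have F2': "F2 N \<delta> d \<le> p2" using F2 le1[OF p20] by linarith
      have "F_bound l N \<delta> d \<le> 1 * p3 + (K * K * \<kappa> + p3) * p2"
        unfolding F_bound_def using F2 F3 F2' F3' nv spectral_norm_normal_inverse_le p30 K0 \<kappa>0
        by (intro add_mono mult_mono) auto
      thus "F_bound l N \<delta> d \<le> p4" by (simp add: p4_def)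
    qed
    have g: "vnorm (g_vec d (u_opt d)) \<le> \<kappa> * (\<kappa> + K * K * \<kappa>)"
    proof -
      have bc: "b_vec d (u_opt d) \<in> carrier_vec (a + (l + b))" by (rule b_vec_carrier[OF u_opt(1)])
      have z: "0\<^sub>v (a + l) @\<^sub>v u_opt d \<in> carrier_vec (a + (l + b))"
        using append_carrier_vec[of "0\<^sub>v (a + l)" "a + l" "u_opt d" b] u_opt(1) by (simp add: add.assoc)
      have "vnorm (b_vec d (u_opt d)) \<le> vnorm (b0 d) + vnorm (u_opt d)"
        using vnorm_triangle[OF b0_carrier z] by (simp add: b_vec_split[OF u_opt(1)])
      also have "\<dots> \<le> \<kappa> + K * K * \<kappa>" using b0 vnorm_minimiser_le[OF u_opt] nv by linarith
      finally have "vnorm (b_vec d (u_opt d)) \<le> \<kappa> + K * K * \<kappa>" .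
      thus ?thesis
        unfolding g_vec_def using h \<kappa>0
        by (intro order_trans[OF vnorm_mult_mat_vec_le[OF pinv_H(1) bc]] mult_mono) (auto simp: h_def)
    qed
    define G where "G = eta l N \<delta> d * vnorm (g_vec d (u_opt d))"
    have G: "0 \<le> G" "G \<le> E"
    proof -
      have hF: "0 \<le> h * F_bound l N \<delta> d" "h * F_bound l N \<delta> d \<le> \<kappa> * p4"
        using F h \<kappa>0 by (auto intro: mult_mono)
      have "G = 0 \<or> G = vnorm (g_vec d (u_opt d)) + h * F_bound l N \<delta> d"
        by (cases "vnorm (g_vec d (u_opt d)) = 0") (auto simp: G_def eta_def h_def field_simps)
      thus "0 \<le> G" "G \<le> E" using hF g E0 by (auto simp: E_def)
    qed
    have C1: "0 \<le> C1 l N \<delta> d" "C1 l N \<delta> d \<le> q1 * \<delta>"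
    proof -
      have C1_eq: "C1 l N \<delta> d = 2 * inverse (sigma_min (H_mat d)) * (sqrt l + G * N) * \<delta>"
        by (simp add: C1_def G_def mult_ac)
      show "0 \<le> C1 l N \<delta> d" unfolding C1_eq using sig G \<delta> by simp
      show "C1 l N \<delta> d \<le> q1 * \<delta>"
        unfolding C1_eq q1_def using sig G \<delta> \<kappa>0
        by (intro mult_right_mono mult_mono add_left_mono mult_left_mono) auto
    qed
    have C2: "0 \<le> C2 l N \<delta> d" "C2 l N \<delta> d \<le> q2 * \<delta>"
    proof -
      have C2_eq: "C2 l N \<delta> d = (spectral_norm (Y_f d) + N * \<delta>) * C1 l N \<delta> d + G * N * \<delta>"
        by (simp add: C2_def G_def mult_ac)
      show "0 \<le> C2 l N \<delta> d" unfolding C2_eq using C1 G \<delta> by simp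
      have "C2 l N \<delta> d \<le> (\<kappa> + N) * (q1 * \<delta>) + E * N * \<delta>"
        unfolding C2_eq using C1 G \<delta> Y \<kappa>0 le1[of "real N"]
        by (intro add_mono mult_mono mult_right_mono) auto
      thus "C2 l N \<delta> d \<le> q2 * \<delta>" by (simp add: q2_def algebra_simps)
    qed
    have C3_eq: "C3 l N \<delta> d = 8 * (C2 l N \<delta> d * C2 l N \<delta> d) + 4 * spectral_norm (Y_f d) * G * C2 l N \<delta> d"
      by (simp add: C3_def G_def power2_eq_square mult_ac)
    have "C2 l N \<delta> d \<le> q2" using C2 le1[OF q20] by linarith
    hence "C3 l N \<delta> d \<le> 8 * (q2 * (q2 * \<delta>)) + 4 * \<kappa> * E * (q2 * \<delta>)"
      unfolding C3_eq using C2 G Y \<kappa>0 q20 E0 \<delta>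
      by (intro add_mono mult_mono mult_left_mono) auto
    hence "C3 l N \<delta> d \<le> q3 * \<delta>" by (simp add: q3_def algebra_simps)
    moreover have "0 \<le> C3 l N \<delta> d" unfolding C3_eq using C2 G by simp
    ultimately show "\<bar>C3 l N \<delta> d\<bar> \<le> q3 * \<delta>" by simp
  qed
qed

text \<open>Bounds on the noiseless data suffice, since they persist under small noise.\<close>

lemma C3_linear_bound_noisy:
  fixes k :: real and l N :: nat
  assumes k: "0 < k"
  obtains q where "0 \<le> q"
    "\<And>d dh a b f \<delta>. \<lbrakk>noisy_data d dh a l b f N \<delta>; 0 < a + (l + b); a + (l + b) \<le> N;
      \<And>v. v \<in> carrier_vec (a + (l + b)) \<Longrightarrow> vnorm v \<le> k * vnorm ((H_mat d)\<^sup>T *\<^sub>v v);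
      spectral_norm (Y_f d) \<le> k; vnorm (b0 d) \<le> k; \<delta> \<le> 1; 2 * N * k * \<delta> \<le> 1\<rbrakk> \<Longrightarrow> \<bar>C3 l N \<delta> dh\<bar> \<le> q * \<delta>"
proof -
  define \<kappa> where "\<kappa> = 2 * k + N + sqrt l + 1"
  have \<kappa>: "1 \<le> \<kappa>" "2 * k \<le> \<kappa>" "k + N \<le> \<kappa>" "k + sqrt l \<le> \<kappa>" using k by (auto simp: \<kappa>_def)
  obtain q where q: "0 \<le> q" and bound: "\<And>d a b f e \<delta>. \<lbrakk>predictor d a l b f N e; 0 < a + (l + b); a + (l + b) \<le> N; 1 / e \<le> \<kappa>;
      spectral_norm (Y_f d) \<le> \<kappa>; vnorm (b0 d) \<le> \<kappa>; 0 < \<delta>; \<delta> \<le> 1\<rbrakk> \<Longrightarrow> \<bar>C3 l N \<delta> d\<bar> \<le> q * \<delta>"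
    using C3_linear_bound[OF \<kappa>(1), of l N] by metis
  show thesis
  proof (rule that[OF q])
    fix d dh a b f and \<delta> :: real
    assume nd: "noisy_data d dh a l b f N \<delta>" and r: "0 < a + (l + b)" "a + (l + b) \<le> N"
      and H: "\<And>v. v \<in> carrier_vec (a + (l + b)) \<Longrightarrow> vnorm v \<le> k * vnorm ((H_mat d)\<^sup>T *\<^sub>v v)"
      and Y: "spectral_norm (Y_f d) \<le> k" and b0: "vnorm (b0 d) \<le> k"
      and \<delta>: "\<delta> \<le> 1" "2 * N * k * \<delta> \<le> 1"
    interpret noisy_data d dh a l b f N \<delta> by (rule nd)
    have N\<delta>: "N * \<delta> \<le> N" using \<delta> by (simp add: mult_left_le)
    have P: "predictor dh a l b f N (1 / (2 * k))"
    proof unfold_locales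
      show "0 < 1 / (2 * k)" using k by simp
      fix v :: "real vec" assume v: "v \<in> carrier_vec (a + (l + b))"
      have "2 * vnorm v \<le> 2 * k * vnorm ((H_mat d)\<^sup>T *\<^sub>v v)" using H[OF v] by simp
      also have "\<dots> \<le> 2 * k * (vnorm ((H_mat dh)\<^sup>T *\<^sub>v v) + N * \<delta> * vnorm v)"
        using H_transpose_noise[OF v] k by (intro mult_left_mono) auto
      also have "\<dots> = 2 * k * vnorm ((H_mat dh)\<^sup>T *\<^sub>v v) + 2 * N * k * \<delta> * vnorm v"
        by (simp add: algebra_simps)
      also have "2 * N * k * \<delta> * vnorm v \<le> 1 * vnorm v" using \<delta>(2) by (intro mult_right_mono) auto
      finally have "vnorm v \<le> 2 * k * vnorm ((H_mat dh)\<^sup>T *\<^sub>v v)" by simp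
      thus "1 / (2 * k) * vnorm v \<le> vnorm ((H_mat dh)\<^sup>T *\<^sub>v v)" using k by (simp add: field_simps)
    qed
    have "spectral_norm (Y_f dh - Y_f d) \<le> N * \<delta>"
      using noise(1) Y_f_noise bar.dims hat.dims by (intro spectral_norm_le[of _ f N]) (auto simp: minus_carrier_mat)
    hence Yh: "spectral_norm (Y_f dh) \<le> \<kappa>"
      using spectral_norm_le_of_diff[OF hat.dims(4) bar.dims(4)] Y \<kappa> N\<delta> by linarith
    have "sqrt l * \<delta> \<le> sqrt l" using \<delta> by (simp add: mult_left_le)
    hence bh: "vnorm (b0 dh) \<le> \<kappa>"
      using vnorm_triangle_sub[OF hat.b0_carrier bar.b0_carrier] b0_noise b0 \<kappa> by linarith
    show "\<bar>C3 l N \<delta> dh\<bar> \<le> q * \<delta>"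
      by (rule bound[OF P r _ Yh bh noise(1) \<delta>(1)]) (use \<kappa> in simp)
  qed
qed

section \<open>A measurable measure of the conditioning of the data\<close>

definition entry_sum :: "real mat \<Rightarrow> real" where
  "entry_sum M = (\<Sum>i<dim_row M. \<Sum>j<dim_col M. \<bar>M $$ (i, j)\<bar>)"

lemma entry_sum_nonneg: "0 \<le> entry_sum M"
  unfolding entry_sum_def by (intro sum_nonneg) auto

lemma spectral_norm_le_entry_sum:
  assumes M: "M \<in> carrier_mat r c"
  shows "spectral_norm M \<le> entry_sum M"
proof (rule spectral_norm_le[OF M entry_sum_nonneg])
  fix x :: "real vec" assume x: "x \<in> carrier_vec c"
  have "\<bar>(M *\<^sub>v x) $ i\<bar> \<le> (\<Sum>j<c. \<bar>M $$ (i, j)\<bar>) * vnorm x" if i: "i < r" for i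
  proof -
    have "\<bar>(M *\<^sub>v x) $ i\<bar> \<le> vnorm (row M i) * vnorm x"
      using M x i by (auto intro!: Cauchy_Schwarz_vec[of _ c])
    also have "vnorm (row M i) \<le> (\<Sum>j<c. \<bar>M $$ (i, j)\<bar>)"
      using vnorm_le_sum_abs[of "row M i"] M i by simp
    finally show ?thesis by (simp add: mult_right_mono)
  qed
  hence "(\<Sum>i<r. \<bar>(M *\<^sub>v x) $ i\<bar>) \<le> (\<Sum>i<r. (\<Sum>j<c. \<bar>M $$ (i, j)\<bar>) * vnorm x)"
    by (intro sum_mono) auto
  also have "\<dots> = entry_sum M * vnorm x" using M by (simp add: entry_sum_def sum_distrib_right)
  finally show "vnorm (M *\<^sub>v x) \<le> entry_sum M * vnorm x"
    using vnorm_le_sum_abs[of "M *\<^sub>v x"] M by simp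
qed

text \<open>The singular values are awkward as functions of the outcome. Cramer's rule
  \<open>adj (H H\<^sup>T) H H\<^sup>T = det (H H\<^sup>T) I\<close> replaces the smallest one by a rational function of the entries.\<close>

lemma vnorm_le_adj_mat:
  assumes H: "(H :: real mat) \<in> carrier_mat r c" and ker: "\<And>v. v \<in> carrier_vec r \<Longrightarrow> H\<^sup>T *\<^sub>v v = 0\<^sub>v c \<Longrightarrow> v = 0\<^sub>v r"
    and v: "v \<in> carrier_vec r"
  shows "vnorm v \<le> entry_sum (adj_mat (H * H\<^sup>T) * H) / \<bar>det (H * H\<^sup>T)\<bar> * vnorm (H\<^sup>T *\<^sub>v v)"
proof -
  define G where "G = H * H\<^sup>T"
  have G: "G \<in> carrier_mat r r" using H by (simp add: G_def)
  have Ht: "H\<^sup>T \<in> carrier_mat c r" using H by simp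
  have GH: "G *\<^sub>v w = H *\<^sub>v (H\<^sup>T *\<^sub>v w)" if "w \<in> carrier_vec r" for w
    unfolding G_def by (rule assoc_mult_mat_vec[OF H Ht that])
  have "w = 0\<^sub>v r" if w: "w \<in> carrier_vec r" "G *\<^sub>v w = 0\<^sub>v r" for w
  proof (rule ker[OF w(1)])
    have Hw: "H\<^sup>T *\<^sub>v w \<in> carrier_vec c" using Ht w by auto
    have "(H\<^sup>T *\<^sub>v w) \<bullet> (H\<^sup>T *\<^sub>v w) = w \<bullet> (H *\<^sub>v (H\<^sup>T *\<^sub>v w))"
      by (rule transpose_vec_mult_scalar[OF H Hw w(1)])
    also have "\<dots> = 0" using w GH[OF w(1)] by simp
    finally show "H\<^sup>T *\<^sub>v w = 0\<^sub>v c" using scalar_prod_self_eq_0[OF Hw] by simp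
  qed
  hence det: "det G \<noteq> 0" using det_0_iff_vec_prod_zero_field[OF G] by blast
  note adj = adj_mat[OF G]
  have AH: "adj_mat G * H \<in> carrier_mat r c" using adj H by auto
  have Hv: "H\<^sup>T *\<^sub>v v \<in> carrier_vec c" using Ht v by auto
  have "(adj_mat G * H) *\<^sub>v (H\<^sup>T *\<^sub>v v) = adj_mat G *\<^sub>v (G *\<^sub>v v)"
    unfolding GH[OF v] by (rule assoc_mult_mat_vec[OF adj(1) H Hv])
  also have "\<dots> = (adj_mat G * G) *\<^sub>v v" by (rule assoc_mult_mat_vec[OF adj(1) G v, symmetric])
  also have "\<dots> = det G \<cdot>\<^sub>v v" unfolding adj(3) using v by (simp add: smult_mat_mult_vec[of _ r r])
  finally have "\<bar>det G\<bar> * vnorm v = vnorm ((adj_mat G * H) *\<^sub>v (H\<^sup>T *\<^sub>v v))" by simp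
  also have "\<dots> \<le> entry_sum (adj_mat G * H) * vnorm (H\<^sup>T *\<^sub>v v)"
    using spectral_norm_le_entry_sum[OF AH]
    by (intro order_trans[OF vnorm_mult_mat_vec_le[OF AH Hv]] mult_right_mono) auto
  finally show ?thesis using det by (simp add: G_def[symmetric] field_simps)
qed

text \<open>The type of matrices carries no topology, so measurability is meant entrywise.\<close>

definition measurable_mat :: "'w measure \<Rightarrow> nat \<Rightarrow> nat \<Rightarrow> ('w \<Rightarrow> real mat) \<Rightarrow> bool" where
  "measurable_mat M r c F \<longleftrightarrow> (\<forall>\<omega>. F \<omega> \<in> carrier_mat r c) \<and>
    (\<forall>i<r. \<forall>j<c. (\<lambda>\<omega>. F \<omega> $$ (i, j)) \<in> borel_measurable M)"

lemma measurable_mat_transpose: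
  assumes "measurable_mat M r c F"
  shows "measurable_mat M c r (\<lambda>\<omega>. (F \<omega>)\<^sup>T)"
proof -
  have "(\<lambda>\<omega>. (F \<omega>)\<^sup>T $$ (i, j)) = (\<lambda>\<omega>. F \<omega> $$ (j, i))" if "i < c" "j < r" for i j
    using assms that by (intro ext index_transpose_mat) (auto simp: measurable_mat_def)
  thus ?thesis using assms by (auto simp: measurable_mat_def)
qed

lemma measurable_mat_mult:
  assumes "measurable_mat M r k F" "measurable_mat M k c G"
  shows "measurable_mat M r c (\<lambda>\<omega>. F \<omega> * G \<omega>)"
proof -
  have "(\<lambda>\<omega>. (F \<omega> * G \<omega>) $$ (i, j)) = (\<lambda>\<omega>. \<Sum>h<k. F \<omega> $$ (i, h) * G \<omega> $$ (h, j))" if "i < r" "j < c" for i j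
  proof (rule ext)
    fix \<omega>
    have "F \<omega> \<in> carrier_mat r k" "G \<omega> \<in> carrier_mat k c" using assms by (auto simp: measurable_mat_def)
    thus "(F \<omega> * G \<omega>) $$ (i, j) = (\<Sum>h<k. F \<omega> $$ (i, h) * G \<omega> $$ (h, j))"
      using that by (simp add: scalar_prod_def atLeast0LessThan)
  qed
  moreover have "F \<omega> * G \<omega> \<in> carrier_mat r c" for \<omega>
    using assms mult_carrier_mat[of "F \<omega>" r k "G \<omega>" c] by (auto simp: measurable_mat_def)
  ultimately show ?thesis using assms
    by (auto simp: measurable_mat_def intro!: borel_measurable_sum borel_measurable_times)
qed

lemma measurable_mat_det:
  assumes "measurable_mat M k k F"
  shows "(\<lambda>\<omega>. det (F \<omega>)) \<in> borel_measurable M"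
proof -
  have "(\<lambda>\<omega>. det (F \<omega>)) = (\<lambda>\<omega>. \<Sum>p | p permutes {0..<k}. signof p * (\<Prod>i = 0..<k. F \<omega> $$ (i, p i)))"
    using assms by (intro ext det_def') (auto simp: measurable_mat_def)
  moreover have "p i < k" if "p permutes {0..<k}" "i < k" for p i
    using permutes_in_image[OF that(1), of i] that(2) by simp
  ultimately show ?thesis using assms
    by (auto simp: measurable_mat_def intro!: borel_measurable_sum borel_measurable_times borel_measurable_prod)
qed

lemma measurable_mat_adj:
  assumes F: "measurable_mat M k k F"
  shows "measurable_mat M k k (\<lambda>\<omega>. adj_mat (F \<omega>))"
proof -
  have c: "F \<omega> \<in> carrier_mat k k" for \<omega> using F by (auto simp: measurable_mat_def)
  have entry: "(\<lambda>\<omega>. F \<omega> $$ (i, j)) \<in> borel_measurable M" if "i < k" "j < k" for i j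
    using F that by (auto simp: measurable_mat_def)
  have del: "measurable_mat M (k - 1) (k - 1) (\<lambda>\<omega>. mat_delete (F \<omega>) i j)" if "i < k" "j < k" for i j
  proof -
    have "(\<lambda>\<omega>. mat_delete (F \<omega>) i j $$ (i', j')) \<in> borel_measurable M"
      if "i' < k - 1" "j' < k - 1" for i' j'
    proof -
      have "(\<lambda>\<omega>. mat_delete (F \<omega>) i j $$ (i', j'))
        = (\<lambda>\<omega>. F \<omega> $$ (if i' < i then i' else Suc i', if j' < j then j' else Suc j'))"
        using that by (intro ext) (simp add: mat_delete_def carrier_matD[OF c])
      also have "\<dots> \<in> borel_measurable M" by (rule entry) (use that in auto)
      finally show ?thesis .
    qed
    moreover have "mat_delete (F \<omega>) i j \<in> carrier_mat (k - 1) (k - 1)" for \<omega>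
      by (rule mat_delete_carrier[OF c])
    ultimately show ?thesis by (simp add: measurable_mat_def)
  qed
  have "(\<lambda>\<omega>. adj_mat (F \<omega>) $$ (i, j)) \<in> borel_measurable M" if "i < k" "j < k" for i j
  proof -
    have "(\<lambda>\<omega>. adj_mat (F \<omega>) $$ (i, j)) = (\<lambda>\<omega>. (- 1) ^ (j + i) * det (mat_delete (F \<omega>) j i))"
      using that by (intro ext) (simp add: adj_mat_def cofactor_def carrier_matD[OF c])
    also have "\<dots> \<in> borel_measurable M"
      by (intro borel_measurable_times borel_measurable_const measurable_mat_det[OF del] that)
    finally show ?thesis .
  qed
  moreover have "adj_mat (F \<omega>) \<in> carrier_mat k k" for \<omega> by (rule adj_mat(1)[OF c])
  ultimately show ?thesis by (simp add: measurable_mat_def)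
qed

lemma measurable_mat_append_rows:
  assumes F: "measurable_mat M r1 c F" and G: "measurable_mat M r2 c G"
  shows "measurable_mat M (r1 + r2) c (\<lambda>\<omega>. F \<omega> @\<^sub>r G \<omega>)"
proof -
  have c: "F \<omega> \<in> carrier_mat r1 c" "G \<omega> \<in> carrier_mat r2 c" for \<omega>
    using F G by (auto simp: measurable_mat_def)
  have "(\<lambda>\<omega>. (F \<omega> @\<^sub>r G \<omega>) $$ (i, j)) \<in> borel_measurable M" if ij: "i < r1 + r2" "j < c" for i j
  proof (cases "i < r1")
    case True
    hence "(\<lambda>\<omega>. (F \<omega> @\<^sub>r G \<omega>) $$ (i, j)) = (\<lambda>\<omega>. F \<omega> $$ (i, j))"
      using ij by (simp add: append_rows_def carrier_matD[OF c(1)] carrier_matD[OF c(2)])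
    thus ?thesis using F True ij by (simp add: measurable_mat_def)
  next
    case False
    hence "(\<lambda>\<omega>. (F \<omega> @\<^sub>r G \<omega>) $$ (i, j)) = (\<lambda>\<omega>. G \<omega> $$ (i - r1, j))"
      using ij by (simp add: append_rows_def carrier_matD[OF c(1)] carrier_matD[OF c(2)])
    thus ?thesis using G False ij by (simp add: measurable_mat_def)
  qed
  thus ?thesis using carrier_append_rows[OF c] by (simp add: measurable_mat_def)
qed

lemma measurable_entry_sum:
  assumes F: "measurable_mat M r c F"
  shows "(\<lambda>\<omega>. entry_sum (F \<omega>)) \<in> borel_measurable M"
proof -
  have c: "F \<omega> \<in> carrier_mat r c" for \<omega> using F by (auto simp: measurable_mat_def)
  have "(\<lambda>\<omega>. entry_sum (F \<omega>)) = (\<lambda>\<omega>. \<Sum>i<r. \<Sum>j<c. \<bar>F \<omega> $$ (i, j)\<bar>)"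
    by (simp add: entry_sum_def carrier_matD[OF c])
  thus ?thesis using F by (auto simp: measurable_mat_def intro!: borel_measurable_sum borel_measurable_abs)
qed

text \<open>One number that controls the inverse of the smallest singular value and the size of the data. It
  is meaningful for data matrices of full row rank, where the determinant does not vanish; the last
  summand only keeps it positive.\<close>

definition conditioning :: "data \<Rightarrow> real" where
  "conditioning d = (let H = H_mat d in
     entry_sum (adj_mat (H * H\<^sup>T) * H) / \<bar>det (H * H\<^sup>T)\<bar>
     + entry_sum (Y_f d) + (\<Sum>i<dim_vec (b0 d). \<bar>b0 d $ i\<bar>) + 1)"

lemma (in data_dims) conditioning:
  assumes "\<And>v. v \<in> carrier_vec (a + (l + b)) \<Longrightarrow> (H_mat d)\<^sup>T *\<^sub>v v = 0\<^sub>v N \<Longrightarrow> v = 0\<^sub>v (a + (l + b))"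
  shows "0 < conditioning d" "spectral_norm (Y_f d) \<le> conditioning d" "vnorm (b0 d) \<le> conditioning d"
    "v \<in> carrier_vec (a + (l + b)) \<Longrightarrow> vnorm v \<le> conditioning d * vnorm ((H_mat d)\<^sup>T *\<^sub>v v)"
proof -
  let ?H = "H_mat d"
  define s where "s = entry_sum (adj_mat (?H * ?H\<^sup>T) * ?H) / \<bar>det (?H * ?H\<^sup>T)\<bar>"
  define t where "t = entry_sum (Y_f d)"
  define w where "w = (\<Sum>i<dim_vec (b0 d). \<bar>b0 d $ i\<bar>)"
  have eq: "conditioning d = s + t + w + 1" by (simp add: conditioning_def Let_def s_def t_def w_def)
  have nn: "0 \<le> s" "0 \<le> t" "0 \<le> w" by (auto simp: s_def t_def w_def entry_sum_nonneg sum_nonneg)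
  show "0 < conditioning d" using nn by (simp add: eq)
  show "spectral_norm (Y_f d) \<le> conditioning d"
    using spectral_norm_le_entry_sum[OF dims(4)] nn by (simp add: eq t_def)
  show "vnorm (b0 d) \<le> conditioning d" using vnorm_le_sum_abs[of "b0 d"] nn by (simp add: eq w_def)
  show "vnorm v \<le> conditioning d * vnorm (?H\<^sup>T *\<^sub>v v)" if "v \<in> carrier_vec (a + (l + b))"
  proof -
    have "vnorm v \<le> s * vnorm (?H\<^sup>T *\<^sub>v v)" unfolding s_def by (rule vnorm_le_adj_mat[OF H_carrier assms that])
    also have "\<dots> \<le> conditioning d * vnorm (?H\<^sup>T *\<^sub>v v)" using nn by (intro mult_right_mono) (auto simp: eq)
    finally show ?thesis .
  qed
qed

lemma measurable_conditioning:
  assumes U: "measurable_mat M a N (\<lambda>\<omega>. U_p (d \<omega>))" and Yp: "measurable_mat M l N (\<lambda>\<omega>. Y_p (d \<omega>))"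
    and Uf: "measurable_mat M b N (\<lambda>\<omega>. U_f (d \<omega>))" and Yf: "measurable_mat M f N (\<lambda>\<omega>. Y_f (d \<omega>))"
    and up: "\<And>\<omega>. u_p (d \<omega>) \<in> carrier_vec a" "\<And>i. i < a \<Longrightarrow> (\<lambda>\<omega>. u_p (d \<omega>) $ i) \<in> borel_measurable M"
    and yp: "\<And>\<omega>. y_p (d \<omega>) \<in> carrier_vec l" "\<And>i. i < l \<Longrightarrow> (\<lambda>\<omega>. y_p (d \<omega>) $ i) \<in> borel_measurable M"
  shows "(\<lambda>\<omega>. conditioning (d \<omega>)) \<in> borel_measurable M"
proof -
  have H: "measurable_mat M (a + (l + b)) N (\<lambda>\<omega>. H_mat (d \<omega>))"
    unfolding H_mat_def by (intro measurable_mat_append_rows U Yp Uf)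
  have G: "measurable_mat M (a + (l + b)) (a + (l + b)) (\<lambda>\<omega>. H_mat (d \<omega>) * (H_mat (d \<omega>))\<^sup>T)"
    by (intro measurable_mat_mult[OF H] measurable_mat_transpose H)
  have b0: "(\<Sum>i<dim_vec (b0 (d \<omega>)). \<bar>b0 (d \<omega>) $ i\<bar>) = (\<Sum>i<a. \<bar>u_p (d \<omega>) $ i\<bar>) + (\<Sum>i<l. \<bar>y_p (d \<omega>) $ i\<bar>)" for \<omega>
  proof -
    have dim: "dim_row (U_f (d \<omega>)) = b" using Uf by (auto simp: measurable_mat_def)
    have "dim_vec (b0 (d \<omega>)) = a + (l + b)" using up(1)[of \<omega>] yp(1)[of \<omega>] by (simp add: b0_def b_vec_def dim)
    thus ?thesis using up(1)[of \<omega>] yp(1)[of \<omega>] by (simp add: sum_lessThan_add b0_def b_vec_def dim)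
  qed
  show ?thesis
    unfolding conditioning_def Let_def b0
    by (intro borel_measurable_add borel_measurable_divide borel_measurable_sum borel_measurable_abs borel_measurable_const
        measurable_entry_sum[OF measurable_mat_mult[OF measurable_mat_adj[OF G] H]]
        measurable_entry_sum[OF Yf] measurable_mat_det[OF G] up(2) yp(2)) auto
qed

section \<open>Convergence in probability\<close>

lemma outer_measure_of_le:
  assumes "A \<subseteq> B" "B \<in> sets M"
  shows "outer_measure_of M A \<le> emeasure M B"
  unfolding outer_measure_of_def using assms by (intro INF_lower) auto

text \<open>A random modulus of continuity must be measurable to be of use here: outer measures are not
  continuous along decreasing sequences of arbitrary sets. The exceptional null sets may depend on the
  parameter.\<close>

lemma tendsto_in_prob_of_linear_bound:
  fixes X :: "real \<Rightarrow> 'w \<Rightarrow> real" and R :: "'w \<Rightarrow> real"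
  assumes M: "prob_space M" and R: "R \<in> borel_measurable M"
    and bound: "\<And>k. 0 < k \<Longrightarrow> \<exists>q \<delta>0. 0 \<le> q \<and> 0 < \<delta>0 \<and>
      (\<forall>\<delta>. 0 < \<delta> \<and> \<delta> < \<delta>0 \<longrightarrow> (AE \<omega> in M. R \<omega> \<le> k \<longrightarrow> \<bar>X \<delta> \<omega>\<bar> \<le> q * \<delta>))"
  shows "tendsto_in_prob M X 0 (at_right 0)"
  unfolding tendsto_in_prob_def
proof (intro allI impI)
  interpret prob_space M by (rule M)
  fix \<epsilon> :: real assume \<epsilon>: "0 < \<epsilon>"
  define A where "A k = {\<omega> \<in> space M. real (Suc k) < R \<omega>}" for k
  have A: "A k \<in> sets M" for k unfolding A_def using R by measurable
  have "(\<lambda>k. emeasure M (A k)) \<longlonglongrightarrow> emeasure M (\<Inter>k. A k)"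
  proof (rule Lim_emeasure_decseq)
    show "decseq A" by (auto simp: decseq_def A_def)
  qed (use A in auto)
  moreover have "(\<Inter>k. A k) = {}"
  proof -
    have "\<exists>k. \<not> real (Suc k) < R \<omega>" for \<omega>
      using reals_Archimedean2[of "R \<omega>"] by (metis less_Suc_eq not_less_iff_gr_or_eq of_nat_less_iff order_less_trans)
    thus ?thesis by (auto simp: A_def)
  qed
  ultimately have lim: "(\<lambda>k. emeasure M (A k)) \<longlonglongrightarrow> 0" by simp
  show "((\<lambda>\<delta>. outer_measure_of M {\<omega> \<in> space M. \<bar>X \<delta> \<omega> - 0\<bar> > \<epsilon>}) \<longlongrightarrow> 0) (at_right 0)"
  proof (rule order_tendstoI)
    fix s :: ennreal assume "0 < s"
    then obtain k where k: "emeasure M (A k) < s"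
      using order_tendstoD(2)[OF lim] by (metis eventually_sequentially order_refl)
    obtain q \<delta>0 where q: "0 \<le> q" "0 < \<delta>0" and le: "\<And>\<delta>. 0 < \<delta> \<Longrightarrow> \<delta> < \<delta>0 \<Longrightarrow>
        (AE \<omega> in M. R \<omega> \<le> real (Suc k) \<longrightarrow> \<bar>X \<delta> \<omega>\<bar> \<le> q * \<delta>)"
      using bound[of "real (Suc k)"] by auto
    define \<delta>1 where "\<delta>1 = min \<delta>0 (\<epsilon> / (q + 1))"
    have \<delta>1: "0 < \<delta>1" using q \<epsilon> by (simp add: \<delta>1_def)
    have "outer_measure_of M {\<omega> \<in> space M. \<bar>X \<delta> \<omega> - 0\<bar> > \<epsilon>} < s" if \<delta>: "0 < \<delta>" "\<delta> < \<delta>1" for \<delta>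
    proof -
      have "q * \<delta> \<le> (q + 1) * \<delta>" using \<delta> by simp
      also have "\<dots> \<le> \<epsilon>" using \<delta> q by (simp add: \<delta>1_def field_simps)
      finally have q\<delta>: "q * \<delta> \<le> \<epsilon>" .
      obtain Z where Z: "{\<omega> \<in> space M. \<not> (R \<omega> \<le> real (Suc k) \<longrightarrow> \<bar>X \<delta> \<omega>\<bar> \<le> q * \<delta>)} \<subseteq> Z"
          "emeasure M Z = 0" "Z \<in> sets M"
        using le[of \<delta>] \<delta> by (auto simp: \<delta>1_def elim: AE_E)
      have "{\<omega> \<in> space M. \<bar>X \<delta> \<omega> - 0\<bar> > \<epsilon>} \<subseteq> A k \<union> Z" using Z(1) q\<delta> by (force simp: A_def)
      hence "outer_measure_of M {\<omega> \<in> space M. \<bar>X \<delta> \<omega> - 0\<bar> > \<epsilon>} \<le> emeasure M (A k \<union> Z)"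
        using A Z(3) by (intro outer_measure_of_le) auto
      also have "\<dots> \<le> emeasure M (A k) + emeasure M Z" using A Z(3) by (rule emeasure_subadditive)
      also have "\<dots> < s" using k Z(2) by simp
      finally show ?thesis .
    qed
    thus "\<forall>\<^sub>F \<delta> in at_right 0. outer_measure_of M {\<omega> \<in> space M. \<bar>X \<delta> \<omega> - 0\<bar> > \<epsilon>} < s"
      using \<delta>1 by (auto simp: eventually_at_right_field)
  qed simp
qed

section \<open>Suboptimality of the robust input and vanishing of the bound\<close>

text \<open>Noiseless states and outputs are linear functions of the inputs, and so are measurable.\<close>

lemma measurable_conditioning_mk_data:
  fixes x u y ur yr :: "'w \<Rightarrow> nat \<Rightarrow> real vec"
  assumes L: "0 < L" "lp < L"
    and system: "A \<in> carrier_mat n n" "B \<in> carrier_mat n m" "C \<in> carrier_mat 1 n" "D \<in> carrier_mat 1 m"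
    and x1: "\<And>\<omega>. \<omega> \<in> space M \<Longrightarrow> x \<omega> 1 = 0\<^sub>v n"
    and traj: "\<And>\<omega>. \<omega> \<in> space M \<Longrightarrow> is_trajectory A B C D 1 T (x \<omega>) (u \<omega>) (y \<omega>)"
    and um: "\<And>t i. t \<in> {1..T} \<Longrightarrow> i < m \<Longrightarrow> (\<lambda>\<omega>. u \<omega> t $ i) \<in> borel_measurable M"
    and urm: "\<And>t i. t \<in> {1..lp} \<Longrightarrow> i < m \<Longrightarrow> (\<lambda>\<omega>. ur \<omega> t $ i) \<in> borel_measurable M"
    and yrm: "\<And>t. t \<in> {1..lp} \<Longrightarrow> (\<lambda>\<omega>. yr \<omega> t $ 0) \<in> borel_measurable M"
  shows "(\<lambda>\<omega>. conditioning (mk_data m 1 L lp T (u \<omega>) (y \<omega>) (ur \<omega>) (yr \<omega>))) \<in> borel_measurable M"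
proof -
  let ?d = "\<lambda>\<omega>. mk_data m 1 L lp T (u \<omega>) (y \<omega>) (ur \<omega>) (yr \<omega>)"
  have tr: "x \<omega> t \<in> carrier_vec n" "u \<omega> t \<in> carrier_vec m" "x \<omega> (Suc t) = A *\<^sub>v x \<omega> t + B *\<^sub>v u \<omega> t"
      "y \<omega> t = C *\<^sub>v x \<omega> t + D *\<^sub>v u \<omega> t" if "\<omega> \<in> space M" "t \<in> {1..T}" for \<omega> t
    using traj[OF that(1)] that(2) system by (auto simp: is_trajectory_def)
  have lin: "(\<lambda>\<omega>. (F *\<^sub>v x \<omega> t + G *\<^sub>v u \<omega> t) $ i) \<in> borel_measurable M"
    if t: "t \<in> {1..T}" and FG: "F \<in> carrier_mat r n" "G \<in> carrier_mat r m" and i: "i < r"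
      and xm: "\<And>k. k < n \<Longrightarrow> (\<lambda>\<omega>. x \<omega> t $ k) \<in> borel_measurable M" for F G r t i
  proof -
    have "(F *\<^sub>v x \<omega> t + G *\<^sub>v u \<omega> t) $ i = (\<Sum>k<n. F $$ (i, k) * x \<omega> t $ k) + (\<Sum>k<m. G $$ (i, k) * u \<omega> t $ k)"
      if "\<omega> \<in> space M" for \<omega>
      using tr[OF that t] FG i by (simp add: scalar_prod_def atLeast0LessThan)
    moreover have "(\<lambda>\<omega>. (\<Sum>k<n. F $$ (i, k) * x \<omega> t $ k) + (\<Sum>k<m. G $$ (i, k) * u \<omega> t $ k)) \<in> borel_measurable M"
      using xm um[OF t] by (intro borel_measurable_add borel_measurable_sum borel_measurable_times borel_measurable_const) auto
    ultimately show ?thesis by (simp cong: measurable_cong)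
  qed
  have xm: "(\<lambda>\<omega>. x \<omega> (Suc t) $ i) \<in> borel_measurable M" if "Suc t \<le> T" "i < n" for t i
    using that
  proof (induction t arbitrary: i)
    case 0
    have "x \<omega> (Suc 0) $ i = 0" if "\<omega> \<in> space M" for \<omega> using x1[OF that] 0 by simp
    thus ?case by (simp cong: measurable_cong)
  next
    case (Suc t)
    have t: "Suc t \<in> {1..T}" using Suc.prems by simp
    have "(\<lambda>\<omega>. (A *\<^sub>v x \<omega> (Suc t) + B *\<^sub>v u \<omega> (Suc t)) $ i) \<in> borel_measurable M"
      by (rule lin[OF t system(1,2) Suc.prems(2)]) (use Suc in auto)
    thus ?case using tr(3)[OF _ t] by (simp cong: measurable_cong)
  qed
  have ym: "(\<lambda>\<omega>. y \<omega> t $ 0) \<in> borel_measurable M" if t: "t \<in> {1..T}" for t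
  proof -
    obtain t' where t': "t = Suc t'" using t by (cases t) auto
    have "(\<lambda>\<omega>. (C *\<^sub>v x \<omega> t + D *\<^sub>v u \<omega> t) $ 0) \<in> borel_measurable M"
      by (rule lin[OF t system(3,4)]) (use xm[of t'] t t' in auto)
    thus ?thesis using tr(4)[OF _ t] by (simp cong: measurable_cong)
  qed
  have time: "j * L + 1 + \<tau> \<in> {1..T}" if "j < T div L" "\<tau> < L" for j \<tau>
  proof -
    have "Suc j * L \<le> T" using that L by (simp add: less_eq_div_iff_mult_less_eq Suc_le_eq[symmetric])
    thus ?thesis using that by simp
  qed
  note dims = data_dims.dims[OF mk_data_dims[OF L]]
  note idx = mk_data_index[OF L]
  have div: "i div m < k" "i mod m < m" if "i < m * k" for i k
  proof -
    have "0 < m" using that by (cases m) auto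
    thus "i div m < k" "i mod m < m" using that by (auto simp: less_mult_imp_div_less mult.commute)
  qed
  show ?thesis
  proof (rule measurable_conditioning)
    show "measurable_mat M (m * lp) (T div L) (\<lambda>\<omega>. U_p (?d \<omega>))"
      unfolding measurable_mat_def
    proof (intro conjI allI impI dims)
      fix i j assume i: "i < m * lp" and j: "j < T div L"
      have "(\<lambda>\<omega>. u \<omega> (j * L + 1 + i div m) $ (i mod m)) \<in> borel_measurable M"
        using div[OF i] L by (intro um time[OF j]) auto
      thus "(\<lambda>\<omega>. U_p (?d \<omega>) $$ (i, j)) \<in> borel_measurable M"
        by (simp only: idx(1)[OF j i])
    qed
    show "measurable_mat M lp (T div L) (\<lambda>\<omega>. Y_p (?d \<omega>))"
      unfolding measurable_mat_def
    proof (intro conjI allI impI dims)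
      fix i j assume i: "i < lp" and j: "j < T div L"
      have "(\<lambda>\<omega>. y \<omega> (j * L + 1 + i) $ 0) \<in> borel_measurable M"
        using i L by (intro ym time[OF j]) auto
      thus "(\<lambda>\<omega>. Y_p (?d \<omega>) $$ (i, j)) \<in> borel_measurable M"
        by (simp only: idx(3)[OF j i])
    qed
    show "measurable_mat M (m * (L - lp)) (T div L) (\<lambda>\<omega>. U_f (?d \<omega>))"
      unfolding measurable_mat_def
    proof (intro conjI allI impI dims)
      fix i j assume i: "i < m * (L - lp)" and j: "j < T div L"
      have "(\<lambda>\<omega>. u \<omega> (j * L + 1 + (lp + i div m)) $ (i mod m)) \<in> borel_measurable M"
        using div[OF i] by (intro um time[OF j]) auto
      thus "(\<lambda>\<omega>. U_f (?d \<omega>) $$ (i, j)) \<in> borel_measurable M"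
        by (simp only: idx(2)[OF j i])
    qed
    show "measurable_mat M (L - lp) (T div L) (\<lambda>\<omega>. Y_f (?d \<omega>))"
      unfolding measurable_mat_def
    proof (intro conjI allI impI dims)
      fix i j assume i: "i < L - lp" and j: "j < T div L"
      have "(\<lambda>\<omega>. y \<omega> (j * L + 1 + (lp + i)) $ 0) \<in> borel_measurable M"
        using i by (intro ym time[OF j]) auto
      thus "(\<lambda>\<omega>. Y_f (?d \<omega>) $$ (i, j)) \<in> borel_measurable M"
        by (simp only: idx(4)[OF j i])
    qed
    fix \<omega>
    show "u_p (?d \<omega>) \<in> carrier_vec (m * lp)"
      "y_p (?d \<omega>) \<in> carrier_vec lp" by (rule dims)+
  next
    fix i assume i: "i < m * lp"
    have "(\<lambda>\<omega>. ur \<omega> (1 + i div m) $ (i mod m)) \<in> borel_measurable M"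
      using div[OF i] by (intro urm) auto
    thus "(\<lambda>\<omega>. u_p (?d \<omega>) $ i) \<in> borel_measurable M"
      using i by (simp add: mk_data_def col_seq_def)
  next
    fix i assume i: "i < lp"
    have "(\<lambda>\<omega>. yr \<omega> (1 + i) $ 0) \<in> borel_measurable M" using i by (intro yrm) auto
    thus "(\<lambda>\<omega>. y_p (?d \<omega>) $ i) \<in> borel_measurable M"
      using i by (simp add: mk_data_def col_seq_def)
  qed
qed

theorem theorem16:
  fixes A B C D :: "real mat" and n m p L T lp lh :: nat
    and M :: "'w measure" and Q :: "(nat \<Rightarrow> real) measure"
    and u x y ur yr :: "'w \<Rightarrow> nat \<Rightarrow> real vec"
    and yhat yrhat :: "real \<Rightarrow> 'w \<Rightarrow> nat \<Rightarrow> real vec"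
    and d :: "'w \<Rightarrow> data" and dhat :: "real \<Rightarrow> 'w \<Rightarrow> data"
  assumes system: "A \<in> carrier_mat n n" "B \<in> carrier_mat n m"
      "C \<in> carrier_mat p n" "D \<in> carrier_mat p m" "0 < n" "0 < m"
    and miso: "p = 1"
    and minimal: "controllable A B" "observable A C"
    and lp: "lp = obs_index A C" "lp < L"
    and lh: "lh = T div L"
    and M: "prob_space M"
    and historical: "\<And>\<omega>. \<omega> \<in> space M \<Longrightarrow> x \<omega> 1 = 0\<^sub>v n"
      "\<And>\<omega>. \<omega> \<in> space M \<Longrightarrow> is_trajectory A B C D 1 T (x \<omega>) (u \<omega>) (y \<omega>)"
      "\<And>t i. t \<in> {1..T} \<Longrightarrow> i < m \<Longrightarrow> (\<lambda>\<omega>. u \<omega> t $ i) \<in> borel_measurable M"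
    and Q: "prob_space Q" "sets Q = sets (Rn_borel (m * L))" "null_on_subspaces (m * L) Q"
    and iid: "prob_space.indep_vars M (\<lambda>_. Rn_borel (m * L)) (\<lambda>k \<omega>. block m L (u \<omega>) k) {0..4 * L}"
      "\<And>k. k \<in> {0..4 * L} \<Longrightarrow> distr M (Rn_borel (m * L)) (\<lambda>\<omega>. block m L (u \<omega>) k) = Q"
    and T: "4 * L\<^sup>2 + L \<le> T"
    and exciting: "AE \<omega> in M. page_exciting m L (n + 1) T (u \<omega>)"
    and recent: "\<And>\<omega>. \<omega> \<in> space M \<Longrightarrow> \<exists>xr. is_trajectory A B C D 1 lp xr (ur \<omega>) (yr \<omega>)"
      "\<And>t i. t \<in> {1..lp} \<Longrightarrow> i < m \<Longrightarrow> (\<lambda>\<omega>. ur \<omega> t $ i) \<in> borel_measurable M"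
      "\<And>t i. t \<in> {1..lp} \<Longrightarrow> i < p \<Longrightarrow> (\<lambda>\<omega>. yr \<omega> t $ i) \<in> borel_measurable M"
    and d: "d = (\<lambda>\<omega>. mk_data m p L lp T (u \<omega>) (y \<omega>) (ur \<omega>) (yr \<omega>))"
    and dhat: "dhat = (\<lambda>\<delta> \<omega>. mk_data m p L lp T (u \<omega>) (yhat \<delta> \<omega>) (ur \<omega>) (yrhat \<delta> \<omega>))"
    and noise: "\<And>\<delta>. 0 < \<delta> \<Longrightarrow> AE \<omega> in M. noise_bound \<delta> (dhat \<delta> \<omega>) (d \<omega>)"
  shows "(\<forall>\<delta>>0. \<forall>\<omega>\<in>space M. \<forall>ucheck ustar.
        page_exciting m L (n + 1) T (u \<omega>) \<and>
        noise_bound \<delta> (dhat \<delta> \<omega>) (d \<omega>) \<and>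
        \<delta> < sigma_min (H_mat (dhat \<delta> \<omega>)) / (2 * lh) \<and>
        g_vec (dhat \<delta> \<omega>) (u_opt (dhat \<delta> \<omega>)) \<noteq> 0\<^sub>v lh \<and>
        is_arg_min (c_worst lp lh \<delta> (dhat \<delta> \<omega>)) (\<lambda>v. v \<in> carrier_vec (m * (L - lp))) ucheck \<and>
        is_arg_min (reg_cost (d \<omega>)) (\<lambda>v. v \<in> carrier_vec (m * (L - lp))) ustar
        \<longrightarrow> reg_cost (d \<omega>) ucheck - reg_cost (d \<omega>) ustar \<le> C3 lp lh \<delta> (dhat \<delta> \<omega>))
    \<and> tendsto_in_prob M (\<lambda>\<delta> \<omega>. C3 lp lh \<delta> (dhat \<delta> \<omega>)) 0 (at_right 0)"
proof -
  have C': "C \<in> carrier_mat 1 n" "D \<in> carrier_mat 1 m" using system miso by auto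
  have L: "0 < L" using lp by simp
  have d_eq: "d \<omega> = mk_data m 1 L lp T (u \<omega>) (y \<omega>) (ur \<omega>) (yr \<omega>)" for \<omega> by (simp add: d miso)
  have dh_eq: "dhat \<delta> \<omega> = mk_data m 1 L lp T (u \<omega>) (yhat \<delta> \<omega>) (ur \<omega>) (yrhat \<delta> \<omega>)" for \<delta> \<omega>
    by (simp add: dhat miso)
  let ?a = "m * lp" and ?b = "m * (L - lp)" and ?f = "L - lp"
  let ?r = "?a + (lp + ?b)"
  have LT: "L \<le> lh"
  proof -
    have "L * L \<le> T" using T by (simp add: power2_eq_square)
    thus ?thesis using L by (simp add: lh less_eq_div_iff_mult_less_eq)
  qed
  have miso_data: "miso_data A B C D n m L lp T (x \<omega>) (u \<omega>) (y \<omega>)" if "\<omega> \<in> space M" for \<omega>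
    using system C' minimal lp historical(2)[OF that] by unfold_locales auto
  have r_pos: "0 < ?r" using system(6) lp by simp
  have noisy: "noisy_data (d \<omega>) (dhat \<delta> \<omega>) ?a lp ?b ?f lh \<delta>"
    if "0 < \<delta>" "noise_bound \<delta> (dhat \<delta> \<omega>) (d \<omega>)" for \<delta> \<omega>
  proof -
    interpret bar: data_dims "d \<omega>" ?a lp ?b ?f lh
      unfolding d_eq lh by (rule mk_data_dims[OF L lp(2)])
    interpret hat: data_dims "dhat \<delta> \<omega>" ?a lp ?b ?f lh
      unfolding dh_eq lh by (rule mk_data_dims[OF L lp(2)])
    show ?thesis
      by unfold_locales (use that LT lp in \<open>auto simp: d_eq dh_eq mk_data_def\<close>)
  qed
  have H_inj: "v = 0\<^sub>v ?r"
    if "\<omega> \<in> space M" "page_exciting m L (n + 1) T (u \<omega>)" "v \<in> carrier_vec ?r" "(H_mat (d \<omega>))\<^sup>T *\<^sub>v v = 0\<^sub>v lh" for \<omega> v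
    using miso_data.H_left_kernel[OF miso_data[OF that(1)], of v "ur \<omega>" "yr \<omega>"] that(2-) by (simp add: d_eq lh)
  have rows: "?r \<le> lh" if "\<omega> \<in> space M" "page_exciting m L (n + 1) T (u \<omega>)" for \<omega>
    using miso_data.H_rows_le[OF miso_data[OF that(1)]] that(2) by (simp add: lh)
  have part1: "reg_cost (d \<omega>) ucheck - reg_cost (d \<omega>) ustar \<le> C3 lp lh \<delta> (dhat \<delta> \<omega>)"
    if \<delta>: "0 < \<delta>" and \<omega>: "\<omega> \<in> space M" and exc: "page_exciting m L (n + 1) T (u \<omega>)"
      and nb: "noise_bound \<delta> (dhat \<delta> \<omega>) (d \<omega>)" and small: "\<delta> < sigma_min (H_mat (dhat \<delta> \<omega>)) / (2 * lh)"
      and nz: "g_vec (dhat \<delta> \<omega>) (u_opt (dhat \<delta> \<omega>)) \<noteq> 0\<^sub>v lh"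
      and check: "is_arg_min (c_worst lp lh \<delta> (dhat \<delta> \<omega>)) (\<lambda>v. v \<in> carrier_vec ?b) ucheck"
      and star: "is_arg_min (reg_cost (d \<omega>)) (\<lambda>v. v \<in> carrier_vec ?b) ustar"
    for \<delta> \<omega> ucheck ustar
  proof -
    interpret noisy_data "d \<omega>" "dhat \<delta> \<omega>" ?a lp ?b ?f lh \<delta> by (rule noisy[OF \<delta> nb])
    define e where "e = sigma_min (H_mat (dhat \<delta> \<omega>))"
    have lh0: "0 < lh" using LT L by simp
    have small': "2 * lh * \<delta> < e" using small lh0 by (simp add: e_def field_simps)
    have "0 < 2 * lh * \<delta>" using lh0 \<delta> by simp
    hence e: "0 < e" using small' by linarith
    have sig: "e * vnorm v \<le> vnorm ((H_mat (dhat \<delta> \<omega>))\<^sup>T *\<^sub>v v)" if "v \<in> carrier_vec ?r" for v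
      unfolding e_def by (rule sigma_min_lower[OF hat.H_carrier r_pos rows[OF \<omega> exc] that])
    interpret noisy_predictor "d \<omega>" "dhat \<delta> \<omega>" ?a lp ?b ?f lh \<delta> e
    proof unfold_locales
      show "0 < e" "0 < e / 2" using e by auto
      show "2 * lh * \<delta> \<le> e" using small' by simp
      fix v :: "real vec" assume v: "v \<in> carrier_vec ?r"
      show "e * vnorm v \<le> vnorm ((H_mat (dhat \<delta> \<omega>))\<^sup>T *\<^sub>v v)" by (rule sig[OF v])
      have "lh * \<delta> * vnorm v \<le> e / 2 * vnorm v" using small' by (intro mult_right_mono) auto
      thus "e / 2 * vnorm v \<le> vnorm ((H_mat (d \<omega>))\<^sup>T *\<^sub>v v)"
        using H_transpose_noise[OF v] sig[OF v] by (simp add: abs_le_iff)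
    next
      fix z :: "real vec" assume "z \<in> carrier_vec lh" "H_mat (d \<omega>) *\<^sub>v z = 0\<^sub>v ?r"
      thus "Y_f (d \<omega>) *\<^sub>v z = 0\<^sub>v ?f"
        using miso_data.consistent[OF miso_data[OF \<omega>], of z "ur \<omega>" "yr \<omega>"] by (simp add: d_eq lh)
    qed
    have "vnorm (g_vec (dhat \<delta> \<omega>) (u_opt (dhat \<delta> \<omega>))) \<noteq> 0"
      using nz vnorm_eq_0_imp[OF hat.g_vec_carrier[OF hat.u_opt(1)]] by blast
    thus ?thesis by (rule suboptimality[OF e_def[symmetric] _ check star])
  qed
  have part2: "tendsto_in_prob M (\<lambda>\<delta> \<omega>. C3 lp lh \<delta> (dhat \<delta> \<omega>)) 0 (at_right 0)"
  proof (rule tendsto_in_prob_of_linear_bound[OF M])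
    show "(\<lambda>\<omega>. conditioning (d \<omega>)) \<in> borel_measurable M"
      unfolding d_eq
      by (rule measurable_conditioning_mk_data[OF L lp(2) system(1,2) C' historical(1,2,3) recent(2)])
        (use recent(3) miso in auto)
    fix k :: real assume k: "0 < k"
    obtain q where q: "0 \<le> q" and bound: "\<And>d dh a b f \<delta>. \<lbrakk>noisy_data d dh a lp b f lh \<delta>; 0 < a + (lp + b); a + (lp + b) \<le> lh;
        \<And>v. v \<in> carrier_vec (a + (lp + b)) \<Longrightarrow> vnorm v \<le> k * vnorm ((H_mat d)\<^sup>T *\<^sub>v v);
        spectral_norm (Y_f d) \<le> k; vnorm (b0 d) \<le> k; \<delta> \<le> 1; 2 * lh * k * \<delta> \<le> 1\<rbrakk> \<Longrightarrow> \<bar>C3 lp lh \<delta> dh\<bar> \<le> q * \<delta>"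
      using C3_linear_bound_noisy[OF k, of lp lh] by metis
    define \<delta>0 where "\<delta>0 = min 1 (1 / (2 * lh * k + 1))"
    have "0 < 2 * lh * k + 1" using k by (simp add: add_nonneg_pos)
    hence \<delta>0: "0 < \<delta>0" by (simp add: \<delta>0_def)
    have "AE \<omega> in M. conditioning (d \<omega>) \<le> k \<longrightarrow> \<bar>C3 lp lh \<delta> (dhat \<delta> \<omega>)\<bar> \<le> q * \<delta>" if \<delta>: "0 < \<delta>" "\<delta> < \<delta>0" for \<delta>
    proof -
      have "\<delta> * (2 * lh * k + 1) < 1"
        using \<delta>(2) \<open>0 < 2 * lh * k + 1\<close> by (simp add: \<delta>0_def pos_less_divide_eq)
      hence \<delta>1: "2 * lh * k * \<delta> \<le> 1" "\<delta> \<le> 1" using \<delta> by (simp_all add: \<delta>0_def algebra_simps)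
      show ?thesis
        using AE_space exciting noise[OF \<delta>(1)]
      proof eventually_elim
        case (elim \<omega>)
        interpret noisy_data "d \<omega>" "dhat \<delta> \<omega>" ?a lp ?b ?f lh \<delta> by (rule noisy[OF \<delta>(1) elim(3)])
        note cond = bar.conditioning[OF H_inj[OF elim(1,2)]]
        show ?case
        proof
          assume le: "conditioning (d \<omega>) \<le> k"
          have "vnorm v \<le> k * vnorm ((H_mat (d \<omega>))\<^sup>T *\<^sub>v v)" if "v \<in> carrier_vec ?r" for v
            using cond(4)[OF _ _ that] mult_right_mono[OF le, of "vnorm ((H_mat (d \<omega>))\<^sup>T *\<^sub>v v)"] by simp
          thus "\<bar>C3 lp lh \<delta> (dhat \<delta> \<omega>)\<bar> \<le> q * \<delta>"
            using cond(2,3) le \<delta>1 by (intro bound[OF noisy_data_axioms r_pos rows[OF elim(1,2)]]) auto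
        qed
      qed
    qed
    thus "\<exists>q \<delta>0. 0 \<le> q \<and> 0 < \<delta>0 \<and>
        (\<forall>\<delta>. 0 < \<delta> \<and> \<delta> < \<delta>0 \<longrightarrow> (AE \<omega> in M. conditioning (d \<omega>) \<le> k \<longrightarrow> \<bar>C3 lp lh \<delta> (dhat \<delta> \<omega>)\<bar> \<le> q * \<delta>))"
      using q \<delta>0 by blast
  qed
  show ?thesis using part1 part2 by blast
qed

end
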